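(* Let $d\ge 1$ and let $(\{W(x)\}_{x\in\mathbb{R}^d},Q)$ be a real-valued continuous centered Gaussian process indexed by $\mathbb{R}^d$ satisfying the Gaussian environment assumption (stated in the context) with function $\gamma:\mathbb{R}^d\to[0,\infty)$. If $$\limsup_{|x|\to\infty}\frac{\gamma(x)\sqrt{\log\log|x|}}{|x|}<\infty,$$ then, $Q$-almost surely, the semigroup $\{P_t^W\}_{t>0}$ on $L^2(\mathbb{R}^d;\mu^W)$ is noncompact. In particular, if there exists some $p\in(0,1)$ such that $$\limsup_{|x|\to\infty}\frac{\gamma(x)\sqrt{\log\log|x|}}{|x|^p}=0,$$ then $\lambda_{\mathrm{ess}}^W=0$, $Q$-almost surely.
   Context: **Dirichlet form, semigroup, essential spectrum.** For a locally bounded measurable function $w:\mathbb{R}^d\to\mathbb{R}$, let $\mu^w(\mathrm{d}x)=e^{-w(x)}\,\mathrm{d}x$ and $\mathcal{E}^w(u,v)=\frac12\int_{\mathbb{R}^d}\nabla u\cdot\nabla v\,e^{-w}\,\mathrm{d}x$. The form $(\mathcal{E}^w,C_c^\infty(\mathbb{R}^d))$ is closable on $L^2(\mathbb{R}^d;\mu^w)$; let $(\mathcal{E}^w,\mathcal{F}^w)$ be its closure with respect to the norm $(\mathcal{E}^w(u,u)+\|u\|_{L^2(\mathbb{R}^d;\mu^w)}^2)^{1/2}$, which is a regular Dirichlet form. Let $L^w$ be the associated non-positive definite self-adjoint operator, i.e. its domain $D(L^w)\subset\mathcal{F}^w$ and $\mathcal{E}^w(u,v)=\langle -L^wu,v\rangle_{L^2(\mathbb{R}^d;\mu^w)}$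 for $u\in D(L^w)$, $v\in\mathcal{F}^w$ (formally $L^w=\frac12(\Delta-\nabla w\cdot\nabla)$). Let $\{P_t^w\}_{t>0}$ be the Markovian semigroup on $L^2(\mathbb{R}^d;\mu^w)$ generated by $L^w$, let $\sigma_{\mathrm{ess}}(-L^w)$ be the essential spectrum of $-L^w$, and $\lambda_{\mathrm{ess}}^w=\inf\sigma_{\mathrm{ess}}(-L^w)$, with $\inf\emptyset=\infty$. The semigroup is compact if and only if $\sigma_{\mathrm{ess}}(-L^w)=\emptyset$, i.e. $\lambda_{\mathrm{ess}}^w=\infty$; otherwise it is noncompact. For a random field $W$, these objects are defined realization by realization ($W$ is $Q$-a.s. continuous, hence locally bounded). **Gaussian environment assumption.** $E$ denotes expectation with respect to $Q$. (1) There is a function $\gamma:\mathbb{R}^d\to[0,\infty)$ with $\gamma(0)=0$, $\gamma(x)>0$ for $x\neq0$, and $E[(W(x)-W(y))^2]=\gamma(x-y)^2$ for all $x,y\in\mathbb{R}^d$. Moreover, there exist nondecreasing functions $\sigma_i:[0,\infty)\to[0,\infty)$, $1\le i\le l$, and positive integers $d_1,\dots,d_l$ with $d_1+\cdots+d_l=d$, such that $\gamma(x)^2=\sum_{i=1}^l\sigma_i(|x_i|)^2$ for $x=(x_1,\dots,x_l)\in\mathbb{R}^{d_1}\times\cdots\times\mathbb{R}^{d_l}$. (2) (a) $\lim_{|x|\to\infty}\gamma(x)\sqrt{\log\log|x|}/\log|x|=\infty$. (b) Every $\sigma_i$ is nondecreasing and continuously differentiable on $(0,\infty)$, and there exist constants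 $\alpha_i\in(0,1)$ and $\beta_i\in(0,1)$ such that $\sigma_i$ is regularly varying at $0$ with rate (index) $\alpha_i$ and at $\infty$ with rate (index) $\beta_i$. (c) There is a constant $c_0>0$ such that for every $1\le i\le l$, $x|\sigma_i'(x)|\le c_0\sigma_i(x)$ for all $x>0$. *)

theory Defs
  imports "HOL-Probability.Probability"
begin

section \<open>Real \<open>L\<^sup>2\<close> spaces and operators on them\<close>

text \<open>Elements of \<open>L\<^sup>2(M)\<close> are represented by square-integrable functions, and two functions
  that agree almost everywhere represent the same element. An unbounded operator \<open>A\<close> is
  represented by its graph, a set of pairs \<open>(u, A u)\<close> that is closed under changing either
  component on a null set.\<close>

definition l2 :: "'a measure \<Rightarrow> ('a \<Rightarrow> real) set" where
  "l2 M = {u \<in> borel_measurable M. integrable M (\<lambda>x. (u x)\<^sup>2)}"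

definition l2_inner :: "'a measure \<Rightarrow> ('a \<Rightarrow> real) \<Rightarrow> ('a \<Rightarrow> real) \<Rightarrow> real" where
  "l2_inner M u v = (LINT x|M. u x * v x)"

definition l2_norm :: "'a measure \<Rightarrow> ('a \<Rightarrow> real) \<Rightarrow> real" where
  "l2_norm M u = sqrt (l2_inner M u u)"

text \<open>Here \<open>l\<close> is in the resolvent set if \<open>A - l\<close> maps the domain of \<open>A\<close> onto \<open>L\<^sup>2(M)\<close> and has a
  bounded inverse; the norm bound includes injectivity. Only real \<open>l\<close> are considered: the
  operators of interest are self-adjoint, and the spectrum of the complexification of such an
  operator is real and coincides with the set below.\<close>

definition resolvent_set :: "'a measure \<Rightarrow> (('a \<Rightarrow> real) \<times> ('a \<Rightarrow> real)) set \<Rightarrow> real set" where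
  "resolvent_set M A = {l.
     (\<forall>f \<in> l2 M. \<exists>(u, g) \<in> A. AE x in M. g x - l * u x = f x) \<and>
     (\<exists>C. \<forall>(u, g) \<in> A. l2_norm M u \<le> C * l2_norm M (\<lambda>x. g x - l * u x))}"

definition l2_spectrum :: "'a measure \<Rightarrow> (('a \<Rightarrow> real) \<times> ('a \<Rightarrow> real)) set \<Rightarrow> real set" where
  "l2_spectrum M A = - resolvent_set M A"

definition eigenspace :: "(('a \<Rightarrow> real) \<times> ('a \<Rightarrow> real)) set \<Rightarrow> real \<Rightarrow> ('a \<Rightarrow> real) set" where
  "eigenspace A l = {u. (u, \<lambda>x. l * u x) \<in> A}"

definition eigenvalue_finite_mult ::
    "'a measure \<Rightarrow> (('a \<Rightarrow> real) \<times> ('a \<Rightarrow> real)) set \<Rightarrow> real \<Rightarrow> bool" where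
  "eigenvalue_finite_mult M A l \<longleftrightarrow>
     (\<exists>u \<in> eigenspace A l. \<not> (AE x in M. u x = 0)) \<and>
     (\<exists>B. finite B \<and> B \<subseteq> eigenspace A l \<and>
        (\<forall>u \<in> eigenspace A l. \<exists>c. AE x in M. u x = (\<Sum>b\<in>B. c b * b x)))"

text \<open>The essential spectrum of a self-adjoint operator: the spectrum without the isolated
  eigenvalues of finite multiplicity.\<close>

definition essential_spectrum ::
    "'a measure \<Rightarrow> (('a \<Rightarrow> real) \<times> ('a \<Rightarrow> real)) set \<Rightarrow> real set" where
  "essential_spectrum M A = l2_spectrum M A -
     {l. l isolated_in l2_spectrum M A \<and> eigenvalue_finite_mult M A l}"

text \<open>\<open>T\<close> is a strongly continuous contraction semigroup on \<open>L\<^sup>2(M)\<close> whose infinitesimal generator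
  has graph \<open>A\<close>. Only the values \<open>T t f\<close> with \<open>t > 0\<close> and \<open>f \<in> l2 M\<close> matter. Linearity and
  contractivity make \<open>T t\<close> well defined modulo null sets.\<close>

definition semigroup_generated_by :: "'a measure \<Rightarrow> (('a \<Rightarrow> real) \<times> ('a \<Rightarrow> real)) set \<Rightarrow>
    (real \<Rightarrow> ('a \<Rightarrow> real) \<Rightarrow> ('a \<Rightarrow> real)) \<Rightarrow> bool" where
  "semigroup_generated_by M A T \<longleftrightarrow>
     (\<forall>t>0. \<forall>f \<in> l2 M. T t f \<in> l2 M) \<and>
     (\<forall>t>0. \<forall>f \<in> l2 M. \<forall>g \<in> l2 M. \<forall>a b.
        AE x in M. T t (\<lambda>y. a * f y + b * g y) x = a * T t f x + b * T t g x) \<and>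
     (\<forall>t>0. \<forall>f \<in> l2 M. l2_norm M (T t f) \<le> l2_norm M f) \<and>
     (\<forall>s>0. \<forall>t>0. \<forall>f \<in> l2 M. AE x in M. T (s + t) f x = T s (T t f) x) \<and>
     (\<forall>f \<in> l2 M. ((\<lambda>t. l2_norm M (\<lambda>x. T t f x - f x)) \<longlongrightarrow> 0) (at_right 0)) \<and>
     (\<forall>u \<in> l2 M. \<forall>g \<in> l2 M. (u, g) \<in> A \<longleftrightarrow>
        ((\<lambda>t. l2_norm M (\<lambda>x. (T t u x - u x) / t - g x)) \<longlongrightarrow> 0) (at_right 0))"

definition compact_operator :: "'a measure \<Rightarrow> (('a \<Rightarrow> real) \<Rightarrow> ('a \<Rightarrow> real)) \<Rightarrow> bool" where
  "compact_operator M S \<longleftrightarrow>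
     (\<forall>f :: nat \<Rightarrow> 'a \<Rightarrow> real. (\<forall>n. f n \<in> l2 M) \<and> (\<exists>C. \<forall>n. l2_norm M (f n) \<le> C) \<longrightarrow>
        (\<exists>r g. strict_mono r \<and> g \<in> l2 M \<and>
           (\<lambda>n. l2_norm M (\<lambda>x. S (f (r n)) x - g x)) \<longlonglongrightarrow> 0))"

definition compact_semigroup ::
    "'a measure \<Rightarrow> (real \<Rightarrow> ('a \<Rightarrow> real) \<Rightarrow> ('a \<Rightarrow> real)) \<Rightarrow> bool" where
  "compact_semigroup M T \<longleftrightarrow> (\<forall>t>0. compact_operator M (T t))"


section \<open>The Dirichlet form of a potential\<close>

definition mu :: "(real ^ 'n \<Rightarrow> real) \<Rightarrow> (real ^ 'n) measure" where
  "mu w = density lborel (\<lambda>x. ennreal (exp (- w x)))"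

definition grad :: "(real ^ 'n \<Rightarrow> real) \<Rightarrow> real ^ 'n \<Rightarrow> real ^ 'n" where
  "grad u x = (\<chi> i. frechet_derivative u (at x) (axis i 1))"

primrec ck :: "nat \<Rightarrow> (real ^ 'n \<Rightarrow> real) \<Rightarrow> bool" where
  "ck 0 u \<longleftrightarrow> continuous_on UNIV u"
| "ck (Suc k) u \<longleftrightarrow> (\<forall>x. u differentiable (at x)) \<and> (\<forall>i. ck k (\<lambda>x. grad u x $ i))"

definition test_functions :: "(real ^ 'n \<Rightarrow> real) set" where
  "test_functions = {u. (\<forall>k. ck k u) \<and> compact (closure {x. u x \<noteq> 0})}"

definition pre_form ::
    "(real ^ 'n \<Rightarrow> real) \<Rightarrow> (real ^ 'n \<Rightarrow> real) \<Rightarrow> (real ^ 'n \<Rightarrow> real) \<Rightarrow> real" where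
  "pre_form w u v = 1 / 2 * (LINT x|lborel. (grad u x \<bullet> grad v x) * exp (- w x))"

text \<open>The closure of the form on test functions: \<open>u\<close> is in the form domain if it is the
  \<open>L\<^sup>2\<close>-limit of test functions that are Cauchy with respect to the form, and the closed form is
  the limit of the form along such sequences. Since the form on test functions is closable for
  locally bounded \<open>w\<close>, this limit does not depend on the sequences.\<close>

definition form_approx ::
    "(real ^ 'n \<Rightarrow> real) \<Rightarrow> (nat \<Rightarrow> real ^ 'n \<Rightarrow> real) \<Rightarrow> (real ^ 'n \<Rightarrow> real) \<Rightarrow> bool" where
  "form_approx w \<phi> u \<longleftrightarrow>
     (\<forall>n. \<phi> n \<in> test_functions) \<and>
     (\<lambda>n. l2_norm (mu w) (\<lambda>x. \<phi> n x - u x)) \<longlonglongrightarrow> 0 \<and>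
     (\<forall>\<epsilon>>0. \<exists>N. \<forall>m\<ge>N. \<forall>n\<ge>N.
        pre_form w (\<lambda>x. \<phi> m x - \<phi> n x) (\<lambda>x. \<phi> m x - \<phi> n x) < \<epsilon>)"

definition form_domain :: "(real ^ 'n \<Rightarrow> real) \<Rightarrow> (real ^ 'n \<Rightarrow> real) set" where
  "form_domain w = {u \<in> l2 (mu w). \<exists>\<phi>. form_approx w \<phi> u}"

definition dirichlet_form ::
    "(real ^ 'n \<Rightarrow> real) \<Rightarrow> (real ^ 'n \<Rightarrow> real) \<Rightarrow> (real ^ 'n \<Rightarrow> real) \<Rightarrow> real" where
  "dirichlet_form w u v = (THE e. \<forall>\<phi> \<psi>. form_approx w \<phi> u \<and> form_approx w \<psi> v \<longrightarrow>
     (\<lambda>n. pre_form w (\<phi> n) (\<psi> n)) \<longlonglongrightarrow> e)"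

text \<open>The graphs of \<open>L\<close> and \<open>-L\<close>, where \<open>L\<close> is the non-positive self-adjoint operator associated
  with the closed form.\<close>

definition generator ::
    "(real ^ 'n \<Rightarrow> real) \<Rightarrow> ((real ^ 'n \<Rightarrow> real) \<times> (real ^ 'n \<Rightarrow> real)) set" where
  "generator w = {(u, f). u \<in> form_domain w \<and> f \<in> l2 (mu w) \<and>
     (\<forall>v \<in> form_domain w. dirichlet_form w u v = l2_inner (mu w) (\<lambda>x. - f x) v)}"

definition neg_generator ::
    "(real ^ 'n \<Rightarrow> real) \<Rightarrow> ((real ^ 'n \<Rightarrow> real) \<times> (real ^ 'n \<Rightarrow> real)) set" where
  "neg_generator w = {(u, \<lambda>x. - f x) | u f. (u, f) \<in> generator w}"

text \<open>The semigroup generated by \<open>L\<close> exists and is unique up to null sets, so the choice below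
  only selects representatives. Its Markov property is a consequence.\<close>

definition semigroup_of ::
    "(real ^ 'n \<Rightarrow> real) \<Rightarrow> real \<Rightarrow> (real ^ 'n \<Rightarrow> real) \<Rightarrow> (real ^ 'n \<Rightarrow> real)" where
  "semigroup_of w = (SOME T. semigroup_generated_by (mu w) (generator w) T)"

definition noncompact_semigroup :: "(real ^ 'n \<Rightarrow> real) \<Rightarrow> bool" where
  "noncompact_semigroup w \<longleftrightarrow> \<not> compact_semigroup (mu w) (semigroup_of w)"

definition lambda_ess :: "(real ^ 'n \<Rightarrow> real) \<Rightarrow> ereal" where
  "lambda_ess w = Inf (ereal ` essential_spectrum (mu w) (neg_generator w))"


section \<open>The Gaussian environment\<close>

text \<open>Variance zero is allowed.\<close>

definition centered_gaussian :: "'w measure \<Rightarrow> ('w \<Rightarrow> real) \<Rightarrow> bool" where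
  "centered_gaussian Q X \<longleftrightarrow> X \<in> borel_measurable Q \<and>
     ((AE \<omega> in Q. X \<omega> = 0) \<or>
      (\<exists>s>0. distributed Q lborel X (\<lambda>x. ennreal (normal_density 0 s x))))"

definition centered_gaussian_process :: "'w measure \<Rightarrow> ('i \<Rightarrow> 'w \<Rightarrow> real) \<Rightarrow> bool" where
  "centered_gaussian_process Q W \<longleftrightarrow>
     (\<forall>F c. finite F \<longrightarrow> centered_gaussian Q (\<lambda>\<omega>. \<Sum>x\<in>F. c x * W x \<omega>))"

text \<open>Regular variation is used below for continuous functions on \<open>(0, \<infinity>)\<close>, so the usual
  measurability requirement is automatic.\<close>

definition regularly_varying_at_zero :: "(real \<Rightarrow> real) \<Rightarrow> real \<Rightarrow> bool" where
  "regularly_varying_at_zero f \<rho> \<longleftrightarrow> (\<forall>\<^sub>F x in at_right 0. f x > 0) \<and>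
     (\<forall>c>0. ((\<lambda>x. f (c * x) / f x) \<longlongrightarrow> c powr \<rho>) (at_right 0))"

definition regularly_varying_at_infinity :: "(real \<Rightarrow> real) \<Rightarrow> real \<Rightarrow> bool" where
  "regularly_varying_at_infinity f \<rho> \<longleftrightarrow> (\<forall>\<^sub>F x in at_top. f x > 0) \<and>
     (\<forall>c>0. ((\<lambda>x. f (c * x) / f x) \<longlongrightarrow> c powr \<rho>) at_top)"

text \<open>The splitting of \<open>\<real>\<^sup>d\<close> into \<open>\<real>\<close> to the powers \<open>d\<^sub>1, \<dots>, d\<^sub>l\<close> is given by a map \<open>b\<close> from the
  coordinates onto \<open>{1..l}\<close>: coordinate \<open>j\<close> belongs to block \<open>b j\<close>, and \<open>d\<^sub>i\<close> is the (positive)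
  number of coordinates in block \<open>i\<close>. The norm of the component of \<open>x\<close> in block \<open>i\<close> is:\<close>

definition block_norm :: "('n \<Rightarrow> nat) \<Rightarrow> nat \<Rightarrow> real ^ 'n \<Rightarrow> real" where
  "block_norm b i x = sqrt (\<Sum>j | b j = i. (x $ j)\<^sup>2)"

definition gaussian_environment ::
    "'w measure \<Rightarrow> (real ^ 'n \<Rightarrow> 'w \<Rightarrow> real) \<Rightarrow> (real ^ 'n \<Rightarrow> real) \<Rightarrow> bool" where
  "gaussian_environment Q W \<gamma> \<longleftrightarrow>
     \<gamma> 0 = 0 \<and> (\<forall>x. x \<noteq> 0 \<longrightarrow> \<gamma> x > 0) \<and>
     (\<forall>x y. (LINT \<omega>|Q. (W x \<omega> - W y \<omega>)\<^sup>2) = (\<gamma> (x - y))\<^sup>2) \<and>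
     (\<exists>(l :: nat) (b :: 'n \<Rightarrow> nat) (\<sigma> :: nat \<Rightarrow> real \<Rightarrow> real).
        range b = {1..l} \<and>
        (\<forall>i\<in>{1..l}. mono_on {0..} (\<sigma> i) \<and> (\<forall>r\<ge>0. \<sigma> i r \<ge> 0)) \<and>
        (\<forall>x. (\<gamma> x)\<^sup>2 = (\<Sum>i\<in>{1..l}. (\<sigma> i (block_norm b i x))\<^sup>2)) \<and>
        (\<forall>i\<in>{1..l}. (\<forall>r>0. \<sigma> i differentiable (at r)) \<and> continuous_on {0<..} (deriv (\<sigma> i))) \<and>
        (\<forall>i\<in>{1..l}. \<exists>\<alpha>\<in>{0<..<1}. \<exists>\<beta>\<in>{0<..<1}.
           regularly_varying_at_zero (\<sigma> i) \<alpha> \<and> regularly_varying_at_infinity (\<sigma> i) \<beta>) \<and>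
        (\<exists>c0>0. \<forall>i\<in>{1..l}. \<forall>r>0. r * \<bar>deriv (\<sigma> i) r\<bar> \<le> c0 * \<sigma> i r)) \<and>
     filterlim (\<lambda>x. \<gamma> x * sqrt (ln (ln (norm x))) / ln (norm x)) at_top at_infinity"

end

theory Submission
  imports Defs "HOL-Real_Asymp.Real_Asymp"
begin

text \<open>
  Write \<open>-L\<close> for the non-negative operator of the Dirichlet form of a potential \<open>w\<close>. Noncompactness and
  \<open>\<lambda>\<^sub>e\<^sub>s\<^sub>s = 0\<close> both follow once, for every \<open>\<eta> > 0\<close>, there are infinitely many test functions with pairwise disjoint
  supports whose energy is at most \<open>\<eta>\<close> times their squared norm. The proof has a deterministic part, which reduces
  the claim to a growth condition on \<open>w\<close> averaged over cells, and a probabilistic part, which verifies this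
  condition.

  \<^emph>\<open>Operator theory.\<close> The form is treated as the square of a closed densely defined gradient \<open>D\<close> between Hilbert
  spaces (\<open>closed_gradient\<close>), so that \<open>-L = D\<^sup>* D\<close>. Everything is expressed through the bounded operator
  \<open>G = (1 - L)\<^sup>-\<^sup>1\<close>, which is a symmetric positive contraction. For such operators polynomials that are nonnegative
  on \<open>[0,1]\<close> are mapped to positive operators, because they have Bernstein representations with almost nonnegative
  coefficients (\<open>poly_bern_representation\<close>, \<open>pcalc_pos\<close>); this gives a continuous functional calculus \<open>f(G)\<close>. With
  \<open>f(x) = exp (- t (1/x - 1))\<close> it yields the semigroup (\<open>contraction_semigroup_S\<close>). Conversely, if \<open>[0,\<epsilon>]\<close> contained no
  essential spectrum, then by compactness a cutoff \<open>f(G)\<close> to energies at most \<open>\<epsilon>\<close> would have finite rank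
  (\<open>localized_interval\<close>, \<open>localized_fin_rank_at_eigenvalue\<close>), and some combination of finitely many orthogonal
  states of energy below \<open>\<epsilon>\<close> would be annihilated by it; but states in the kernel of the cutoff have energy at least
  \<open>\<epsilon>\<close>. Hence infinitely many orthogonal states of energy at most \<open>\<eta>\<close> force essential spectrum in \<open>[0,\<epsilon>]\<close> for every
  \<open>\<epsilon> > \<eta>\<close> (\<open>low_energy_spectrum\<close>), and they also make some operator of the semigroup noncompact
  (\<open>low_energy_noncompact\<close>).

  \<^emph>\<open>The Dirichlet form.\<close> Multiplication by \<open>exp (-w/2)\<close> identifies \<open>L\<^sup>2(\<mu>\<^sup>w)\<close> with \<open>L\<^sup>2\<close> of Lebesgue measure. The
  gradient on test functions is closable by integration by parts (\<open>closable\<close>), and its closure has the spectrum and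
  the semigroup of the form (\<open>resolvent_set_eq\<close>, \<open>essential_spectrumI\<close>, \<open>semigroup_exists\<close>).

  \<^emph>\<open>Test functions.\<close> Divide the space into cubes of side \<open>L\<close>. A bump around a cube has a gradient of order \<open>1/L\<close>, so
  its energy is of order \<open>L\<^sup>-\<^sup>2\<close> times its squared norm, provided that the mass \<open>\<integral> exp (-w)\<close> of no neighbouring cube
  exceeds \<open>e\<close> times that of the central one. If all cubes far out violated this, then following a chain of neighbours
  from a cube at distance \<open>N\<close> would lead to masses exponentially large in \<open>N\<close> relative to the starting one. So it
  suffices that the masses at distance \<open>N\<close>, measured relative to \<open>exp (- w 0)\<close>, lie between \<open>exp (- N/8)\<close> and
  \<open>exp (N/8)\<close> for large \<open>N\<close> (\<open>exists_far_good_cell\<close>, \<open>noncompact_of_subexponential_cells\<close>).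

  \<^emph>\<open>The random potential.\<close> The variance of \<open>W x - W y\<close> is a sum of squares of regularly varying functions of index
  below \<open>1\<close>, and therefore at most of order \<open>\<bar>x - y\<bar>\<^sup>2\<^sup>q\<close> with some \<open>q < 1\<close> at large distances
  (\<open>regularly_varying_growth\<close>). Compare \<open>W\<close> at the origin with \<open>W\<close> at a corner of the cube (\<open>increment_tail\<close>), and the
  corner with the rest of the cube through the mass that \<open>W\<close> minus its corner value gives to the cube; since the
  increments are stationary, the expectation of the latter is bounded uniformly over the cubes
  (\<open>local_mass_expectation\<close>).
  Only polynomially many cubes lie within distance \<open>N\<close>, each of which fails with probability at most of order
  \<open>exp (- N\<^sup>1\<^sup>-\<^sup>q / 16)\<close>, so the Borel-Cantelli lemma applies (\<open>AE_noncompact\<close>).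
\<close>

section \<open>Projections in Hilbert space\<close>

text \<open>By the parallelogram law every minimizing sequence for the distance to the subspace is a Cauchy sequence.\<close>

lemma closed_subspace_projection:
  fixes S :: "'h::{real_inner,complete_space} set"
  assumes S: "subspace S" "closed S"
  shows "\<exists>y\<in>S. \<forall>z\<in>S. inner (x - y) z = 0"
proof -
  define d where "d = (INF y\<in>S. (norm (x - y))\<^sup>2)"
  have ne: "S \<noteq> {}" using S(1) subspace_0 by blast
  have bdd: "bdd_below ((\<lambda>y. (norm (x - y))\<^sup>2) ` S)"
    by (rule bdd_belowI[of _ 0]) auto
  have low: "d \<le> (norm (x - y))\<^sup>2" if "y \<in> S" for y
    unfolding d_def by (rule cINF_lower[OF bdd that])
  have "\<exists>y\<in>S. (norm (x - y))\<^sup>2 < d + 1 / (real n + 1)" for n :: nat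
  proof -
    have "d < d + 1 / (real n + 1)" by simp
    then show ?thesis unfolding d_def using cINF_less_iff[OF ne bdd] by blast
  qed
  then obtain y where yS: "\<And>n. y n \<in> S"
    and yd: "\<And>n. (norm (x - y n))\<^sup>2 < d + 1 / (real n + 1)"
    by metis
  have par: "(norm (y m - y n))\<^sup>2 \<le> 2 / (real m + 1) + 2 / (real n + 1)" for m n
  proof -
    have mid: "(1/2) *\<^sub>R (y m + y n) \<in> S"
      using S(1) yS by (simp add: subspace_add subspace_scale)
    have "(norm (y m - y n))\<^sup>2 = 2 * (norm (x - y m))\<^sup>2 + 2 * (norm (x - y n))\<^sup>2
        - 4 * (norm (x - (1/2) *\<^sub>R (y m + y n)))\<^sup>2"
      by (simp add: power2_norm_eq_inner algebra_simps inner_commute)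
    moreover have "2 * (d + 1 / (real m + 1)) + 2 * (d + 1 / (real n + 1)) - 4 * d
        = 2 / (real m + 1) + 2 / (real n + 1)" by simp
    ultimately show ?thesis using low[OF mid] yd[of m] yd[of n] by linarith
  qed
  have "Cauchy y"
  proof (rule metric_CauchyI)
    fix e :: real assume e: "0 < e"
    obtain N :: nat where N: "4 / e\<^sup>2 < real N" using reals_Archimedean2 by blast
    have "dist (y m) (y n) < e" if "m \<ge> N" "n \<ge> N" for m n
    proof -
      have "2 / (real m + 1) + 2 / (real n + 1) \<le> 2 / (real N + 1) + 2 / (real N + 1)"
        using that by (intro add_mono divide_left_mono) auto
      also have "\<dots> = 4 / (real N + 1)" by simp
      also have "\<dots> < e\<^sup>2"
      proof -
        have "0 < e\<^sup>2" "4 < real N * e\<^sup>2" using N e by (simp_all add: field_simps)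
        then have "4 < e\<^sup>2 * (real N + 1)" by (simp add: algebra_simps add_strict_increasing)
        then show ?thesis by (simp add: pos_divide_less_eq)
      qed
      finally have "(norm (y m - y n))\<^sup>2 < e\<^sup>2" using par[of m n] by linarith
      then show ?thesis using e by (simp add: dist_norm power_less_imp_less_base)
    qed
    then show "\<exists>N. \<forall>m\<ge>N. \<forall>n\<ge>N. dist (y m) (y n) < e" by blast
  qed
  then obtain p where p: "y \<longlonglongrightarrow> p" using Cauchy_convergent convergent_def by blast
  have pS: "p \<in> S" using S(2) yS p closed_sequentially by blast
  have pd: "(norm (x - p))\<^sup>2 \<le> d"
  proof (rule LIMSEQ_le)
    show "(\<lambda>n. (norm (x - y n))\<^sup>2) \<longlonglongrightarrow> (norm (x - p))\<^sup>2" by (intro tendsto_intros p)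
    have "(\<lambda>n. 1 / (real n + 1)) \<longlonglongrightarrow> 0"
      using LIMSEQ_inverse_real_of_nat by (simp add: inverse_eq_divide add.commute)
    then have "(\<lambda>n. d + 1 / (real n + 1)) \<longlonglongrightarrow> d + 0" by (intro tendsto_intros)
    then show "(\<lambda>n. d + 1 / (real n + 1)) \<longlonglongrightarrow> d" by simp
    show "\<exists>N. \<forall>n\<ge>N. (norm (x - y n))\<^sup>2 \<le> d + 1 / (real n + 1)" using yd less_imp_le by blast
  qed
  have "inner (x - p) z = 0" if z: "z \<in> S" for z
  proof (cases "z = 0")
    case False
    define t where "t = inner (x - p) z / (norm z)\<^sup>2"
    \<comment> \<open>The choice of \<open>t\<close> minimizes the distance from \<open>x\<close> to \<open>p + t z\<close>.\<close>
    have "p + t *\<^sub>R z \<in> S" using S(1) pS z by (simp add: subspace_add subspace_scale)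
    from low[OF this] pd have "(norm (x - p))\<^sup>2 \<le> (norm (x - p - t *\<^sub>R z))\<^sup>2"
      unfolding diff_diff_eq by linarith
    also have "\<dots> = (norm (x - p))\<^sup>2 - 2 * t * inner (x - p) z + t * t * (norm z)\<^sup>2"
      by (simp only: power2_norm_eq_inner)
         (simp add: inner_diff_left inner_diff_right inner_commute algebra_simps)
    also have "\<dots> = (norm (x - p))\<^sup>2 - (inner (x - p) z)\<^sup>2 / (norm z)\<^sup>2"
      using False unfolding t_def by (simp add: field_simps power2_eq_square)
    finally have "(inner (x - p) z)\<^sup>2 / (norm z)\<^sup>2 \<le> 0" by simp
    then have "(inner (x - p) z)\<^sup>2 \<le> 0" using False by (simp add: divide_le_0_iff)
    then show ?thesis by simp
  qed simp
  with pS show ?thesis by blast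
qed

lemma subspace_closure:
  fixes F :: "'h::real_normed_vector set"
  assumes F: "subspace F"
  shows "subspace (closure F)"
proof (rule subspaceI)
  show "0 \<in> closure F" using subspace_0[OF F] closure_subset by blast
next
  fix x y assume "x \<in> closure F" "y \<in> closure F"
  then obtain a b where "\<And>n. a n \<in> F" "a \<longlonglongrightarrow> x" "\<And>n. b n \<in> F" "b \<longlonglongrightarrow> y"
    unfolding closure_sequential by blast
  then show "x + y \<in> closure F"
    unfolding closure_sequential by (intro exI[of _ "\<lambda>n. a n + b n"]) (auto intro: tendsto_add subspace_add[OF F])
next
  fix c x assume "x \<in> closure F"
  then obtain a where "\<And>n. a n \<in> F" "a \<longlonglongrightarrow> x" unfolding closure_sequential by blast
  then show "c *\<^sub>R x \<in> closure F"
    unfolding closure_sequential by (intro exI[of _ "\<lambda>n. c *\<^sub>R a n"]) (auto intro: tendsto_scaleR subspace_scale[OF F])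
qed

lemma dense_of_orthogonal_trivial:
  fixes F :: "'h::{real_inner,complete_space} set"
  assumes F: "subspace F" and orth: "\<And>z. (\<And>v. v \<in> F \<Longrightarrow> inner z v = 0) \<Longrightarrow> z = 0"
  shows "closure F = UNIV"
proof -
  have "x \<in> closure F" for x
  proof -
    obtain y where y: "y \<in> closure F" "\<And>z. z \<in> closure F \<Longrightarrow> inner (x - y) z = 0"
      using closed_subspace_projection[OF subspace_closure[OF F] closed_closure, of x] by blast
    have "x - y = 0" using y(2) closure_subset by (intro orth) blast
    then show ?thesis using y(1) by simp
  qed
  then show ?thesis by auto
qed

section \<open>Continuous functions of a positive contraction\<close>

text \<open>The Bernstein basis as formal polynomials, so that an operator can be substituted for the variable.\<close>

definition bern :: "nat \<Rightarrow> nat \<Rightarrow> real poly" where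
  "bern n k = smult (real (n choose k)) ([:0,1:] ^ k * [:1,-1:] ^ (n - k))"

lemma sum_bern: "(\<Sum>k\<le>n. bern n k) = 1"
proof -
  have "(1::real poly) = ([:0,1:] + [:1,-1:]) ^ n"
    by (simp only: add_pCons add_0_right) (simp flip: one_pCons)
  also have "\<dots> = (\<Sum>k\<le>n. of_nat (n choose k) * [:0,1:] ^ k * [:1,-1:] ^ (n - k))"
    by (rule binomial_ring)
  also have "\<dots> = (\<Sum>k\<le>n. bern n k)"
    unfolding bern_def by (intro sum.cong refl) (simp add: of_nat_poly mult.assoc)
  finally show ?thesis by simp
qed

lemma smult_sum_right: "smult a (sum f A) = (\<Sum>i\<in>A. smult a (f i))"
  by (induction A rule: infinite_finite_induct) (simp_all add: smult_add_right)

text \<open>Multiplication by the variable, carried out on Bernstein coefficients; this drives the induction on the degree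
  in the next lemma.\<close>

lemma shift_bern:
  assumes "k \<le> n"
  shows "pCons 0 (bern n k) = smult (real (Suc k) / real (Suc n)) (bern (Suc n) (Suc k))"
proof -
  have c: "real (Suc k) / real (Suc n) * real (Suc n choose Suc k) = real (n choose k)"
  proof -
    have "Suc k * (Suc n choose Suc k) = Suc n * (n choose k)"
      by (metis Suc_times_binomial_eq mult.commute)
    then have "real (Suc k) * real (Suc n choose Suc k) = real (Suc n) * real (n choose k)"
      by (metis of_nat_mult)
    then show ?thesis by (simp add: field_simps del: of_nat_Suc)
  qed
  have "pCons 0 (bern n k) = [:0,1:] * bern n k" by simp
  also have "\<dots> = smult (real (n choose k)) ([:0,1:] ^ Suc k * [:1,-1:] ^ (Suc n - Suc k))"
    unfolding bern_def by (simp add: algebra_simps)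
  also have "\<dots> = smult (real (Suc k) / real (Suc n)) (bern (Suc n) (Suc k))"
    unfolding bern_def smult_smult c ..
  finally show ?thesis .
qed

text \<open>The Bernstein coefficients of a fixed polynomial approach its values at \<open>k/n\<close> as the degree \<open>n\<close> of the
  representation grows. In contrast to Bernstein approximation the representation is exact, which is what makes it
  usable under a substitution of operators: a polynomial that is nonnegative on \<open>[0,1]\<close> is a combination of
  Bernstein polynomials with coefficients at least \<open>-e\<close>.\<close>

lemma poly_bern_representation:
  fixes p :: "real poly"
  assumes "0 < e"
  shows "\<exists>N. \<forall>n\<ge>N. \<exists>c. p = (\<Sum>k\<le>n. smult (c k) (bern n k)) \<and>
           (\<forall>k\<le>n. \<bar>c k - poly p (real k / real n)\<bar> < e)"
  using assms
proof (induction p arbitrary: e)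
  case 0
  show ?case by (rule exI[of _ 0], intro allI impI exI[of _ "\<lambda>_. 0"]) (simp add: 0)
next
  case (pCons a p)
  have uc: "uniformly_continuous_on {0..1::real} (poly p)"
    by (intro compact_uniformly_continuous continuous_intros compact_Icc)
  obtain d where d: "d > 0" and dd: "\<And>x y. x \<in> {0..1} \<Longrightarrow> y \<in> {0..1} \<Longrightarrow> \<bar>x - y\<bar> < d
      \<Longrightarrow> \<bar>poly p x - poly p y\<bar> < e / 2"
    using uc pCons.prems unfolding uniformly_continuous_on_def dist_real_def
    by (metis half_gt_zero abs_minus_commute)
  obtain N where N: "\<And>n. n \<ge> N \<Longrightarrow> \<exists>c. p = (\<Sum>k\<le>n. smult (c k) (bern n k)) \<and>
           (\<forall>k\<le>n. \<bar>c k - poly p (real k / real n)\<bar> < e / 2)"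
    using pCons.IH[of "e/2"] pCons.prems by auto
  obtain M :: nat where M: "1 / d < real M" using reals_Archimedean2 by blast
  have "\<exists>c. pCons a p = (\<Sum>k\<le>n. smult (c k) (bern n k)) \<and>
           (\<forall>k\<le>n. \<bar>c k - poly (pCons a p) (real k / real n)\<bar> < e)" if n: "n \<ge> N + M + 2" for n
  proof -
    obtain m where m: "n = Suc m" and mN: "m \<ge> N" and mM: "m \<ge> M" "m > 0" using n
      by (intro that[of "n - 1"]) auto
    obtain c where c: "p = (\<Sum>k\<le>m. smult (c k) (bern m k))"
      and cc: "\<And>k. k \<le> m \<Longrightarrow> \<bar>c k - poly p (real k / real m)\<bar> < e / 2"
      using N[OF mN] by blast
    define c' where "c' k = a + (if k = 0 then 0 else real k / real n * c (k - 1))" for k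
    \<comment> \<open>The coefficient of \<open>bern n k\<close> in \<open>x p(x)\<close> is \<open>k/n\<close> times that of \<open>bern (n - 1) (k - 1)\<close> in \<open>p\<close>. At \<open>k = 0\<close> the
       value of \<open>k - 1\<close> is immaterial.\<close>
    have "pCons 0 p = pCons 0 (\<Sum>k\<le>m. smult (c k) (bern m k))" using c by simp
    also have "\<dots> = (\<Sum>k\<le>m. smult (c k) (pCons 0 (bern m k)))"
    proof -
      have "pCons 0 q = monom 1 1 * q" for q :: "real poly" by (simp add: monom_Suc)
      then show ?thesis by (simp only: sum_distrib_left mult_smult_right)
    qed
    also have "\<dots> = (\<Sum>k\<le>m. smult (real (Suc k) / real n * c (Suc k - 1)) (bern n (Suc k)))"
      by (intro sum.cong refl) (simp only: shift_bern[OF iffD1[OF atMost_iff]] m smult_smult diff_Suc_1 mult.commute)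
    also have "\<dots> = (\<Sum>k\<in>{1..n}. smult (real k / real n * c (k - 1)) (bern n k))"
      unfolding m using sum.shift_bounds_cl_Suc_ivl[of "\<lambda>k. smult (real k / real (Suc m) * c (k - 1)) (bern (Suc m) k)" 0 m]
      by (simp add: atMost_atLeast0)
    also have "\<dots> = (\<Sum>k\<le>n. smult (c' k - a) (bern n k))"
      by (rule sum.mono_neutral_cong_left) (auto simp: c'_def Suc_le_eq)
    finally have e1: "pCons 0 p = (\<Sum>k\<le>n. smult (c' k - a) (bern n k))" .
    have "[:a:] = smult a (\<Sum>k\<le>n. bern n k)" by (simp add: sum_bern one_pCons)
    also have "\<dots> = (\<Sum>k\<le>n. smult a (bern n k))"
      by (rule smult_sum_right)
    finally have e2: "[:a:] = (\<Sum>k\<le>n. smult a (bern n k))" .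
    have "pCons a p = [:a:] + pCons 0 p" by simp
    also have "\<dots> = (\<Sum>k\<le>n. smult (c' k) (bern n k))"
      unfolding e1 e2 sum.distrib[symmetric] smult_add_left[symmetric] by simp
    finally have rep: "pCons a p = (\<Sum>k\<le>n. smult (c' k) (bern n k))" .
    have "\<bar>c' k - poly (pCons a p) (real k / real n)\<bar> < e" if k: "k \<le> n" for k
    proof (cases "k = 0")
      case True then show ?thesis using pCons.prems by (simp add: c'_def)
    next
      case False
      then obtain j where j: "k = Suc j" and jm: "j \<le> m" using k m by (cases k) auto
      have r1: "real k / real n \<in> {0..1}" and r2: "real j / real m \<in> {0..1}"
        using k jm m mM by (auto simp: divide_simps)
      have "\<bar>real j / real m - real k / real n\<bar> = (real m - real j) / (real m * real n)"
      proof -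
        have "real k / real n - real j / real m = (real m - real j) / (real m * real n)"
          using mM unfolding m j by (simp add: field_simps)
        moreover have "0 \<le> (real m - real j) / (real m * real n)" using jm by simp
        ultimately show ?thesis by linarith
      qed
      also have "\<dots> \<le> real m / (real m * real n)"
        by (intro divide_right_mono) auto
      also have "\<dots> = 1 / real n" using mM by simp
      also have "\<dots> \<le> 1 / real M"
      proof -
        have "0 < 1 / d" using d by simp
        then have "0 < real M" using M by linarith
        then show ?thesis using mM m by (intro divide_left_mono) auto
      qed
      also have "\<dots> < d" using M d by (cases "M = 0") (auto simp: field_simps)
      finally have "\<bar>poly p (real j / real m) - poly p (real k / real n)\<bar> < e / 2"
        by (rule dd[OF r2 r1])
      with cc[OF jm] have cl: "\<bar>c j - poly p (real k / real n)\<bar> < e" by linarith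
      have "c' k - poly (pCons a p) (real k / real n)
          = (real k / real n) * (c j - poly p (real k / real n))"
        using False by (simp add: c'_def j algebra_simps)
      then have "\<bar>c' k - poly (pCons a p) (real k / real n)\<bar>
          = (real k / real n) * \<bar>c j - poly p (real k / real n)\<bar>"
        by (simp add: abs_mult)
      also have "\<dots> \<le> 1 * \<bar>c j - poly p (real k / real n)\<bar>"
        using r1 by (intro mult_right_mono) auto
      finally have "\<bar>c' k - poly (pCons a p) (real k / real n)\<bar> \<le> \<bar>c j - poly p (real k / real n)\<bar>"
        unfolding mult_1 .
      then show ?thesis using cl by (rule order_le_less_trans)
    qed
    then show ?thesis using rep by blast
  qed
  then show ?case by blast
qed

definition pcalc :: "('h::real_vector \<Rightarrow> 'h) \<Rightarrow> real poly \<Rightarrow> 'h \<Rightarrow> 'h" where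
  "pcalc G p = fold_coeffs (\<lambda>a f x. a *\<^sub>R x + G (f x)) p (\<lambda>_. 0)"

text \<open>The condition \<open>G\<^sup>2 \<le> G\<close> encodes \<open>0 \<le> G \<le> 1\<close> in a single inequality of quadratic forms.\<close>

locale positive_contraction =
  fixes G :: "'h::{real_inner,complete_space} \<Rightarrow> 'h"
  assumes linear_G: "linear G"
    and sym_G: "inner (G x) y = inner x (G y)"
    and sq_G: "inner (G x) (G x) \<le> inner (G x) x"
begin

lemma G_simps: "G (x + y) = G x + G y" "G (c *\<^sub>R x) = c *\<^sub>R G x" "G 0 = 0" "G (x - y) = G x - G y"
  using linear_G by (simp_all add: linear_add linear_scale linear_0 linear_diff)

lemma norm_G: "norm (G x) \<le> norm x"
proof -
  have "(norm (G x))\<^sup>2 \<le> norm (G x) * norm x"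
    using sq_G[of x] Cauchy_Schwarz_ineq2[of "G x" x] by (simp add: power2_norm_eq_inner abs_le_iff)
  then show ?thesis
    by (cases "G x = 0") (auto simp: power2_eq_square)
qed

lemma pcalc_pCons: "pcalc G (pCons a p) x = a *\<^sub>R x + G (pcalc G p x)"
  unfolding pcalc_def by (cases "p = 0 \<and> a = 0") (auto simp: G_simps)

lemma pcalc_0: "pcalc G 0 x = 0"
  by (simp add: pcalc_def)

lemma pcalc_const: "pcalc G [:a:] x = a *\<^sub>R x"
  by (simp add: pcalc_pCons pcalc_0 G_simps)

lemma pcalc_1: "pcalc G 1 x = x"
  by (simp add: one_pCons pcalc_const)

lemma pcalc_X: "pcalc G [:0,1:] x = G x"
  by (simp add: pcalc_pCons pcalc_0 G_simps)

lemma pcalc_add: "pcalc G (p + q) x = pcalc G p x + pcalc G q x"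
  by (induction p q rule: poly_induct2) (simp_all add: pcalc_0 pcalc_pCons G_simps algebra_simps)

lemma pcalc_smult: "pcalc G (smult c p) x = c *\<^sub>R pcalc G p x"
  by (induction p) (simp_all add: pcalc_0 pcalc_pCons G_simps algebra_simps)

lemma pcalc_diff: "pcalc G (p - q) x = pcalc G p x - pcalc G q x"
  using pcalc_add[of "p - q" q x] by simp

lemma pcalc_mult: "pcalc G (p * q) x = pcalc G p (pcalc G q x)"
  by (induction p) (simp_all add: pcalc_0 pcalc_pCons pcalc_add pcalc_smult)

lemma pcalc_sum: "pcalc G (sum f A) x = (\<Sum>i\<in>A. pcalc G (f i) x)"
  by (induction A rule: infinite_finite_induct) (simp_all add: pcalc_0 pcalc_add)

lemma linear_pcalc: "linear (pcalc G p)"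
  by (induction p) (auto intro!: linearI simp: pcalc_0 pcalc_pCons G_simps linear_add linear_scale algebra_simps)

lemma pcalc_sym: "inner (pcalc G p x) y = inner x (pcalc G p y)"
proof (induction p arbitrary: x y)
  case (pCons a p)
  have "pcalc G p (G y) = G (pcalc G p y)"
    by (metis pcalc_X pcalc_mult mult.commute)
  then show ?case by (simp add: pcalc_pCons inner_add_left inner_add_right sym_G pCons.IH)
qed (simp add: pcalc_0)

text \<open>Even powers split evenly between the two sides of the inner product. This leaves \<open>1\<close>, \<open>G\<close>, \<open>1 - G\<close> and
  \<open>G (1 - G)\<close>, and the last of these is nonnegative by the defining inequality.\<close>

lemma pcalc_monomial_pos:
  "0 \<le> inner (pcalc G ([:0,1:] ^ k * [:1,-1:] ^ m) x) x"
proof -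
  define q where "q = ([:0,1:] ^ (k div 2) * [:1,-1:] ^ (m div 2) :: real poly)"
  define r where "r = ([:0,1:] ^ (k mod 2) * [:1,-1:] ^ (m mod 2) :: real poly)"
  define y where "y = pcalc G q x"
  have k: "k = k div 2 + (k div 2 + k mod 2)" and m: "m = m div 2 + (m div 2 + m mod 2)"
    by presburger+
  have "([:0,1:] ^ k * [:1,-1:] ^ m :: real poly) = q * (r * q)"
    by (subst k, subst m) (simp only: power_add q_def r_def mult_ac)
  then have eq: "inner (pcalc G ([:0,1:] ^ k * [:1,-1:] ^ m) x) x = inner (pcalc G r y) y"
    by (simp add: pcalc_mult y_def pcalc_sym)
  have X1: "pcalc G [:1,-1:] z = z - G z" for z
    using linear_neg[OF linear_G] by (simp add: pcalc_pCons pcalc_0 G_simps)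
  have G0: "0 \<le> inner (G y) y" using sq_G[of y] inner_ge_zero[of "G y"] by linarith
  have "(norm (y - G y))\<^sup>2 + inner (G y) y - inner (G y) (G y) = inner y y - inner (G y) y"
    by (simp add: power2_norm_eq_inner inner_diff_left inner_diff_right inner_commute)
  then have G1: "inner (G y) y \<le> inner y y" using sq_G[of y] zero_le_power2[of "norm (y - G y)"] by linarith
  have "k mod 2 = 0 \<or> k mod 2 = 1" "m mod 2 = 0 \<or> m mod 2 = 1" by auto
  then have "0 \<le> inner (pcalc G r y) y"
  proof (elim disjE)
    assume "k mod 2 = 1" "m mod 2 = 1"
    then have "pcalc G r y = G (y - G y)"
      unfolding r_def by (simp only: power_one_right pcalc_mult X1 pcalc_X)
    moreover have "inner (G (y - G y)) y = inner (G y) y - inner (G y) (G y)"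
      by (simp add: G_simps inner_diff_left sym_G)
    ultimately show ?thesis using sq_G[of y] by simp
  qed (use G0 G1 in \<open>simp_all add: r_def pcalc_1 pcalc_X X1 inner_diff_left del: pCons_one\<close>)
  then show ?thesis by (simp add: eq)
qed

lemma pcalc_bern_pos: "0 \<le> inner (pcalc G (bern n k) x) x"
  unfolding bern_def pcalc_smult using pcalc_monomial_pos[of k "n - k" x] by simp

text \<open>In the Bernstein representation of high degree all coefficients exceed \<open>-d\<close>, while the Bernstein polynomials
  become positive operators with sum \<open>1\<close>. Hence \<open>p(G) \<ge> -d\<close> for all \<open>d > 0\<close>.\<close>

lemma pcalc_pos:
  assumes p: "\<And>t. t \<in> {0..1} \<Longrightarrow> 0 \<le> poly p t"
  shows "0 \<le> inner (pcalc G p x) x"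
proof (rule field_le_epsilon)
  fix e :: real assume e: "0 < e"
  define d where "d = e / (1 + inner x x)"
  have pos: "1 + inner x x > 0" using inner_ge_zero[of x] by linarith
  have d: "0 < d" using e pos by (simp add: d_def)
  obtain N where N: "\<And>n. n \<ge> N \<Longrightarrow> \<exists>c. p = (\<Sum>k\<le>n. smult (c k) (bern n k)) \<and>
           (\<forall>k\<le>n. \<bar>c k - poly p (real k / real n)\<bar> < d)"
    using poly_bern_representation[OF d, of p] by blast
  obtain c where c: "p = (\<Sum>k\<le>Suc N. smult (c k) (bern (Suc N) k))"
    and cc: "\<And>k. k \<le> Suc N \<Longrightarrow> \<bar>c k - poly p (real k / real (Suc N))\<bar> < d"
    using N[of "Suc N"] by auto
  have cd: "- d \<le> c k" if "k \<le> Suc N" for k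
  proof -
    have "real k / real (Suc N) \<in> {0..1}" using that by (auto simp: divide_simps)
    from p[OF this] cc[OF that] show ?thesis by linarith
  qed
  have "- d * inner x x = - d * inner (pcalc G (\<Sum>k\<le>Suc N. bern (Suc N) k) x) x"
    by (simp add: sum_bern pcalc_1 del: sum.atMost_Suc)
  also have "\<dots> = (\<Sum>k\<le>Suc N. - d * inner (pcalc G (bern (Suc N) k) x) x)"
    by (simp add: pcalc_sum inner_sum_left sum_distrib_left del: sum.atMost_Suc)
  also have "\<dots> \<le> (\<Sum>k\<le>Suc N. c k * inner (pcalc G (bern (Suc N) k) x) x)"
    using cd pcalc_bern_pos by (intro sum_mono mult_right_mono) auto
  also have "\<dots> = inner (pcalc G p x) x"
    by (subst c) (simp add: pcalc_sum pcalc_smult inner_sum_left del: sum.atMost_Suc)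
  finally have "- d * inner x x \<le> inner (pcalc G p x) x" .
  moreover have "d * inner x x \<le> e" using pos e by (simp add: d_def field_simps)
  ultimately show "0 \<le> inner (pcalc G p x) x + e" by linarith
qed

text \<open>Positivity applied to \<open>M\<^sup>2 - p\<^sup>2\<close>: the bound that extends the calculus from polynomials to continuous functions.\<close>

lemma pcalc_norm:
  assumes p: "\<And>t. t \<in> {0..1} \<Longrightarrow> \<bar>poly p t\<bar> \<le> M"
  shows "norm (pcalc G p x) \<le> M * norm x"
proof -
  have M: "0 \<le> M" using p[of 0] by auto
  have "0 \<le> inner (pcalc G ([:M\<^sup>2:] - p * p) x) x"
  proof (rule pcalc_pos)
    fix t :: real assume "t \<in> {0..1}"
    then have "(poly p t)\<^sup>2 \<le> M\<^sup>2" using p M by (metis abs_le_square_iff abs_of_nonneg)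
    then show "0 \<le> poly ([:M\<^sup>2:] - p * p) t" by (simp add: power2_eq_square)
  qed
  then have "(norm (pcalc G p x))\<^sup>2 \<le> (M * norm x)\<^sup>2"
    by (simp add: pcalc_diff pcalc_const pcalc_mult inner_diff_left power2_norm_eq_inner
        pcalc_sym power_mult_distrib)
  then show ?thesis using M by (meson norm_ge_zero mult_nonneg_nonneg power2_le_imp_le)
qed

end

definition poly_approx :: "(real \<Rightarrow> real) \<Rightarrow> nat \<Rightarrow> real poly" where
  "poly_approx f n = (SOME p. \<forall>t\<in>{0..1}. \<bar>f t - poly p t\<bar> \<le> 1 / (real n + 1))"

lemma poly_approx:
  assumes "continuous_on {0..1} f" "t \<in> {0..1}"
  shows "\<bar>f t - poly (poly_approx f n) t\<bar> \<le> 1 / (real n + 1)"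
proof -
  have "\<exists>N. \<forall>k x. N \<le> k \<and> x \<in> {0..1}
                    \<longrightarrow> \<bar>f x - (\<Sum>j\<le>k. f(j/k) * Bernstein k j x)\<bar> < 1 / (real n + 1)"
    using assms by (intro Bernstein_Weierstrass) auto
  then obtain N where N: "\<And>x. x \<in> {0..1} \<Longrightarrow>
      \<bar>f x - (\<Sum>j\<le>N. f(j/N) * Bernstein N j x)\<bar> < 1 / (real n + 1)"
    by blast
  have "poly (\<Sum>j\<le>N. smult (f (j/N)) (bern N j)) x = (\<Sum>j\<le>N. f(j/N) * Bernstein N j x)" for x
    by (simp add: poly_sum bern_def Bernstein_def mult_ac)
  with N have "\<exists>p. \<forall>t\<in>{0..1}. \<bar>f t - poly p t\<bar> \<le> 1 / (real n + 1)"
    by (intro exI[of _ "\<Sum>j\<le>N. smult (f (j/N)) (bern N j)"]) (auto intro: less_imp_le)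
  from someI_ex[OF this] assms(2) show ?thesis unfolding poly_approx_def by blast
qed

lemma inverse_Suc_tendsto_0: "(\<lambda>n. 1 / (real n + 1)) \<longlonglongrightarrow> 0"
  using LIMSEQ_inverse_real_of_nat by (simp add: inverse_eq_divide add.commute)

text \<open>The limit exists for a positive contraction \<open>G\<close> and \<open>f\<close> continuous on \<open>[0,1]\<close>, and then does not depend on the
  approximating polynomials.\<close>

definition fcalc :: "('h::real_normed_vector \<Rightarrow> 'h) \<Rightarrow> (real \<Rightarrow> real) \<Rightarrow> 'h \<Rightarrow> 'h" where
  "fcalc G f x = lim (\<lambda>n. pcalc G (poly_approx f n) x)"

context positive_contraction
begin

lemma pcalc_close:
  assumes "\<And>t. t \<in> {0..1} \<Longrightarrow> \<bar>f t - poly p t\<bar> \<le> a" "\<And>t. t \<in> {0..1} \<Longrightarrow> \<bar>f t - poly q t\<bar> \<le> b"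
  shows "norm (pcalc G p x - pcalc G q x) \<le> (a + b) * norm x"
  unfolding pcalc_diff[symmetric]
proof (rule pcalc_norm)
  fix t :: real assume "t \<in> {0..1}"
  from assms(1)[OF this] assms(2)[OF this] show "\<bar>poly (p - q) t\<bar> \<le> a + b" by simp
qed

lemma pcalc_tendsto_fcalc0:
  assumes f: "continuous_on {0..1} f"
  shows "(\<lambda>n. pcalc G (poly_approx f n) x) \<longlonglongrightarrow> fcalc G f x"
proof -
  let ?y = "\<lambda>n. pcalc G (poly_approx f n) x"
  have close: "norm (?y m - ?y n) \<le> (1 / (real m + 1) + 1 / (real n + 1)) * norm x" for m n
    by (rule pcalc_close[OF poly_approx[OF f] poly_approx[OF f]])
  have "Cauchy ?y"
  proof (rule metric_CauchyI)
    fix e :: real assume e: "0 < e"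
    have "(\<lambda>n. 1 / (real n + 1) * norm x) \<longlonglongrightarrow> 0 * norm x"
      by (intro tendsto_intros inverse_Suc_tendsto_0)
    then have "(\<lambda>n. 1 / (real n + 1) * norm x) \<longlonglongrightarrow> 0" by simp
    from order_tendstoD(2)[OF this, of "e/2"] e obtain N where
      N: "\<And>n. n \<ge> N \<Longrightarrow> 1 / (real n + 1) * norm x < e / 2"
      by (auto simp: eventually_sequentially)
    have "dist (?y m) (?y n) < e" if "m \<ge> N" "n \<ge> N" for m n
      using close[of m n] N[OF that(1)] N[OF that(2)] unfolding dist_norm distrib_right by linarith
    then show "\<exists>N. \<forall>m\<ge>N. \<forall>n\<ge>N. dist (?y m) (?y n) < e" by blast
  qed
  then show ?thesis
    unfolding fcalc_def by (metis Cauchy_convergent convergent_LIMSEQ_iff)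
qed

lemma pcalc_tendsto_fcalc:
  assumes f: "continuous_on {0..1} f"
    and p: "\<And>n t. t \<in> {0..1} \<Longrightarrow> \<bar>f t - poly (p n) t\<bar> \<le> e n" and e: "e \<longlonglongrightarrow> 0"
  shows "(\<lambda>n. pcalc G (p n) x) \<longlonglongrightarrow> fcalc G f x"
proof -
  have "(\<lambda>n. pcalc G (p n) x - pcalc G (poly_approx f n) x) \<longlonglongrightarrow> 0"
  proof (rule Lim_null_comparison)
    show "\<forall>\<^sub>F n in sequentially. norm (pcalc G (p n) x - pcalc G (poly_approx f n) x)
        \<le> (e n + 1 / (real n + 1)) * norm x"
      by (intro always_eventually allI pcalc_close[OF p poly_approx[OF f]])
    have "(\<lambda>n. (e n + 1 / (real n + 1)) * norm x) \<longlonglongrightarrow> (0 + 0) * norm x"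
      by (intro tendsto_intros e inverse_Suc_tendsto_0)
    then show "(\<lambda>n. (e n + 1 / (real n + 1)) * norm x) \<longlonglongrightarrow> 0" by simp
  qed
  from tendsto_add[OF this pcalc_tendsto_fcalc0[OF f, of x]] show ?thesis by simp
qed

lemma fcalc_cong:
  assumes "\<And>t. t \<in> {0..1} \<Longrightarrow> f t = g t"
  shows "fcalc G f = fcalc G g"
proof -
  have "(\<forall>t\<in>{0..1}. \<bar>f t - poly p t\<bar> \<le> e) = (\<forall>t\<in>{0..1}. \<bar>g t - poly p t\<bar> \<le> e)" for p e
    using assms by (intro ball_cong refl) simp
  then show ?thesis unfolding fcalc_def[abs_def] poly_approx_def by simp
qed

lemma fcalc_poly: "fcalc G (poly p) x = pcalc G p x"
proof -
  have "continuous_on {0..1} (poly p)" by (intro continuous_intros)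
  then have "(\<lambda>n. pcalc G p x) \<longlonglongrightarrow> fcalc G (poly p) x"
    by (rule pcalc_tendsto_fcalc[where e = "\<lambda>_. 0"]) auto
  then show ?thesis by (simp add: LIMSEQ_const_iff)
qed

lemma fcalc_const: "fcalc G (\<lambda>_. c) x = c *\<^sub>R x"
proof -
  have "poly [:c:] = (\<lambda>_. c)" by (simp add: fun_eq_iff)
  then show ?thesis using fcalc_poly[of "[:c:]" x] by (simp add: pcalc_const)
qed

lemma fcalc_id: "fcalc G (\<lambda>t. t) x = G x"
proof -
  have "poly [:0,1:] = (\<lambda>t::real. t)" by (simp add: fun_eq_iff)
  then show ?thesis using fcalc_poly[of "[:0,1:]" x] by (simp add: pcalc_X)
qed

lemma linear_fcalc:
  assumes f: "continuous_on {0..1} f"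
  shows "linear (fcalc G f)"
proof (rule linearI)
  fix x y :: 'h and c :: real
  note L = pcalc_tendsto_fcalc0[OF f]
  have "(\<lambda>n. pcalc G (poly_approx f n) (x + y)) \<longlonglongrightarrow> fcalc G f x + fcalc G f y"
    using tendsto_add[OF L[of x] L[of y]] by (simp add: linear_add[OF linear_pcalc])
  then show "fcalc G f (x + y) = fcalc G f x + fcalc G f y" using L[of "x + y"] LIMSEQ_unique by blast
  have "(\<lambda>n. pcalc G (poly_approx f n) (c *\<^sub>R x)) \<longlonglongrightarrow> c *\<^sub>R fcalc G f x"
    using tendsto_scaleR[OF tendsto_const L[of x], of c] by (simp add: linear_scale[OF linear_pcalc])
  then show "fcalc G f (c *\<^sub>R x) = c *\<^sub>R fcalc G f x" using L[of "c *\<^sub>R x"] LIMSEQ_unique by blast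
qed

lemma fcalc_norm:
  assumes f: "continuous_on {0..1} f" and M: "\<And>t. t \<in> {0..1} \<Longrightarrow> \<bar>f t\<bar> \<le> M"
  shows "norm (fcalc G f x) \<le> M * norm x"
proof (rule LIMSEQ_le)
  show "(\<lambda>n. norm (pcalc G (poly_approx f n) x)) \<longlonglongrightarrow> norm (fcalc G f x)"
    by (intro tendsto_norm pcalc_tendsto_fcalc0 f)
  have "(\<lambda>n. (M + 1 / (real n + 1)) * norm x) \<longlonglongrightarrow> (M + 0) * norm x"
    by (intro tendsto_intros inverse_Suc_tendsto_0)
  then show "(\<lambda>n. (M + 1 / (real n + 1)) * norm x) \<longlonglongrightarrow> M * norm x" by simp
  have "norm (pcalc G (poly_approx f n) x) \<le> (M + 1 / (real n + 1)) * norm x" for n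
  proof (rule pcalc_norm)
    fix t :: real assume "t \<in> {0..1}"
    from M[OF this] poly_approx[OF f this, of n] show "\<bar>poly (poly_approx f n) t\<bar> \<le> M + 1 / (real n + 1)"
      by linarith
  qed
  then show "\<exists>N. \<forall>n\<ge>N. norm (pcalc G (poly_approx f n) x) \<le> (M + 1 / (real n + 1)) * norm x" by blast
qed

lemma fcalc_add:
  assumes f: "continuous_on {0..1} f" and g: "continuous_on {0..1} g"
  shows "fcalc G (\<lambda>t. f t + g t) x = fcalc G f x + fcalc G g x"
proof -
  have "(\<lambda>n. pcalc G (poly_approx f n + poly_approx g n) x) \<longlonglongrightarrow> fcalc G (\<lambda>t. f t + g t) x"
  proof (rule pcalc_tendsto_fcalc)
    show "continuous_on {0..1} (\<lambda>t. f t + g t)" by (intro continuous_intros f g)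
    show "\<bar>f t + g t - poly (poly_approx f n + poly_approx g n) t\<bar> \<le> 1 / (real n + 1) + 1 / (real n + 1)"
      if "t \<in> {0..1}" for n t
      using poly_approx[OF f that, of n] poly_approx[OF g that, of n] by simp
    show "(\<lambda>n. 1 / (real n + 1) + 1 / (real n + 1)) \<longlonglongrightarrow> 0"
      using tendsto_add[OF inverse_Suc_tendsto_0 inverse_Suc_tendsto_0] by simp
  qed
  moreover have "(\<lambda>n. pcalc G (poly_approx f n + poly_approx g n) x) \<longlonglongrightarrow> fcalc G f x + fcalc G g x"
    unfolding pcalc_add by (intro tendsto_add pcalc_tendsto_fcalc0 f g)
  ultimately show ?thesis by (rule LIMSEQ_unique)
qed

lemma fcalc_mult:
  assumes f: "continuous_on {0..1} f" and g: "continuous_on {0..1} g"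
  shows "fcalc G (\<lambda>t. f t * g t) x = fcalc G f (fcalc G g x)"
proof -
  obtain A where A: "\<And>t. t \<in> {0..1} \<Longrightarrow> \<bar>f t\<bar> \<le> A"
    using compact_imp_bounded[OF compact_continuous_image[OF f compact_Icc]]
    unfolding bounded_iff by (metis atLeastAtMost_iff image_eqI real_norm_def)
  obtain B where B: "\<And>t. t \<in> {0..1} \<Longrightarrow> \<bar>g t\<bar> \<le> B"
    using compact_imp_bounded[OF compact_continuous_image[OF g compact_Icc]]
    unfolding bounded_iff by (metis atLeastAtMost_iff image_eqI real_norm_def)
  let ?p = "poly_approx f" and ?q = "poly_approx g"
  have pA: "\<bar>poly (?p n) t\<bar> \<le> A + 1" if "t \<in> {0..1}" for n t
  proof -
    have "1 / (real n + 1) \<le> 1" by simp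
    then show ?thesis using poly_approx[OF f that, of n] A[OF that] by linarith
  qed
  have "(\<lambda>n. pcalc G (?p n * ?q n) x) \<longlonglongrightarrow> fcalc G (\<lambda>t. f t * g t) x"
  proof (rule pcalc_tendsto_fcalc)
    show "continuous_on {0..1} (\<lambda>t. f t * g t)" by (intro continuous_intros f g)
    show "\<bar>f t * g t - poly (?p n * ?q n) t\<bar> \<le> 1 / (real n + 1) * B + (A + 1) * (1 / (real n + 1))"
      if "t \<in> {0..1}" for n t
    proof -
      have "f t * g t - poly (?p n * ?q n) t
          = (f t - poly (?p n) t) * g t + poly (?p n) t * (g t - poly (?q n) t)"
        by (simp add: algebra_simps)
      also have "\<bar>\<dots>\<bar> \<le> \<bar>f t - poly (?p n) t\<bar> * \<bar>g t\<bar> + \<bar>poly (?p n) t\<bar> * \<bar>g t - poly (?q n) t\<bar>"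
        by (metis abs_mult abs_triangle_ineq)
      also have "\<dots> \<le> 1 / (real n + 1) * B + (A + 1) * (1 / (real n + 1))"
        using poly_approx[OF f that, of n] poly_approx[OF g that, of n] B[OF that] pA[OF that, of n]
          A[OF that]
        by (intro add_mono mult_mono) auto
      finally show ?thesis .
    qed
    have "(\<lambda>n. 1 / (real n + 1) * B + (A + 1) * (1 / (real n + 1))) \<longlonglongrightarrow> 0 * B + (A + 1) * 0"
      by (intro tendsto_intros inverse_Suc_tendsto_0)
    then show "(\<lambda>n. 1 / (real n + 1) * B + (A + 1) * (1 / (real n + 1))) \<longlonglongrightarrow> 0" by simp
  qed
  moreover have "(\<lambda>n. pcalc G (?p n * ?q n) x) \<longlonglongrightarrow> fcalc G f (fcalc G g x)"
  proof -
    let ?z = "fcalc G g x"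
    have "(\<lambda>n. pcalc G (?p n) (pcalc G (?q n) x - ?z)) \<longlonglongrightarrow> 0"
    proof (rule Lim_null_comparison)
      show "\<forall>\<^sub>F n in sequentially. norm (pcalc G (?p n) (pcalc G (?q n) x - ?z))
          \<le> (A + 1) * norm (pcalc G (?q n) x - ?z)"
        by (intro always_eventually allI pcalc_norm pA)
      have "(\<lambda>n. (A + 1) * norm (pcalc G (?q n) x - ?z)) \<longlonglongrightarrow> (A + 1) * norm (?z - ?z)"
        by (intro tendsto_intros pcalc_tendsto_fcalc0 g)
      then show "(\<lambda>n. (A + 1) * norm (pcalc G (?q n) x - ?z)) \<longlonglongrightarrow> 0" by simp
    qed
    from tendsto_add[OF this pcalc_tendsto_fcalc0[OF f, of ?z]]
    show ?thesis by (simp add: pcalc_mult linear_diff[OF linear_pcalc])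
  qed
  ultimately show ?thesis by (rule LIMSEQ_unique)
qed

end

section \<open>Spectral localization\<close>

definition fin_rank :: "('h::real_vector \<Rightarrow> 'h) \<Rightarrow> bool" where
  "fin_rank S \<longleftrightarrow> (\<exists>B. finite B \<and> range S \<subseteq> span B)"

lemma fin_rank_add: "fin_rank S \<Longrightarrow> fin_rank T \<Longrightarrow> fin_rank (\<lambda>x. S x + T x)"
proof -
  assume "fin_rank S" "fin_rank T"
  then obtain A B where A: "finite A" "range S \<subseteq> span A" and B: "finite B" "range T \<subseteq> span B"
    unfolding fin_rank_def by blast
  have "S x + T x \<in> span (A \<union> B)" for x
  proof (rule span_add)
    show "S x \<in> span (A \<union> B)" using A(2) span_mono[of A "A \<union> B"] by blast
    show "T x \<in> span (A \<union> B)" using B(2) span_mono[of B "A \<union> B"] by blast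
  qed
  then show ?thesis unfolding fin_rank_def using A B by (intro exI[of _ "A \<union> B"]) auto
qed

lemma fin_rank_zero: "fin_rank (\<lambda>_. 0)"
  unfolding fin_rank_def by (intro exI[of _ "{}"]) auto

context positive_contraction
begin

lemma fcalc_zero: "(\<And>t. t \<in> {0..1} \<Longrightarrow> f t = 0) \<Longrightarrow> fcalc G f = (\<lambda>_. 0)"
  using fcalc_cong[of f "\<lambda>_. 0"] by (auto simp: fun_eq_iff fcalc_const)

text \<open>A property \<open>V\<close> of operators that holds for all \<open>f(G)\<close> with \<open>f\<close> supported near \<open>[a,b]\<close>. With \<open>V S\<close> saying \<open>S = 0\<close>
  this means that the interval misses the spectrum of \<open>G\<close>; with \<open>V\<close> saying finite rank, that the spectrum in the
  interval consists of at most finitely many eigenvalues of finite multiplicity.\<close>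

definition localized :: "(('h \<Rightarrow> 'h) \<Rightarrow> bool) \<Rightarrow> real \<Rightarrow> real \<Rightarrow> real \<Rightarrow> bool" where
  "localized V a b r \<longleftrightarrow> (\<forall>f. continuous_on {0..1} f \<longrightarrow>
      (\<forall>t\<in>{0..1}. t \<le> a - r \<or> b + r \<le> t \<longrightarrow> f t = 0) \<longrightarrow> V (fcalc G f))"

lemma localizedD:
  "localized V a b r \<Longrightarrow> continuous_on {0..1} f \<Longrightarrow>
    (\<And>t. t \<in> {0..1} \<Longrightarrow> t \<le> a - r \<or> b + r \<le> t \<Longrightarrow> f t = 0) \<Longrightarrow> V (fcalc G f)"
  unfolding localized_def by blast

text \<open>Compactness of the interval, in the form of the bisection principle; adjacent intervals are glued by a
  continuous partition of unity.\<close>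

lemma localized_interval:
  assumes V: "\<And>S T. V S \<Longrightarrow> V T \<Longrightarrow> V (\<lambda>x. S x + T x)"
    and ab: "a \<le> b"
    and loc: "\<And>x. a \<le> x \<Longrightarrow> x \<le> b \<Longrightarrow> \<exists>r>0. localized V x x r"
  shows "\<exists>r>0. localized V a b r"
  using ab
proof (induction rule: Bolzano)
  case (trans a b c)
  then obtain r1 r2 where r1: "r1 > 0" "localized V a b r1" and r2: "r2 > 0" "localized V b c r2" by blast
  define r where "r = min r1 r2"
  have r: "r > 0" "r \<le> r1" "r \<le> r2" using r1 r2 by (auto simp: r_def)
  \<comment> \<open>A ramp from \<open>1\<close> at \<open>b - r\<close> to \<open>0\<close> at \<open>b + r\<close>: it separates \<open>f\<close> into parts supported near \<open>[a,b]\<close> and near \<open>[b,c]\<close>.\<close>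
  define h where "h t = max 0 (min 1 ((b + r - t) / (2 * r)))" for t
  have hc: "continuous_on {0..1} h" unfolding h_def by (intro continuous_intros) (use r in auto)
  have h0: "h t = 0" if "b + r \<le> t" for t
    using that r unfolding h_def by (simp add: divide_le_0_iff)
  have h1: "h t = 1" if "t \<le> b - r" for t
    using that r unfolding h_def by (simp add: field_simps)
  have "localized V a c r"
    unfolding localized_def
  proof (intro allI impI)
    fix f :: "real \<Rightarrow> real" assume f: "continuous_on {0..1} f" and f0: "\<forall>t\<in>{0..1}. t \<le> a - r \<or> c + r \<le> t \<longrightarrow> f t = 0"
    have c1: "continuous_on {0..1} (\<lambda>t. f t * h t)" and c2: "continuous_on {0..1} (\<lambda>t. f t * (1 - h t))"
      by (intro continuous_intros f hc)+
    have "V (fcalc G (\<lambda>t. f t * h t))"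
      using f0 h0 r by (intro localizedD[OF r1(2) c1]) fastforce
    moreover have "V (fcalc G (\<lambda>t. f t * (1 - h t)))"
      using f0 h1 r by (intro localizedD[OF r2(2) c2]) fastforce
    ultimately have "V (\<lambda>x. fcalc G (\<lambda>t. f t * h t) x + fcalc G (\<lambda>t. f t * (1 - h t)) x)"
      by (rule V)
    moreover have "(\<lambda>x. fcalc G (\<lambda>t. f t * h t) x + fcalc G (\<lambda>t. f t * (1 - h t)) x) = fcalc G f"
    proof -
      have "(\<lambda>t. f t * h t + f t * (1 - h t)) = f" by (simp add: fun_eq_iff algebra_simps)
      then show ?thesis using fcalc_add[OF c1 c2] by (simp add: fun_eq_iff)
    qed
    ultimately show "V (fcalc G f)" by simp
  qed
  then show ?case using r by blast
next
  case (local x)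
  then obtain r where r: "r > 0" "localized V x x r" using loc by blast
  have "\<exists>r>0. localized V a b r" if ab: "a \<le> x" "x \<le> b" "b - a < r / 4" for a b
  proof -
    have b: "a - r / 4 \<ge> x - r" "b + r / 4 \<le> x + r" using r(1) ab by linarith+
    have "localized V a b (r/4)"
      unfolding localized_def
    proof (intro allI impI)
      fix f :: "real \<Rightarrow> real"
      assume f: "continuous_on {0..1} f" "\<forall>t\<in>{0..1}. t \<le> a - r / 4 \<or> b + r / 4 \<le> t \<longrightarrow> f t = 0"
      show "V (fcalc G f)" by (rule localizedD[OF r(2) f(1)]) (use f(2) b in auto)
    qed
    then show ?thesis using r(1) by (intro exI[of _ "r/4"]) auto
  qed
  then show ?case using r(1) by (intro exI[of _ "r/4"]) auto
qed

lemma fcalc_shift: "continuous_on {0..1} f \<Longrightarrow>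
    fcalc G (\<lambda>t. (t - c) * f t) x = G (fcalc G f x) - c *\<^sub>R fcalc G f x"
proof -
  assume f: "continuous_on {0..1} f"
  have "fcalc G (\<lambda>t. (t + (- c)) * f t) x = fcalc G (\<lambda>t. t + (- c)) (fcalc G f x)"
    by (intro fcalc_mult continuous_intros f)
  also have "\<dots> = fcalc G (\<lambda>t. t) (fcalc G f x) + fcalc G (\<lambda>_. - c) (fcalc G f x)"
    by (intro fcalc_add continuous_intros)
  finally show ?thesis by (simp add: fcalc_id fcalc_const)
qed

text \<open>If \<open>f\<close> is supported within distance \<open>c/2\<close> of \<open>x\<close>, then \<open>G - x\<close> has norm at most \<open>c/2\<close> on the range of \<open>f(G)\<close>,
  which contradicts the lower bound \<open>c\<close> unless \<open>f(G) = 0\<close>.\<close>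

lemma localized_zero_of_bounded_below:
  assumes c: "c > 0" and below: "\<And>v. c * norm v \<le> norm (G v - x *\<^sub>R v)"
  shows "\<exists>r>0. localized (\<lambda>S. S = (\<lambda>_. 0)) x x r"
proof -
  define r where "r = c / 2"
  have r: "r > 0" using c by (simp add: r_def)
  have "localized (\<lambda>S. S = (\<lambda>_. 0)) x x r"
    unfolding localized_def
  proof (intro allI impI ext)
    fix f :: "real \<Rightarrow> real" and u assume f: "continuous_on {0..1} f" and f0: "\<forall>t\<in>{0..1}. t \<le> x - r \<or> x + r \<le> t \<longrightarrow> f t = 0"
    \<comment> \<open>The truncation of \<open>t - x\<close> coincides with \<open>t - x\<close> on the support of \<open>f\<close> and is bounded by \<open>r\<close>.\<close>
    define h where "h t = max (- r) (min r (t - x))" for t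
    have hc: "continuous_on {0..1} h" unfolding h_def by (intro continuous_intros)
    have "fcalc G (\<lambda>t. (t - x) * f t) = fcalc G (\<lambda>t. h t * f t)"
    proof (rule fcalc_cong)
      fix t :: real assume "t \<in> {0..1}"
      then show "(t - x) * f t = h t * f t"
        using f0 by (cases "t \<le> x - r \<or> x + r \<le> t") (auto simp: h_def)
    qed
    then have "G (fcalc G f u) - x *\<^sub>R fcalc G f u = fcalc G h (fcalc G f u)"
      by (metis f fcalc_shift fcalc_mult[OF hc f])
    also have "norm \<dots> \<le> r * norm (fcalc G f u)"
      by (rule fcalc_norm[OF hc]) (use r in \<open>auto simp: h_def\<close>)
    finally have "c * norm (fcalc G f u) \<le> r * norm (fcalc G f u)"
      using below[of "fcalc G f u"] by linarith
    then show "fcalc G f u = 0" using c by (simp add: r_def mult_le_0_iff)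
  qed
  then show ?thesis using r by blast
qed

lemma localized_zero_outside:
  assumes "x > 1"
  shows "\<exists>r>0. localized (\<lambda>S. S = (\<lambda>_. 0)) x x r"
  using assms by (intro exI[of _ "x - 1"]) (auto simp: localized_def intro!: fcalc_zero)

text \<open>Away from \<open>x\<close> the function \<open>f\<close> contributes nothing to \<open>f(G)\<close>, so \<open>(G - x) f(G)\<close> is of norm at most \<open>d sup \<bar>f\<bar>\<close> for
  every \<open>d > 0\<close>, and \<open>f(G)\<close> maps into the eigenspace.\<close>

lemma localized_fin_rank_at_eigenvalue:
  assumes x: "0 < x" and \<rho>: "\<rho> > 0"
    and loc: "\<And>y. 0 < \<bar>y - x\<bar> \<Longrightarrow> \<bar>y - x\<bar> < \<rho> \<Longrightarrow> \<exists>r>0. localized (\<lambda>S. S = (\<lambda>_. 0)) y y r"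
    and B: "finite B" "\<And>u. G u = x *\<^sub>R u \<Longrightarrow> u \<in> span B"
  shows "\<exists>r>0. localized fin_rank x x r"
proof (intro exI[of _ "\<rho>/2"] conjI)
  define r where "r = \<rho> / 2"
  have r: "r > 0" "r < \<rho>" using \<rho> by (auto simp: r_def)
  show "localized fin_rank x x (\<rho>/2)"
    unfolding localized_def r_def[symmetric]
  proof (intro allI impI)
    fix f :: "real \<Rightarrow> real" assume f: "continuous_on {0..1} f" and f0: "\<forall>t\<in>{0..1}. t \<le> x - r \<or> x + r \<le> t \<longrightarrow> f t = 0"
    obtain M where M: "\<And>t. t \<in> {0..1} \<Longrightarrow> \<bar>f t\<bar> \<le> M"
      using compact_imp_bounded[OF compact_continuous_image[OF f compact_Icc]]
      unfolding bounded_iff by (metis atLeastAtMost_iff image_eqI real_norm_def)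
    have M0: "0 \<le> M" using M[of 0] by auto
    have "G (fcalc G f u) - x *\<^sub>R fcalc G f u = 0" for u
    proof -
      have small: "norm (fcalc G (\<lambda>t. (t - x) * f t) u) \<le> d * M * norm u" if d: "0 < d" "d < r" for d
      proof -
        \<comment> \<open>The parts of \<open>(t - x) f(t)\<close> to the right of \<open>x + d\<close>, to the left of \<open>x - d\<close>, and the truncated rest.\<close>
        define g1 where "g1 t = max 0 (t - x - d) * f t" for t
        define g2 where "g2 t = min 0 (t - x + d) * f t" for t
        define g3 where "g3 t = max (-d) (min d (t - x)) * f t" for t
        have c: "continuous_on {0..1} g1" "continuous_on {0..1} g2" "continuous_on {0..1} g3"
          unfolding g1_def g2_def g3_def by (intro continuous_intros f)+
        have z1: "fcalc G g1 = (\<lambda>_. 0)"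
        proof -
          have "\<exists>r'>0. localized (\<lambda>S. S = (\<lambda>_. 0)) (x + d) (x + r) r'"
            by (rule localized_interval[where V = "\<lambda>S. S = (\<lambda>_. 0)"]) (use d r in \<open>auto intro!: loc\<close>)
          then obtain r' where r': "r' > 0" "localized (\<lambda>S. S = (\<lambda>_. 0)) (x + d) (x + r) r'" by blast
          show ?thesis by (rule localizedD[OF r'(2) c(1)]) (use f0 r'(1) in \<open>auto simp: g1_def\<close>)
        qed
        have z2: "fcalc G g2 = (\<lambda>_. 0)"
        proof -
          have "\<exists>r'>0. localized (\<lambda>S. S = (\<lambda>_. 0)) (x - r) (x - d) r'"
            by (rule localized_interval[where V = "\<lambda>S. S = (\<lambda>_. 0)"]) (use d r in \<open>auto intro!: loc\<close>)
          then obtain r' where r': "r' > 0" "localized (\<lambda>S. S = (\<lambda>_. 0)) (x - r) (x - d) r'" by blast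
          show ?thesis by (rule localizedD[OF r'(2) c(2)]) (use f0 r'(1) in \<open>auto simp: g2_def\<close>)
        qed
        have c12: "continuous_on {0..1} (\<lambda>t. g1 t + g2 t)" by (intro continuous_intros c)
        have "(\<lambda>t. (t - x) * f t) = (\<lambda>t. (g1 t + g2 t) + g3 t)"
        proof
          fix t
          have "t - x = max 0 (t - x - d) + min 0 (t - x + d) + max (-d) (min d (t - x))"
            using d by (auto simp: max_def min_def)
          then have "(t - x) * f t = (max 0 (t - x - d) + min 0 (t - x + d) + max (-d) (min d (t - x))) * f t"
            by simp
          then show "(t - x) * f t = (g1 t + g2 t) + g3 t"
            unfolding g1_def g2_def g3_def by (simp add: distrib_right)
        qed
        then have "fcalc G (\<lambda>t. (t - x) * f t) u = fcalc G g1 u + fcalc G g2 u + fcalc G g3 u"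
          by (simp add: fcalc_add[OF c12 c(3)] fcalc_add[OF c(1,2)])
        then have "fcalc G (\<lambda>t. (t - x) * f t) u = fcalc G g3 u" by (simp add: z1 z2)
        also have "norm \<dots> \<le> d * M * norm u"
        proof (rule fcalc_norm[OF c(3)])
          fix t :: real assume t: "t \<in> {0..1}"
          have "\<bar>max (-d) (min d (t - x))\<bar> \<le> d" using d by (auto simp: max_def min_def)
          then show "\<bar>g3 t\<bar> \<le> d * M" unfolding g3_def abs_mult
            using M[OF t] d by (intro mult_mono) auto
        qed
        finally show ?thesis .
      qed
      have "norm (fcalc G (\<lambda>t. (t - x) * f t) u) \<le> 0"
      proof (rule field_le_epsilon)
        fix e :: real assume e: "0 < e"
        define d where "d = min (r / 2) (e / (1 + M * norm u))"
        have pos: "0 < 1 + M * norm u" using M0 by (simp add: add_pos_nonneg)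
        have d: "0 < d" "d < r" using r e pos by (auto simp: d_def)
        have "d * M * norm u \<le> d * (1 + M * norm u)" using d by (simp add: algebra_simps)
        also have "\<dots> \<le> e / (1 + M * norm u) * (1 + M * norm u)"
          using pos by (intro mult_right_mono) (auto simp: d_def)
        also have "\<dots> = e" using pos by simp
        finally show "norm (fcalc G (\<lambda>t. (t - x) * f t) u) \<le> 0 + e" using small[OF d] by simp
      qed
      then show ?thesis using fcalc_shift[OF f, of x u] by simp
    qed
    then have "fcalc G f u \<in> span B" for u by (intro B(2)) simp
    then show "fin_rank (fcalc G f)" unfolding fin_rank_def using B(1) by blast
  qed
qed (use \<rho> in auto)

end

section \<open>The operator of a closed gradient\<close>

text \<open>A uniformly bounded family of operators that converges to zero on a dense set converges to zero strongly.\<close>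

lemma dense_tendsto_zero:
  fixes B :: "'t \<Rightarrow> 'h::real_normed_vector \<Rightarrow> 'h"
  assumes D: "closure D = UNIV" and lin: "\<And>t x y. t \<in> T \<Longrightarrow> B t (x - y) = B t x - B t y"
    and bound: "\<And>t x. t \<in> T \<Longrightarrow> norm (B t x) \<le> M * norm x"
    and T: "eventually (\<lambda>t. t \<in> T) F"
    and conv: "\<And>x. x \<in> D \<Longrightarrow> ((\<lambda>t. B t x) \<longlongrightarrow> 0) F"
  shows "((\<lambda>t. B t x) \<longlongrightarrow> 0) F"
proof (rule tendstoI)
  fix e :: real assume e: "0 < e"
  define d where "d = e / (2 * (1 + \<bar>M\<bar>))"
  have d: "d > 0" using e by (simp add: d_def add_pos_nonneg)
  have "x \<in> closure D" using D by simp
  then obtain y where y: "y \<in> D" "dist y x < d" using d closure_approachable by blast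
  have "\<forall>\<^sub>F t in F. dist (B t y) 0 < e / 2" using conv[OF y(1)] e by (intro tendstoD) auto
  with T show "\<forall>\<^sub>F t in F. dist (B t x) 0 < e"
  proof eventually_elim
    case (elim t)
    have "norm (B t x) = norm (B t (x - y) + B t y)" using lin[OF elim(1)] by simp
    also have "\<dots> \<le> norm (B t (x - y)) + norm (B t y)" by (rule norm_triangle_ineq)
    also have "norm (B t (x - y)) \<le> (1 + \<bar>M\<bar>) * norm (x - y)"
    proof -
      have "M * norm (x - y) \<le> (1 + \<bar>M\<bar>) * norm (x - y)" by (intro mult_right_mono) auto
      then show ?thesis using bound[OF elim(1), of "x - y"] by linarith
    qed
    also have "\<dots> \<le> (1 + \<bar>M\<bar>) * d"
      using y(2) by (intro mult_left_mono) (auto simp: dist_norm norm_minus_commute)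
    also have "\<dots> = e / 2" by (simp add: d_def field_simps)
    finally show ?case using elim(2) by (simp add: dist_norm)
  qed
qed

text \<open>The graph of a closed, densely defined operator from \<open>'h\<close> to \<open>'k\<close>, the abstract version of the gradient. Its
  quadratic form is closed, and every closed nonnegative form with dense domain arises in this way. Density is
  stated as the absence of a nonzero vector orthogonal to the domain.\<close>

locale closed_gradient =
  fixes Gam :: "('h::{real_inner,complete_space} \<times> 'k::{real_inner,complete_space}) set"
  assumes sub_Gam: "subspace Gam" and closed_Gam: "closed Gam"
    and single_Gam: "(0, g) \<in> Gam \<Longrightarrow> g = 0"
    and dense_Gam: "(\<And>v k. (v, k) \<in> Gam \<Longrightarrow> inner z v = 0) \<Longrightarrow> z = 0"
begin

lemma Gam_add: "(u, g) \<in> Gam \<Longrightarrow> (v, k) \<in> Gam \<Longrightarrow> (u + v, g + k) \<in> Gam"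
  using subspace_add[OF sub_Gam] by fastforce

lemma Gam_scale: "(u, g) \<in> Gam \<Longrightarrow> (c *\<^sub>R u, c *\<^sub>R g) \<in> Gam"
  using subspace_scale[OF sub_Gam] by fastforce

lemma Gam_diff: "(u, g) \<in> Gam \<Longrightarrow> (v, k) \<in> Gam \<Longrightarrow> (u - v, g - k) \<in> Gam"
  using subspace_diff[OF sub_Gam] by fastforce

lemma Gam_sum: "(\<And>i. i \<in> I \<Longrightarrow> (u i, g i) \<in> Gam) \<Longrightarrow> (sum u I, sum g I) \<in> Gam"
proof (induction I rule: infinite_finite_induct)
  case (insert i I)
  then show ?case by (simp add: Gam_add)
qed (use subspace_0[OF sub_Gam] in \<open>simp_all add: zero_prod_def\<close>)

text \<open>The Riesz representation theorem in the graph, obtained from an orthogonal projection: rescaling the first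
  component by \<open>sqrt l\<close> turns the form plus \<open>l\<close> times the square of the norm into the norm of the product space.\<close>

lemma resolvent_exists:
  assumes l: "0 < l"
  shows "\<exists>u g. (u, g) \<in> Gam \<and> (\<forall>v k. (v, k) \<in> Gam \<longrightarrow> inner g k + l * inner u v = inner f v)"
proof -
  define s where "s = sqrt l"
  have s: "s > 0" "s * s = l" using l by (auto simp: s_def)
  define m :: "'h \<times> 'k \<Rightarrow> 'h \<times> 'k" where "m p = ((1 / s) *\<^sub>R fst p, snd p)" for p
  have "closed (m -` Gam)"
    unfolding m_def by (intro closed_vimage closed_Gam continuous_intros)
  moreover have "subspace (m -` Gam)"
  proof (rule subspaceI)
    show "0 \<in> m -` Gam" using subspace_0[OF sub_Gam] by (simp add: m_def zero_prod_def)
    show "x + y \<in> m -` Gam" if "x \<in> m -` Gam" "y \<in> m -` Gam" for x y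
      using that Gam_add by (auto simp: m_def scaleR_add_right)
    show "c *\<^sub>R x \<in> m -` Gam" if "x \<in> m -` Gam" for c x
      using Gam_scale[of "fst (m x)" "snd (m x)" c] that by (simp add: m_def)
  qed
  ultimately obtain y where y: "y \<in> m -` Gam"
    and orth: "\<And>z. z \<in> m -` Gam \<Longrightarrow> inner (((1 / s) *\<^sub>R f, 0) - y) z = 0"
    using closed_subspace_projection by blast
  define u where "u = (1 / s) *\<^sub>R fst y"
  define g where "g = snd y"
  have yu: "y = (s *\<^sub>R u, g)" using s by (simp add: u_def g_def)
  have "(u, g) \<in> Gam" using y by (simp add: m_def u_def g_def)
  moreover have "inner g k + l * inner u v = inner f v" if "(v, k) \<in> Gam" for v k
  proof -
    have "(s *\<^sub>R v, k) \<in> m -` Gam" using that s by (simp add: m_def)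
    from orth[OF this] show ?thesis
      using s by (simp add: yu inner_diff_left inner_diff_right algebra_simps)
  qed
  ultimately show ?thesis by blast
qed

text \<open>The resolvent \<open>G = (1 + D\<^sup>* D)\<^sup>-\<^sup>1\<close> together with the gradient of its values.\<close>

definition res :: "'h \<Rightarrow> 'h \<times> 'k" where
  "res f = (SOME p. p \<in> Gam \<and> (\<forall>v k. (v, k) \<in> Gam \<longrightarrow> inner (snd p) k + inner (fst p) v = inner f v))"

definition G :: "'h \<Rightarrow> 'h" where "G f = fst (res f)"
definition dG :: "'h \<Rightarrow> 'k" where "dG f = snd (res f)"

lemma G_in: "(G f, dG f) \<in> Gam"
  and G_eq: "(v, k) \<in> Gam \<Longrightarrow> inner (dG f) k + inner (G f) v = inner f v"
proof -
  have "\<exists>p. p \<in> Gam \<and> (\<forall>v k. (v, k) \<in> Gam \<longrightarrow> inner (snd p) k + inner (fst p) v = inner f v)"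
    using resolvent_exists[of 1 f] by auto
  from someI_ex[OF this, folded res_def]
  show "(G f, dG f) \<in> Gam" "(v, k) \<in> Gam \<Longrightarrow> inner (dG f) k + inner (G f) v = inner f v"
    by (auto simp: G_def dG_def)
qed

lemma G_unique:
  assumes "(u, g) \<in> Gam" "\<And>v k. (v, k) \<in> Gam \<Longrightarrow> inner g k + inner u v = inner f v"
  shows "u = G f" "g = dG f"
proof -
  have d: "(u - G f, g - dG f) \<in> Gam" by (intro Gam_diff assms G_in)
  have "inner (g - dG f) (g - dG f) + inner (u - G f) (u - G f) = 0"
    using assms(2)[OF d] G_eq[OF d, of f]
    by (simp add: inner_diff_left inner_diff_right)
  then have "inner (g - dG f) (g - dG f) = 0" "inner (u - G f) (u - G f) = 0"
    using inner_ge_zero[of "g - dG f"] inner_ge_zero[of "u - G f"] by linarith+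
  then show "u = G f" "g = dG f" by auto
qed

sublocale positive_contraction G
proof (rule positive_contraction.intro)
  show "linear G"
  proof (rule linearI)
    fix x y :: 'h and c :: real
    have "inner (dG x + dG y) k + inner (G x + G y) v = inner (x + y) v" if "(v, k) \<in> Gam" for v k
      using G_eq[OF that, of x] G_eq[OF that, of y] by (simp add: inner_add_left)
    from G_unique(1)[OF Gam_add[OF G_in G_in] this] show "G (x + y) = G x + G y" by simp
    have "inner (c *\<^sub>R dG x) k + inner (c *\<^sub>R G x) v = inner (c *\<^sub>R x) v" if "(v, k) \<in> Gam" for v k
      using arg_cong[where f = "\<lambda>z. c * z", OF G_eq[OF that, of x]] by (simp add: distrib_left)
    from G_unique(1)[OF Gam_scale[OF G_in] this] show "G (c *\<^sub>R x) = c *\<^sub>R G x" by simp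
  qed
  fix x y
  show "inner (G x) y = inner x (G y)"
    using G_eq[OF G_in, of x y] G_eq[OF G_in, of y x] by (simp add: inner_commute)
  show "inner (G x) (G x) \<le> inner (G x) x"
    using G_eq[OF G_in, of x x] inner_ge_zero[of "dG x"]
    unfolding inner_commute[of "G x" x] by linarith
qed

lemma G_injective: "G z = 0 \<Longrightarrow> z = 0"
proof (rule dense_Gam)
  fix v k assume z: "G z = 0" and vk: "(v, k) \<in> Gam"
  have "inner (dG z) (dG z) = 0" using G_eq[OF G_in, of z z] z by simp
  then show "inner z v = 0" using G_eq[OF vk, of z] z by simp
qed

lemma closure_range_G: "closure (range G) = UNIV"
proof (rule dense_of_orthogonal_trivial)
  show "subspace (range G)" using linear_G linear_subspace_image subspace_UNIV by blast
  fix z assume "\<And>v. v \<in> range G \<Longrightarrow> inner z v = 0"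
  then have "inner z (G z) = 0" by blast
  then have "inner (G z) z = 0" by (simp only: inner_commute)
  then have "inner (G z) (G z) \<le> 0" using sq_G[of z] by simp
  then have "inner (G z) (G z) = 0" using inner_ge_zero[of "G z"] by linarith
  then show "z = 0" using G_injective by auto
qed

text \<open>The graph of the self-adjoint operator \<open>D\<^sup>* D\<close>, in its weak formulation.\<close>

definition A :: "('h \<times> 'h) set" where
  "A = {(u, g). \<exists>k. (u, k) \<in> Gam \<and> (\<forall>v l. (v, l) \<in> Gam \<longrightarrow> inner k l = inner g v)}"

lemma A_iff: "(u, g) \<in> A \<longleftrightarrow> u = G (g + u)"
proof
  assume "(u, g) \<in> A"
  then obtain k where k: "(u, k) \<in> Gam" "\<And>v l. (v, l) \<in> Gam \<Longrightarrow> inner k l = inner g v"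
    unfolding A_def by blast
  show "u = G (g + u)" by (rule G_unique(1)[OF k(1)]) (simp add: k(2) inner_add_left)
next
  assume u: "u = G (g + u)"
  have "inner (dG (g + u)) l = inner g v" if "(v, l) \<in> Gam" for v l
    using G_eq[OF that, of "g + u"] u[symmetric] by (simp add: inner_add_left)
  moreover have "(u, dG (g + u)) \<in> Gam" using G_in[of "g + u"] u[symmetric] by simp
  ultimately show "(u, g) \<in> A" unfolding A_def by blast
qed

lemma A_G: "(G f, f - G f) \<in> A"
  by (simp add: A_iff)

definition rset :: "real set" where
  "rset = {l. (\<forall>f. \<exists>(u, g)\<in>A. g - l *\<^sub>R u = f) \<and> (\<exists>C. \<forall>(u, g)\<in>A. norm u \<le> C * norm (g - l *\<^sub>R u))}"

lemma negative_in_rset: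
  assumes l: "l < 0"
  shows "l \<in> rset"
proof -
  have "\<exists>(u, g)\<in>A. g - l *\<^sub>R u = f" for f
  proof -
    obtain u g where u: "(u, g) \<in> Gam"
      "\<And>v k. (v, k) \<in> Gam \<Longrightarrow> inner g k + (- l) * inner u v = inner f v"
      using resolvent_exists[of "- l" f] l by auto
    have "inner g k = inner (f + l *\<^sub>R u) v" if "(v, k) \<in> Gam" for v k
      using u(2)[OF that] by (simp add: inner_add_left)
    then have "(u, f + l *\<^sub>R u) \<in> A" unfolding A_def using u(1) by blast
    then show ?thesis by (intro bexI[of _ "(u, f + l *\<^sub>R u)"]) auto
  qed
  moreover have "norm u \<le> (1 / (- l)) * norm (g - l *\<^sub>R u)" if uA: "(u, g) \<in> A" for u g
  proof -
    obtain k where k: "(u, k) \<in> Gam" "\<And>v m. (v, m) \<in> Gam \<Longrightarrow> inner k m = inner g v"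
      using uA unfolding A_def by blast
    have "(- l) * (norm u)\<^sup>2 \<le> inner (g - l *\<^sub>R u) u"
      using k(2)[OF k(1)] inner_ge_zero[of k] by (simp add: inner_diff_left power2_norm_eq_inner)
    also have "\<dots> \<le> norm (g - l *\<^sub>R u) * norm u" by (rule norm_cauchy_schwarz)
    finally have cs: "(- l) * (norm u)\<^sup>2 \<le> norm (g - l *\<^sub>R u) * norm u" .
    have "(- l) * norm u \<le> norm (g - l *\<^sub>R u)"
    proof (cases "u = 0")
      case False
      have "(- l * norm u) * norm u \<le> norm (g - l *\<^sub>R u) * norm u"
        using cs by (simp add: power2_eq_square mult_ac)
      then show ?thesis using False by (simp only: mult_le_cancel_right) auto
    qed simp
    then show ?thesis using l by (simp add: field_simps)
  qed
  ultimately show ?thesis unfolding rset_def by blast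
qed

text \<open>Under \<open>x = 1/(1 + l)\<close> points \<open>l\<close> of the resolvent set of \<open>D\<^sup>* D\<close> correspond to points \<open>x\<close> of that of \<open>G\<close>, since
  \<open>D\<^sup>* D - l\<close> maps \<open>G v\<close> to \<open>- (1 + l) (G v - x v)\<close>.\<close>

lemma rset_bounded_below:
  assumes l: "l \<in> rset" "0 \<le> l"
  shows "\<exists>c>0. \<forall>v. c * norm v \<le> norm (G v - (1 / (1 + l)) *\<^sub>R v)"
proof -
  obtain C0 where C0: "\<And>u g. (u, g) \<in> A \<Longrightarrow> norm u \<le> C0 * norm (g - l *\<^sub>R u)"
    using l unfolding rset_def by blast
  define C where "C = 1 + \<bar>C0\<bar>"
  have C: "C > 0" by (simp add: C_def add_pos_nonneg)
  define x where "x = 1 / (1 + l)"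
  have x: "x > 0" using l by (simp add: x_def)
  have xl: "x * (1 + l) = 1" using l by (simp add: x_def)
  define K where "K = 1 + C * (1 + l)"
  have K: "K > 0" using C l by (simp add: K_def add_pos_nonneg)
  have "(x / K) * norm v \<le> norm (G v - x *\<^sub>R v)" for v
  proof -
    have e: "(v - G v) - l *\<^sub>R G v = - ((1 + l) *\<^sub>R (G v - x *\<^sub>R v))"
    proof -
      have "(1 + l) *\<^sub>R (x *\<^sub>R v) = v" using xl by (simp add: mult.commute)
      then show ?thesis by (simp add: algebra_simps)
    qed
    have "norm (G v) \<le> C0 * norm ((v - G v) - l *\<^sub>R G v)" by (rule C0[OF A_G])
    also have "\<dots> \<le> C * norm ((v - G v) - l *\<^sub>R G v)"
      by (intro mult_right_mono) (auto simp: C_def)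
    also have "\<dots> = C * (1 + l) * norm (G v - x *\<^sub>R v)"
      unfolding e using l by simp
    finally have 1: "norm (G v) \<le> C * (1 + l) * norm (G v - x *\<^sub>R v)" .
    have "x * norm v = norm (G v - (G v - x *\<^sub>R v))" using x by simp
    also have "\<dots> \<le> norm (G v) + norm (G v - x *\<^sub>R v)" by (rule norm_triangle_ineq4)
    also have "\<dots> \<le> K * norm (G v - x *\<^sub>R v)" using 1 by (simp add: K_def algebra_simps)
    finally show ?thesis using K by (simp add: field_simps)
  qed
  moreover have "x / K > 0" using x K by simp
  ultimately show ?thesis unfolding x_def by blast
qed

text \<open>Cauchy-Schwarz for the form with the mass term added, applied to \<open>G u\<close> and \<open>u\<close>. It turns a
  bound on the energy, which concerns vectors of the form domain, into a bound on the bounded operator \<open>G\<close>.\<close>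

lemma form_le_imp_G_ge:
  assumes u: "(u, k) \<in> Gam" and e: "(norm k)\<^sup>2 \<le> \<eta> * (norm u)\<^sup>2" "0 \<le> \<eta>"
  shows "(norm u)\<^sup>2 / (1 + \<eta>) \<le> inner (G u) u"
proof (cases "u = 0")
  case False
  have n: "(norm u)\<^sup>2 > 0" using False by simp
  have G: "inner (dG u) (dG u) + inner (G u) (G u) = inner (G u) u"
    using G_eq[OF G_in, of u u] by (simp add: inner_commute)
  have "(norm u)\<^sup>2 = inner (dG u, G u) (k, u)"
    using G_eq[OF u, of u] by (simp add: power2_norm_eq_inner)
  then have "((norm u)\<^sup>2)\<^sup>2 \<le> inner (dG u, G u) (dG u, G u) * inner (k, u) (k, u)"
    using Cauchy_Schwarz_ineq[of "(dG u, G u)" "(k, u)"] by simp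
  also have "\<dots> = inner (G u) u * ((norm k)\<^sup>2 + (norm u)\<^sup>2)"
    using G by (simp add: power2_norm_eq_inner)
  also have "\<dots> \<le> inner (G u) u * ((1 + \<eta>) * (norm u)\<^sup>2)"
  proof (rule mult_left_mono)
    show "0 \<le> inner (G u) u" using sq_G[of u] inner_ge_zero[of "G u"] by linarith
  qed (use e in \<open>simp add: algebra_simps\<close>)
  finally have "(norm u)\<^sup>2 * (norm u)\<^sup>2 \<le> (inner (G u) u * (1 + \<eta>)) * (norm u)\<^sup>2"
    by (simp add: power2_eq_square mult_ac)
  then have "(norm u)\<^sup>2 \<le> inner (G u) u * (1 + \<eta>)" using n by (rule mult_right_le_imp_le)
  then show ?thesis using e(2) by (simp add: field_simps)
qed (simp add: G_simps)

end

section \<open>The semigroup\<close>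

text \<open>The function with \<open>heat t (1/(1 + l)) = exp (- t l)\<close>, which makes \<open>heat t (G)\<close> the semigroup generated by
  \<open>- D\<^sup>* D\<close>. It extends continuously by \<open>0\<close> to \<open>x = 0\<close>, the image of \<open>l = \<infinity>\<close>.\<close>

definition heat :: "real \<Rightarrow> real \<Rightarrow> real" where
  "heat t x = (if x \<le> 0 then 0 else exp (- t * (1 / x - 1)))"

lemma heat_range:
  assumes "0 < t" "x \<in> {0..1}"
  shows "0 \<le> heat t x" "heat t x \<le> 1"
proof -
  show "0 \<le> heat t x" by (simp add: heat_def)
  have "0 \<le> t * (1 / x - 1)" if "x > 0" using assms that by (simp add: field_simps)
  then show "heat t x \<le> 1" by (auto simp: heat_def)
qed

lemma continuous_heat:
  assumes t: "0 < t"
  shows "continuous_on {0..1} (heat t)"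
  unfolding continuous_on_eq_continuous_within
proof
  fix x :: real assume x: "x \<in> {0..1}"
  show "continuous (at x within {0..1}) (heat t)"
  proof (cases "x = 0")
    case True
    have "((\<lambda>y. exp (- t * (1 / y - 1))) \<longlongrightarrow> 0) (at_right (0::real))"
      using t by real_asymp
    then have "(heat t \<longlongrightarrow> 0) (at_right 0)"
      by (rule Lim_transform_eventually) (auto simp: heat_def eventually_at_right_less intro: eventually_mono[OF eventually_at_right_less])
    then have "(heat t \<longlongrightarrow> 0) (at 0 within {0..1})"
      by (simp add: at_within_Icc_at_right)
    then show ?thesis by (simp add: continuous_within heat_def True)
  next
    case False
    then have x0: "x > 0" using x by simp
    have "((\<lambda>y. exp (- t * (1 / y - 1))) \<longlongrightarrow> exp (- t * (1 / x - 1))) (at x)"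
      using x0 by (intro tendsto_intros) auto
    then have "(heat t \<longlongrightarrow> heat t x) (at x)"
    proof (rule Lim_transform_eventually[THEN tendsto_eq_rhs])
      have "\<forall>\<^sub>F y in at x. y > 0" using x0 order_tendstoD(1)[OF tendsto_ident_at] by blast
      then show "\<forall>\<^sub>F y in at x. exp (- t * (1 / y - 1)) = heat t y"
        by eventually_elim (simp add: heat_def)
    qed (use x0 in \<open>simp add: heat_def\<close>)
    then show ?thesis unfolding continuous_within using tendsto_within_subset by blast
  qed
qed

lemma heat_add: "0 < s \<Longrightarrow> 0 < t \<Longrightarrow> heat (s + t) x = heat s x * heat t x"
  by (simp add: heat_def exp_add[symmetric] algebra_simps)

lemma heat_decay:
  assumes t: "0 < t" and x: "x \<in> {0..1}"
  shows "\<bar>heat t x * x - x\<bar> \<le> t"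
proof (cases "x = 0")
  case False
  then have x0: "x > 0" "x \<le> 1" using x by auto
  have "1 - heat t x \<le> t * (1 / x - 1)"
    using x0 exp_ge_add_one_self[of "- t * (1 / x - 1)"] by (simp add: heat_def)
  then have "x * (1 - heat t x) \<le> x * (t * (1 / x - 1))" using x0 by (intro mult_left_mono) auto
  also have "\<dots> = t * (1 - x)" using x0 by (simp add: field_simps)
  also have "\<dots> \<le> t * 1" using x0 t by (intro mult_left_mono) auto
  finally have "x * (1 - heat t x) \<le> t" by simp
  moreover have "0 \<le> x * (1 - heat t x)" using x0 heat_range[OF t x] by simp
  ultimately show ?thesis by (simp add: algebra_simps abs_if)
qed (use t in simp)

text \<open>The deviation of the difference quotient of the semigroup from its limit, both multiplied by the resolvent:
  in terms of \<open>l\<close> it is \<open>((exp (- t l) - 1)/t + l)/(1 + l)\<close>. It is bounded uniformly in \<open>t\<close>, and of order \<open>t\<close> after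
  another multiplication by the resolvent; hence it tends to zero strongly.\<close>

definition heat_error :: "real \<Rightarrow> real \<Rightarrow> real" where
  "heat_error t x = (heat t x * x - x) / t - (x - 1)"

lemma heat_error_bounds:
  assumes t: "0 < t" and x: "x \<in> {0..1}"
  shows "\<bar>heat_error t x\<bar> \<le> 1" "\<bar>heat_error t x * x\<bar> \<le> t"
proof -
  have "\<bar>heat_error t x\<bar> \<le> 1 \<and> \<bar>heat_error t x * x\<bar> \<le> t"
  proof (cases "x = 0")
    case False
    then have x0: "x > 0" "x \<le> 1" using x by auto
    define y where "y = t * (1 / x - 1)"
    have y0: "0 \<le> y" using x0 t by (simp add: y_def field_simps)
    have xy: "x * y = t * (1 - x)" using x0 by (simp add: y_def field_simps)
    have "x * ((heat t x - 1) + y) = t * heat_error t x"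
    proof -
      have "t * heat_error t x = (heat t x * x - x) - t * (x - 1)"
        using t by (simp add: heat_error_def field_simps)
      then show ?thesis using xy by (simp add: algebra_simps)
    qed
    moreover have "heat t x = exp (- y)" using x0 by (simp add: heat_def y_def)
    ultimately have "heat_error t x * t = x * (exp (- y) - 1 + y)" by (simp add: mult.commute)
    then have e: "heat_error t x = x * (exp (- y) - 1 + y) / t"
      using t by (simp add: eq_divide_eq)
    have lo: "0 \<le> exp (- y) - 1 + y" using exp_ge_add_one_self[of "- y"] by simp
    have up1: "exp (- y) - 1 + y \<le> y" using y0 by simp
    have "exp (- y) \<le> 1 / (1 + y)"
      using exp_ge_add_one_self[of y] y0 by (simp add: exp_minus inverse_eq_divide frac_le)
    also have "1 / (1 + y) \<le> 1 - y + y\<^sup>2"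
    proof -
      have "1 \<le> (1 - y + y\<^sup>2) * (1 + y)"
        using y0 by (simp add: algebra_simps power2_eq_square)
      then show ?thesis using y0 by (simp add: divide_le_eq)
    qed
    finally have up2: "exp (- y) - 1 + y \<le> y\<^sup>2" by simp
    have "x * (exp (- y) - 1 + y) \<le> t * (1 - x)"
      using mult_left_mono[OF up1, of x] x0 xy by simp
    also have "\<dots> \<le> t" using x0 t by (simp add: algebra_simps)
    finally have 1: "heat_error t x \<le> 1" using t by (simp add: e)
    have 0: "0 \<le> heat_error t x" using lo x0 t by (simp add: e)
    have "x * (x * (exp (- y) - 1 + y)) \<le> x * (x * y\<^sup>2)"
      using up2 x0 by (intro mult_left_mono) auto
    also have "\<dots> = (x * y)\<^sup>2" by (simp add: power2_eq_square)
    also have "\<dots> = t\<^sup>2 * (1 - x)\<^sup>2" by (simp add: xy power_mult_distrib)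
    also have "\<dots> \<le> t\<^sup>2 * 1" using x0 by (intro mult_left_mono power_le_one) auto
    finally have "heat_error t x * x \<le> t" using t by (simp add: e field_simps power2_eq_square)
    moreover have "0 \<le> heat_error t x * x" using 0 x0 by simp
    ultimately show ?thesis using 0 1 by simp
  qed (use t in \<open>simp add: heat_error_def\<close>)
  then show "\<bar>heat_error t x\<bar> \<le> 1" "\<bar>heat_error t x * x\<bar> \<le> t" by auto
qed

text \<open>Bessel's inequality makes the squared coefficients summable.\<close>

lemma orthonormal_inner_tendsto_0:
  fixes e :: "nat \<Rightarrow> 'h::real_inner"
  assumes on: "\<And>i j. inner (e i) (e j) = (if i = j then 1 else 0)"
  shows "(\<lambda>n. inner g (e n)) \<longlonglongrightarrow> 0"
proof -
  have bessel: "(\<Sum>i<n. (inner g (e i))\<^sup>2) \<le> (norm g)\<^sup>2" for n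
  proof -
    define p where "p = (\<Sum>i<n. inner g (e i) *\<^sub>R e i)"
    have gp: "inner g p = (\<Sum>i<n. (inner g (e i))\<^sup>2)"
      by (simp add: p_def inner_sum_right power2_eq_square)
    have pp: "inner p p = (\<Sum>i<n. (inner g (e i))\<^sup>2)"
      unfolding p_def by (simp add: inner_sum_right inner_sum_left on if_distrib sum.delta power2_eq_square cong: if_cong)
    have "0 \<le> inner (g - p) (g - p)" by simp
    also have "\<dots> = (norm g)\<^sup>2 - (\<Sum>i<n. (inner g (e i))\<^sup>2)"
      using gp pp by (simp add: inner_diff_left inner_diff_right inner_commute power2_norm_eq_inner)
    finally show ?thesis by simp
  qed
  then have "summable (\<lambda>n. (inner g (e n))\<^sup>2)"
    by (intro summableI_nonneg_bounded[where x = "(norm g)\<^sup>2"]) auto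
  then have "(\<lambda>n. (inner g (e n))\<^sup>2) \<longlonglongrightarrow> 0" by (rule summable_LIMSEQ_zero)
  from tendsto_real_sqrt[OF this] have "(\<lambda>n. \<bar>inner g (e n)\<bar>) \<longlonglongrightarrow> 0" by simp
  then show ?thesis by (rule tendsto_rabs_zero_cancel)
qed

text \<open>By the equivalence in the last clause the generator is exactly \<open>- A\<close>, including its domain.\<close>

definition contraction_semigroup ::
    "('h::real_inner \<times> 'h) set \<Rightarrow> (real \<Rightarrow> 'h \<Rightarrow> 'h) \<Rightarrow> bool" where
  "contraction_semigroup A T \<longleftrightarrow>
     (\<forall>t>0. linear (T t)) \<and>
     (\<forall>t>0. \<forall>f. norm (T t f) \<le> norm f) \<and>
     (\<forall>s>0. \<forall>t>0. \<forall>f. T (s + t) f = T s (T t f)) \<and>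
     (\<forall>f. ((\<lambda>t. T t f) \<longlongrightarrow> f) (at_right 0)) \<and>
     (\<forall>u g. (u, g) \<in> A \<longleftrightarrow> ((\<lambda>t. (1 / t) *\<^sub>R (T t u - u)) \<longlongrightarrow> - g) (at_right 0))"

text \<open>By contractivity \<open>T t u - u\<close> is at most \<open>n\<close> times the displacement over time \<open>t/n\<close>, which is asymptotically
  \<open>t \<bar>g\<bar>/n\<close>.\<close>

lemma contraction_semigroup_displacement:
  assumes T: "contraction_semigroup A T" and ug: "(u, g) \<in> A" and t: "0 < t"
  shows "norm (T t u - u) \<le> t * norm g"
proof -
  have lin: "\<And>t. t > 0 \<Longrightarrow> linear (T t)" and con: "\<And>t f. t > 0 \<Longrightarrow> norm (T t f) \<le> norm f"
    and add: "\<And>s t f. s > 0 \<Longrightarrow> t > 0 \<Longrightarrow> T (s + t) f = T s (T t f)"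
    and gen: "((\<lambda>t. (1 / t) *\<^sub>R (T t u - u)) \<longlongrightarrow> - g) (at_right 0)"
    using T ug unfolding contraction_semigroup_def by auto
  have step: "norm (T (real (Suc n) * h) u - u) \<le> real (Suc n) * norm (T h u - u)" if h: "h > 0" for n h
  proof (induction n)
    case (Suc n)
    have "T (real (Suc (Suc n)) * h) u = T (real (Suc n) * h) (T h u)"
    proof -
      have "0 < real (Suc n) * h" using h by simp
      moreover have "real (Suc (Suc n)) * h = real (Suc n) * h + h" by (simp add: algebra_simps)
      ultimately show ?thesis using add[of "real (Suc n) * h" h u] h by simp
    qed
    then have "T (real (Suc (Suc n)) * h) u - u
        = T (real (Suc n) * h) (T h u - u) + (T (real (Suc n) * h) u - u)"
      using lin[of "real (Suc n) * h"] h by (simp add: linear_diff del: of_nat_Suc)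
    also have "norm \<dots> \<le> norm (T (real (Suc n) * h) (T h u - u)) + norm (T (real (Suc n) * h) u - u)"
      by (rule norm_triangle_ineq)
    also have "\<dots> \<le> norm (T h u - u) + real (Suc n) * norm (T h u - u)"
      using h by (intro add_mono con Suc.IH) simp
    also have "\<dots> = real (Suc (Suc n)) * norm (T h u - u)" by (simp add: algebra_simps)
    finally show ?case .
  qed simp
  define h where "h n = t / real (Suc n)" for n
  have hpos: "h n > 0" for n using t by (simp add: h_def)
  have h0: "filterlim h (at_right 0) sequentially"
  proof (rule tendsto_imp_filterlim_at_right)
    have "(\<lambda>n. t * inverse (real (Suc n))) \<longlonglongrightarrow> t * 0" by (intro tendsto_intros LIMSEQ_inverse_real_of_nat)
    then show "h \<longlonglongrightarrow> 0" by (simp add: h_def[abs_def] divide_inverse)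
  qed (use hpos in auto)
  have "(\<lambda>n. t * norm ((1 / h n) *\<^sub>R (T (h n) u - u))) \<longlonglongrightarrow> t * norm (- g)"
    by (intro tendsto_intros filterlim_compose[OF gen h0])
  moreover have "norm (T t u - u) \<le> t * norm ((1 / h n) *\<^sub>R (T (h n) u - u))" for n
  proof -
    have "norm (T t u - u) \<le> real (Suc n) * norm (T (h n) u - u)"
      using step[OF hpos, of n n] by (simp add: h_def del: of_nat_Suc)
    also have "\<dots> = t * norm ((1 / h n) *\<^sub>R (T (h n) u - u))"
      using t hpos[of n] by (simp add: h_def del: of_nat_Suc)
    finally show ?thesis .
  qed
  ultimately have "norm (T t u - u) \<le> t * norm (- g)"
    by (intro LIMSEQ_le_const) auto
  then show ?thesis by simp
qed

context closed_gradient
begin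

definition S :: "real \<Rightarrow> 'h \<Rightarrow> 'h" where
  "S t = fcalc G (heat t)"

lemma bounded_linear_G: "bounded_linear G"
  using linear_G norm_G by (intro bounded_linear_intro[where K = 1]) (auto simp: G_simps)

lemma fcalc_G: "continuous_on {0..1} f \<Longrightarrow> fcalc G (\<lambda>t. f t * t) x = fcalc G f (G x)"
  using fcalc_mult[of f "\<lambda>t. t" x] by (simp add: fcalc_id continuous_on_id)

lemma heat_error_op:
  assumes t: "0 < t"
  shows "fcalc G (heat_error t) h = (1 / t) *\<^sub>R (S t (G h) - G h) - (G h - h)"
    and "continuous_on {0..1} (heat_error t)"
proof -
  note c = continuous_heat[OF t]
  show "continuous_on {0..1} (heat_error t)"
    unfolding heat_error_def[abs_def] by (intro continuous_intros c) (use t in auto)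
  have c1: "continuous_on {0..1} (\<lambda>x. (heat t x * x) * (1 / t))"
    and c2: "continuous_on {0..1} (\<lambda>x. x * (- 1 / t - 1))"
    and c3: "continuous_on {0..1} (\<lambda>x. x * (- 1 / t - 1) + 1)"
    and c4: "continuous_on {0..1} (\<lambda>x. heat t x * x)"
    by (intro continuous_intros c)+
  have "heat_error t = (\<lambda>x. (heat t x * x) * (1 / t) + (x * (- 1 / t - 1) + 1))"
    using t by (simp add: fun_eq_iff heat_error_def field_simps)
  then have "fcalc G (heat_error t) h = fcalc G (\<lambda>x. (heat t x * x) * (1 / t)) h
      + (fcalc G (\<lambda>x. x * (- 1 / t - 1)) h + h)"
    by (simp only: fcalc_add[OF c1 c3] fcalc_add[OF c2 continuous_on_const] fcalc_const scaleR_one)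
  also have "fcalc G (\<lambda>x. (heat t x * x) * (1 / t)) h = (1 / t) *\<^sub>R S t (G h)"
    by (simp only: fcalc_mult[OF c4 continuous_on_const] fcalc_const linear_scale[OF linear_fcalc[OF c4]])
       (simp only: fcalc_G[OF c] S_def)
  also have "fcalc G (\<lambda>x. x * (- 1 / t - 1)) h = (- 1 / t - 1) *\<^sub>R G h"
    by (simp only: fcalc_mult[OF continuous_on_id continuous_on_const] fcalc_id fcalc_const G_simps)
  finally show "fcalc G (heat_error t) h = (1 / t) *\<^sub>R (S t (G h) - G h) - (G h - h)"
    by (simp add: algebra_simps)
qed

lemma S_linear: "0 < t \<Longrightarrow> linear (S t)"
  unfolding S_def by (intro linear_fcalc continuous_heat)

lemma S_norm: "0 < t \<Longrightarrow> norm (S t x) \<le> norm x"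
  unfolding S_def using fcalc_norm[OF continuous_heat, of t 1 x] heat_range[of t] by simp

lemma S_commute: "0 < t \<Longrightarrow> S t (G x) = G (S t x)"
  using fcalc_mult[OF continuous_on_id continuous_heat, of t x]
    fcalc_mult[OF continuous_heat continuous_on_id, of t x]
  by (simp add: S_def fcalc_id mult.commute)

lemma pos_at_right: "\<forall>\<^sub>F t::real in at_right 0. t \<in> {0<..}"
  by (simp add: eventually_at_right_less)

lemma S_strongly_continuous: "((\<lambda>t. S t x) \<longlongrightarrow> x) (at_right 0)"
proof -
  have "((\<lambda>t. S t x - x) \<longlongrightarrow> 0) (at_right 0)"
  proof (rule dense_tendsto_zero[OF closure_range_G _ _ pos_at_right, where M = 2])
    fix t :: real and x y assume t: "t \<in> {0<..}"
    show "S t (x - y) - (x - y) = S t x - x - (S t y - y)"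
      using t by (simp add: linear_diff[OF S_linear])
    show "norm (S t x - x) \<le> 2 * norm x"
      using norm_triangle_ineq4[of "S t x" x] S_norm[of t x] t by simp
  next
    fix x assume "x \<in> range G"
    then obtain h where x: "x = G h" by blast
    show "((\<lambda>t. S t x - x) \<longlongrightarrow> 0) (at_right 0)"
    proof (rule Lim_null_comparison)
      show "\<forall>\<^sub>F t in at_right 0. norm (S t x - x) \<le> t * norm h"
        using pos_at_right
      proof eventually_elim
        case (elim t)
        then have t: "0 < t" by simp
        note c = continuous_heat[OF t]
        have c1: "continuous_on {0..1} (\<lambda>x. heat t x * x)" by (intro continuous_intros c)
        have c2: "continuous_on {0..1} (\<lambda>x::real. x * (- 1))" by (intro continuous_intros)
        have "fcalc G (\<lambda>x. heat t x * x + x * (- 1)) h = S t x - x"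
          unfolding fcalc_add[OF c1 c2] fcalc_G[OF c] fcalc_mult[OF continuous_on_id continuous_on_const]
            fcalc_id fcalc_const S_def x G_simps by simp
        moreover have "norm (fcalc G (\<lambda>x. heat t x * x + x * (- 1)) h) \<le> t * norm h"
          by (rule fcalc_norm) (use heat_decay[OF t] in \<open>auto intro!: continuous_intros c\<close>)
        ultimately show ?case by simp
      qed
      have "((\<lambda>t. t * norm h) \<longlongrightarrow> 0 * norm h) (at_right 0)" by (intro tendsto_intros)
      then show "((\<lambda>t. t * norm h) \<longlongrightarrow> 0) (at_right 0)" by simp
    qed
  qed
  then show ?thesis by (simp add: Lim_null[symmetric])
qed

lemma S_generator_on_domain:
  "((\<lambda>t. (1 / t) *\<^sub>R (S t (G h) - G h)) \<longlongrightarrow> G h - h) (at_right 0)"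
proof -
  have "((\<lambda>t. fcalc G (heat_error t) h) \<longlongrightarrow> 0) (at_right 0)"
  proof (rule dense_tendsto_zero[OF closure_range_G _ _ pos_at_right, where M = 1])
    fix t :: real and x y assume t: "t \<in> {0<..}"
    then have t0: "0 < t" by simp
    note c = heat_error_op(2)[OF t0]
    show "fcalc G (heat_error t) (x - y) = fcalc G (heat_error t) x - fcalc G (heat_error t) y"
      using linear_fcalc[OF c] by (rule linear_diff)
    show "norm (fcalc G (heat_error t) x) \<le> 1 * norm x"
      by (rule fcalc_norm[OF c heat_error_bounds(1)[OF t0]])
  next
    fix x assume "x \<in> range G"
    then obtain k where x: "x = G k" by blast
    show "((\<lambda>t. fcalc G (heat_error t) x) \<longlongrightarrow> 0) (at_right 0)"
    proof (rule Lim_null_comparison)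
      show "\<forall>\<^sub>F t in at_right 0. norm (fcalc G (heat_error t) x) \<le> t * norm k"
        using pos_at_right
      proof eventually_elim
        case (elim t)
        then have t: "0 < t" by simp
        note c = heat_error_op(2)[OF t]
        show ?case unfolding x fcalc_G[OF c, symmetric]
          by (rule fcalc_norm[OF _ heat_error_bounds(2)[OF t]]) (intro continuous_intros c)
      qed
      have "((\<lambda>t. t * norm k) \<longlongrightarrow> 0 * norm k) (at_right 0)" by (intro tendsto_intros)
      then show "((\<lambda>t. t * norm k) \<longlongrightarrow> 0) (at_right 0)" by simp
    qed
  qed
  then have "((\<lambda>t. (1 / t) *\<^sub>R (S t (G h) - G h) - (G h - h)) \<longlongrightarrow> 0) (at_right 0)"
    by (rule Lim_transform_eventually)
       (use pos_at_right in \<open>auto simp: heat_error_op elim: eventually_mono\<close>)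
  then show ?thesis by (simp only: Lim_null[symmetric])
qed

text \<open>Only the graph of \<open>A\<close> admits a limit of difference quotients: \<open>G\<close> commutes with the semigroup, and on the range of
  \<open>G\<close> the limit is known.\<close>

lemma S_generator:
  "(u, g) \<in> A \<longleftrightarrow> ((\<lambda>t. (1 / t) *\<^sub>R (S t u - u)) \<longlongrightarrow> - g) (at_right 0)"
proof
  assume "(u, g) \<in> A"
  then have u: "G (g + u) = u" by (simp add: A_iff)
  show "((\<lambda>t. (1 / t) *\<^sub>R (S t u - u)) \<longlongrightarrow> - g) (at_right 0)"
    using S_generator_on_domain[of "g + u"] unfolding u by simp
next
  assume lim: "((\<lambda>t. (1 / t) *\<^sub>R (S t u - u)) \<longlongrightarrow> - g) (at_right 0)"
  have "((\<lambda>t. G ((1 / t) *\<^sub>R (S t u - u))) \<longlongrightarrow> G (- g)) (at_right 0)"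
    by (rule bounded_linear.tendsto[OF bounded_linear_G lim])
  then have "((\<lambda>t. (1 / t) *\<^sub>R (S t (G u) - G u)) \<longlongrightarrow> G (- g)) (at_right 0)"
    by (rule Lim_transform_eventually)
       (use pos_at_right in \<open>auto simp: S_commute G_simps elim: eventually_mono\<close>)
  from tendsto_unique[OF _ this S_generator_on_domain[of u]]
  have "G (- g) = G u - u" by simp
  then have "u = G (g + u)" using linear_neg[OF linear_G, of g] by (simp add: G_simps algebra_simps)
  then show "(u, g) \<in> A" by (simp add: A_iff)
qed

lemma contraction_semigroup_S: "contraction_semigroup A S"
  unfolding contraction_semigroup_def
proof (intro conjI allI impI)
  fix s t :: real and f assume st: "0 < s" "0 < t"
  have "heat (s + t) = (\<lambda>x. heat s x * heat t x)" using heat_add[OF st] by auto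
  then show "S (s + t) f = S s (S t f)"
    unfolding S_def using fcalc_mult[OF continuous_heat continuous_heat] st by simp
qed (use S_linear S_norm S_strongly_continuous S_generator in auto)

section \<open>Consequences of infinitely many orthogonal states of low energy\<close>

text \<open>Orthogonality is required in the Hilbert space and for the form, so that linear combinations keep the energy bound.\<close>

definition low_energy :: "real \<Rightarrow> (nat \<Rightarrow> 'h) \<Rightarrow> (nat \<Rightarrow> 'k) \<Rightarrow> bool" where
  "low_energy \<eta> u k \<longleftrightarrow> (\<forall>i. (u i, k i) \<in> Gam \<and> norm (u i) = 1 \<and> (norm (k i))\<^sup>2 \<le> \<eta>) \<and>
     (\<forall>i j. i \<noteq> j \<longrightarrow> inner (u i) (u j) = 0 \<and> inner (k i) (k j) = 0)"

text \<open>The vectors \<open>G u\<^sub>n\<close> lie in the domain of the generator with uniform bounds, so for small \<open>t\<close> the semigroup hardly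
  moves them and \<open>\<langle>T\<^sub>t G u\<^sub>n, u\<^sub>n\<rangle>\<close> stays away from \<open>0\<close>. If \<open>T\<^sub>t G u\<^sub>n\<close> had a convergent subsequence, these numbers
  would tend to zero, because an orthonormal sequence tends to zero weakly.\<close>

lemma low_energy_noncompact:
  assumes T: "contraction_semigroup A T" and low: "low_energy \<eta> u k" and \<eta>: "0 \<le> \<eta>"
  shows "\<exists>t>0. \<exists>x :: nat \<Rightarrow> 'h. (\<forall>n. norm (x n) \<le> 1) \<and>
           \<not> (\<exists>r g. strict_mono r \<and> (\<lambda>n. T t (x (r n))) \<longlonglongrightarrow> g)"
proof -
  \<comment> \<open>Half of the lower bound \<open>1/(1 + \<eta>)\<close> for \<open>\<langle>G u\<^sub>n, u\<^sub>n\<rangle>\<close>; the displacement of \<open>G u\<^sub>n\<close> over time \<open>t\<close> is at most \<open>t\<close>.\<close>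
  define t where "t = 1 / (2 * (1 + \<eta>))"
  have t: "t > 0" and t2: "1 / (1 + \<eta>) = 2 * t" using \<eta> by (simp_all add: t_def field_simps)
  have big: "t \<le> inner (T t (G (u n))) (u n)" for n
  proof -
    have un: "norm (u n) = 1" "(u n, k n) \<in> Gam" "(norm (k n))\<^sup>2 \<le> \<eta> * (norm (u n))\<^sup>2"
      using low by (auto simp: low_energy_def)
    have 1: "2 * t \<le> inner (G (u n)) (u n)"
      using form_le_imp_G_ge[OF un(2,3) \<eta>] un(1) t2 by simp
    have "(norm (u n - G (u n)))\<^sup>2 = 1 - 2 * inner (G (u n)) (u n) + inner (G (u n)) (G (u n))"
      using un(1) by (simp add: power2_norm_eq_inner inner_diff_left inner_diff_right inner_commute norm_eq_1)
    also have "\<dots> \<le> 1" using sq_G[of "u n"] inner_ge_zero[of "G (u n)"] by linarith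
    finally have "norm (u n - G (u n)) \<le> 1" by (simp add: abs_square_le_1)
    then have "norm (T t (G (u n)) - G (u n)) \<le> t"
      using contraction_semigroup_displacement[OF T A_G t, of "u n"] t
      by (smt (verit) mult_left_le)
    moreover have "inner (G (u n) - T t (G (u n))) (u n) \<le> norm (G (u n) - T t (G (u n))) * norm (u n)"
      by (rule norm_cauchy_schwarz)
    ultimately show ?thesis using 1 un(1) by (simp add: inner_diff_left norm_minus_commute)
  qed
  have "\<not> (\<exists>r g. strict_mono r \<and> (\<lambda>n. T t (G (u (r n)))) \<longlonglongrightarrow> g)"
  proof
    assume "\<exists>r g. strict_mono r \<and> (\<lambda>n. T t (G (u (r n)))) \<longlonglongrightarrow> g"
    then obtain r g where r: "strict_mono (r :: nat \<Rightarrow> nat)" and lim: "(\<lambda>n. T t (G (u (r n)))) \<longlonglongrightarrow> g" by blast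
    have on: "inner (u (r i)) (u (r j)) = (if i = j then 1 else 0)" for i j
      using low strict_mono_eq[OF r, of i j] by (auto simp: low_energy_def norm_eq_1 low_energy_def)
    have g0: "(\<lambda>n. inner g (u (r n))) \<longlonglongrightarrow> 0" by (rule orthonormal_inner_tendsto_0[OF on])
    have "(\<lambda>n. inner (T t (G (u (r n))) - g) (u (r n))) \<longlonglongrightarrow> 0"
    proof (rule Lim_null_comparison)
      show "\<forall>\<^sub>F n in sequentially. norm (inner (T t (G (u (r n))) - g) (u (r n))) \<le> norm (T t (G (u (r n))) - g)"
      proof (intro always_eventually allI)
        fix n
        have "norm (u (r n)) = 1" using low by (simp add: low_energy_def)
        then show "norm (inner (T t (G (u (r n))) - g) (u (r n))) \<le> norm (T t (G (u (r n))) - g)"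
          using Cauchy_Schwarz_ineq2[of "T t (G (u (r n))) - g" "u (r n)"] by simp
      qed
      show "(\<lambda>n. norm (T t (G (u (r n))) - g)) \<longlonglongrightarrow> 0"
        using lim tendsto_norm_zero LIM_zero by blast
    qed
    from tendsto_add[OF this g0] have "(\<lambda>n. inner (T t (G (u (r n)))) (u (r n))) \<longlonglongrightarrow> 0"
      by (simp add: inner_diff_left)
    then have "t \<le> 0" using big by (intro LIMSEQ_le_const) auto
    with t show False by simp
  qed
  moreover have "norm (G (u n)) \<le> 1" for n
    using norm_G[of "u n"] low by (simp add: low_energy_def)
  ultimately show ?thesis using t by (intro exI[of _ t] conjI exI[of _ "\<lambda>n. G (u n)"]) auto
qed

text \<open>More vectors than the rank of \<open>F\<close> have a nontrivial combination in its kernel, and by orthogonality the energy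
  bound passes to it.\<close>

lemma low_energy_combination:
  assumes low: "low_energy \<eta> u k" and \<eta>: "0 \<le> \<eta>" and B: "finite B"
    and F: "linear F" "range F \<subseteq> span B"
  shows "\<exists>v l. (v, l) \<in> Gam \<and> v \<noteq> 0 \<and> (norm l)\<^sup>2 \<le> \<eta> * (norm v)\<^sup>2 \<and> F v = 0"
proof -
  define n where "n = card B"
  have "\<exists>c. (\<exists>i\<le>n. c i \<noteq> 0) \<and> (\<Sum>i\<le>n. c i *\<^sub>R F (u i)) = 0"
  proof (cases "inj_on (\<lambda>i. F (u i)) {..n}")
    case True
    define I where "I = (\<lambda>i. F (u i)) ` {..n}"
    have card: "card I = n + 1" using True by (simp add: I_def card_image)
    have "dependent I"
    proof (rule ccontr)
      assume "\<not> dependent I"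
      moreover have "I \<subseteq> span B" using F(2) by (auto simp: I_def)
      ultimately have "card I \<le> card B" using independent_span_bound[OF B] by blast
      then show False using card by (simp add: n_def)
    qed
    moreover have "finite I" by (simp add: I_def)
    ultimately obtain d where d: "\<exists>v\<in>I. d v \<noteq> 0" "(\<Sum>v\<in>I. d v *\<^sub>R v) = 0"
      using dependent_finite by blast
    have "(\<Sum>i\<le>n. d (F (u i)) *\<^sub>R F (u i)) = 0"
      using d(2) True by (simp add: I_def sum.reindex)
    moreover have "\<exists>i\<le>n. d (F (u i)) \<noteq> 0" using d(1) by (auto simp: I_def)
    ultimately show ?thesis by (intro exI[of _ "\<lambda>i. d (F (u i))"]) auto
  next
    case False
    then obtain i j where ij: "i \<le> n" "j \<le> n" "i \<noteq> j" "F (u i) = F (u j)" by (auto simp: inj_on_def)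
    define c where "c m = (if m = i then 1 else if m = j then - 1 else 0 :: real)" for m
    have "(\<Sum>m\<le>n. c m *\<^sub>R F (u m)) = (\<Sum>m\<in>{i, j}. c m *\<^sub>R F (u m))"
      by (rule sum.mono_neutral_right) (use ij in \<open>auto simp: c_def\<close>)
    also have "\<dots> = 0" using ij by (simp add: c_def)
    finally show ?thesis using ij(1) by (intro exI[of _ c]) (auto simp: c_def)
  qed
  then obtain c where c: "\<exists>i\<le>n. c i \<noteq> 0" "(\<Sum>i\<le>n. c i *\<^sub>R F (u i)) = 0" by blast
  define v where "v = (\<Sum>i\<le>n. c i *\<^sub>R u i)"
  define l where "l = (\<Sum>i\<le>n. c i *\<^sub>R k i)"
  have "(v, l) \<in> Gam" unfolding v_def l_def
    by (rule Gam_sum) (use low in \<open>auto simp: low_energy_def intro: Gam_scale\<close>)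
  have pyth: "(norm (\<Sum>i\<le>n. c i *\<^sub>R w i))\<^sup>2 = (\<Sum>i\<le>n. (c i)\<^sup>2 * (norm (w i))\<^sup>2)"
    if o: "\<And>i j. i \<noteq> j \<Longrightarrow> inner (w i) (w j) = 0" for w :: "nat \<Rightarrow> 'x::real_inner"
  proof -
    have "(norm (\<Sum>i\<le>n. c i *\<^sub>R w i))\<^sup>2 = (\<Sum>i\<le>n. \<Sum>j\<le>n. c i * (c j * inner (w i) (w j)))"
      unfolding power2_norm_eq_inner inner_sum_left inner_sum_right inner_scaleR_left inner_scaleR_right
      by (intro sum.cong refl) (simp add: inner_commute sum_distrib_left mult_ac)
    also have "\<dots> = (\<Sum>i\<le>n. \<Sum>j\<le>n. if i = j then (c i)\<^sup>2 * (norm (w i))\<^sup>2 else 0)"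
      using o by (intro sum.cong refl) (auto simp: power2_norm_eq_inner power2_eq_square[of "c _"])
    also have "\<dots> = (\<Sum>i\<le>n. (c i)\<^sup>2 * (norm (w i))\<^sup>2)" by (simp add: sum.delta')
    finally show ?thesis .
  qed
  have nv: "(norm v)\<^sup>2 = (\<Sum>i\<le>n. (c i)\<^sup>2)"
    unfolding v_def using low by (subst pyth) (auto simp: low_energy_def)
  have "(norm l)\<^sup>2 = (\<Sum>i\<le>n. (c i)\<^sup>2 * (norm (k i))\<^sup>2)"
    unfolding l_def using low by (subst pyth) (auto simp: low_energy_def)
  also have "\<dots> \<le> (\<Sum>i\<le>n. (c i)\<^sup>2 * \<eta>)"
    using low by (intro sum_mono mult_left_mono) (auto simp: low_energy_def)
  also have "\<dots> = \<eta> * (norm v)\<^sup>2" by (simp add: nv sum_distrib_left mult.commute)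
  finally have "(norm l)\<^sup>2 \<le> \<eta> * (norm v)\<^sup>2" .
  moreover have "v \<noteq> 0"
  proof
    assume "v = 0"
    then have "(\<Sum>i\<le>n. (c i)\<^sup>2) = 0" using nv by simp
    then have "\<forall>i\<in>{..n}. (c i)\<^sup>2 = 0" by (subst (asm) sum_nonneg_eq_0_iff) auto
    then show False using c(1) by auto
  qed
  moreover have "F v = 0" using c(2) F(1) by (simp add: v_def linear_sum linear_scale)
  ultimately show ?thesis using \<open>(v, l) \<in> Gam\<close> by blast
qed

text \<open>Points at which the spectrum is at most an isolated eigenvalue of finite multiplicity.\<close>

definition discrete_at :: "real \<Rightarrow> bool" where
  "discrete_at l \<longleftrightarrow> (\<exists>\<delta>>0. \<forall>m. 0 < \<bar>m - l\<bar> \<and> \<bar>m - l\<bar> < \<delta> \<longrightarrow> m \<in> rset) \<and>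
     (\<exists>B. finite B \<and> (\<forall>u. (u, l *\<^sub>R u) \<in> A \<longrightarrow> u \<in> span B))"

lemma fin_rank_at_discrete:
  assumes l: "0 \<le> l" and "l \<in> rset \<or> discrete_at l"
  shows "\<exists>r>0. localized fin_rank (1 / (1 + l)) (1 / (1 + l)) r"
  using assms(2)
proof
  assume "l \<in> rset"
  from rset_bounded_below[OF this l] obtain r where
    r: "r > 0" "localized (\<lambda>S. S = (\<lambda>_. 0)) (1 / (1 + l)) (1 / (1 + l)) r"
    using localized_zero_of_bounded_below by blast
  then show ?thesis unfolding localized_def using fin_rank_zero by (intro exI[of _ r]) auto
next
  assume "discrete_at l"
  then obtain \<delta> B where \<delta>: "\<delta> > 0" "\<And>m. 0 < \<bar>m - l\<bar> \<Longrightarrow> \<bar>m - l\<bar> < \<delta> \<Longrightarrow> m \<in> rset"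
    and B: "finite B" "\<And>u. (u, l *\<^sub>R u) \<in> A \<Longrightarrow> u \<in> span B"
    unfolding discrete_at_def by blast
  define x where "x = 1 / (1 + l)"
  have x: "x > 0" using l by (simp add: x_def)
  have xl: "1 / x - 1 = l" using l by (simp add: x_def)
  have "((\<lambda>y. 1 / y - 1) \<longlongrightarrow> 1 / x - 1) (at x)" using x by (intro tendsto_intros) auto
  from tendstoD[OF this \<delta>(1)] have "\<forall>\<^sub>F y in at x. \<bar>(1 / y - 1) - l\<bar> < \<delta>"
    unfolding xl dist_real_def .
  then obtain d where d: "d > 0" "\<And>y. y \<noteq> x \<Longrightarrow> \<bar>y - x\<bar> < d \<Longrightarrow> \<bar>(1 / y - 1) - l\<bar> < \<delta>"
    unfolding eventually_at dist_real_def by auto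
  have "\<exists>r>0. localized fin_rank x x r"
  proof (rule localized_fin_rank_at_eigenvalue[OF x, where \<rho> = "min d x"])
    show "0 < min d x" using d x by simp
    show "finite B" by (rule B)
    fix u assume "G u = x *\<^sub>R u"
    moreover have "x * l + x = 1" using l by (simp add: x_def field_simps)
    then have "x *\<^sub>R (l *\<^sub>R u + u) = u" by (simp add: scaleR_add_right flip: scaleR_add_left)
    ultimately have "u = G (l *\<^sub>R u + u)"
      by (metis (no_types, lifting) G_simps(1) G_simps(2) scaleR_add_right scaleR_left_commute)
    then show "u \<in> span B" by (intro B(2)) (simp only: A_iff)
  next
    fix y assume y: "0 < \<bar>y - x\<bar>" "\<bar>y - x\<bar> < min d x"
    show "\<exists>r>0. localized (\<lambda>S. S = (\<lambda>_. 0)) y y r"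
    proof (cases "y > 1")
      case False
      have y0: "y > 0" "y \<le> 1" using y False by auto
      define m where "m = 1 / y - 1"
      have m: "0 \<le> m" "1 / (1 + m) = y" using y0 by (auto simp: m_def field_simps)
      have "m \<noteq> l" using y m(2) by (auto simp: x_def)
      then have "m \<in> rset" using d(2)[of y] y by (intro \<delta>(2)) (auto simp: m_def)
      from rset_bounded_below[OF this m(1)] show ?thesis
        unfolding m(2) using localized_zero_of_bounded_below by blast
    qed (rule localized_zero_outside)
  qed
  then show ?thesis by (simp add: x_def)
qed

text \<open>Suppose that the spectrum in \<open>[0,\<epsilon>]\<close> were discrete. A cutoff function \<open>f\<close> equal to \<open>1\<close> on \<open>[1/(1 + \<epsilon>), 1]\<close> and
  supported near this interval would give an operator \<open>f(G)\<close> of finite rank. A state in its kernel satisfies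
  \<open>\<langle>G v, v\<rangle> \<le> \<bar>v\<bar>\<^sup>2/(1 + \<epsilon>)\<close>, which is incompatible with an energy at most \<open>\<eta> < \<epsilon>\<close>.\<close>

lemma low_energy_spectrum:
  assumes low: "low_energy \<eta> u k" and \<eta>: "0 \<le> \<eta>" "\<eta> < \<epsilon>"
  shows "\<exists>l. 0 \<le> l \<and> l \<le> \<epsilon> \<and> l \<notin> rset \<and> \<not> discrete_at l"
proof (rule ccontr)
  assume neg: "\<not> ?thesis"
  define a where "a = 1 / (1 + \<epsilon>)"
  have \<epsilon>: "\<epsilon> > 0" using \<eta> by simp
  have a: "a > 0" "a \<le> 1" using \<epsilon> by (auto simp: a_def)
  have "\<exists>r>0. localized fin_rank a 1 r"
  proof (rule localized_interval[where V = fin_rank])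
    show "a \<le> 1" by (rule a)
    fix x assume x: "a \<le> x" "x \<le> 1"
    define l where "l = 1 / x - 1"
    have x0: "x > 0" using x a by simp
    have l: "0 \<le> l" "1 / (1 + l) = x" using x x0 by (auto simp: l_def field_simps)
    have "1 / x \<le> 1 / a" using x a by (intro divide_left_mono) auto
    then have "l \<le> \<epsilon>" using \<epsilon> by (simp add: l_def a_def)
    then have "l \<in> rset \<or> discrete_at l" using neg l(1) by blast
    from fin_rank_at_discrete[OF l(1) this] show "\<exists>r>0. localized fin_rank x x r"
      unfolding l(2) .
  qed (rule fin_rank_add)
  then obtain r where r: "r > 0" "localized fin_rank a 1 r" by blast
  define f where "f x = max 0 (min 1 ((x - (a - r)) / r))" for x
  have fc: "continuous_on {0..1} f" unfolding f_def by (intro continuous_intros) (use r in auto)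
  have f01: "0 \<le> f x" "f x \<le> 1" for x by (auto simp: f_def)
  have f1: "f x = 1" if "a \<le> x" for x using that r by (simp add: f_def field_simps)
  have "fin_rank (fcalc G f)"
    by (rule localizedD[OF r(2) fc]) (use r in \<open>auto simp: f_def divide_le_0_iff\<close>)
  then obtain B where B: "finite B" "range (fcalc G f) \<subseteq> span B" unfolding fin_rank_def by blast
  obtain v m where v: "(v, m) \<in> Gam" "v \<noteq> 0" "(norm m)\<^sup>2 \<le> \<eta> * (norm v)\<^sup>2" "fcalc G f v = 0"
    using low_energy_combination[OF low \<eta>(1) B(1) linear_fcalc[OF fc] B(2)] by blast
  define h where "h x = x * (1 - f x)" for x
  have hc: "continuous_on {0..1} h" unfolding h_def by (intro continuous_intros fc)
  have "fcalc G (\<lambda>x. x * f x) v = 0"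
    by (simp add: fcalc_mult[OF continuous_on_id fc] fcalc_id v(4) G_simps)
  moreover have "fcalc G (\<lambda>x. x * f x + h x) v = G v"
    by (simp add: h_def algebra_simps fcalc_id)
  moreover have "fcalc G (\<lambda>x. x * f x + h x) v = fcalc G (\<lambda>x. x * f x) v + fcalc G h v"
    by (intro fcalc_add continuous_intros fc hc)
  ultimately have Gv: "G v = fcalc G h v" by simp
  have "norm (G v) \<le> a * norm v"
    unfolding Gv
  proof (rule fcalc_norm[OF hc])
    fix t :: real assume t: "t \<in> {0..1}"
    show "\<bar>h t\<bar> \<le> a"
    proof (cases "a \<le> t")
      case False
      have "t * (1 - f t) \<le> a * 1" using False t f01[of t] a by (intro mult_mono) auto
      then show ?thesis using t f01[of t] by (simp add: h_def)
    qed (use f1 a in \<open>simp add: h_def\<close>)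
  qed
  then have "inner (G v) v \<le> a * norm v * norm v"
    using norm_cauchy_schwarz[of "G v" v] mult_right_mono[of "norm (G v)" "a * norm v" "norm v"] by simp
  moreover have "(norm v)\<^sup>2 / (1 + \<eta>) \<le> inner (G v) v" by (rule form_le_imp_G_ge[OF v(1,3) \<eta>(1)])
  ultimately have "(1 / (1 + \<eta>)) * (norm v)\<^sup>2 \<le> a * (norm v)\<^sup>2" by (simp add: power2_eq_square)
  moreover have "0 < (norm v)\<^sup>2" using v(2) by simp
  ultimately have "1 / (1 + \<eta>) \<le> a" by (rule mult_right_le_imp_le)
  then show False using \<eta> by (simp add: a_def frac_le_eq field_simps)
qed

end

section \<open>The Hilbert space of square-integrable functions\<close>

lemma l2_measurable: "u \<in> l2 M \<Longrightarrow> u \<in> borel_measurable M"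
  and l2_square_integrable: "u \<in> l2 M \<Longrightarrow> integrable M (\<lambda>x. (u x)\<^sup>2)"
  by (auto simp: l2_def)

lemma l2_product_integrable:
  assumes u: "u \<in> l2 M" and v: "v \<in> l2 M"
  shows "integrable M (\<lambda>x. u x * v x)"
proof (rule Bochner_Integration.integrable_bound)
  show "integrable M (\<lambda>x. (u x)\<^sup>2 + (v x)\<^sup>2)"
    using u v by (auto simp: l2_def)
  show "(\<lambda>x. u x * v x) \<in> borel_measurable M"
    using u v by (auto simp: l2_def)
  have "\<bar>a * b\<bar> \<le> a\<^sup>2 + b\<^sup>2" for a b :: real
  proof -
    have "2 * \<bar>a * b\<bar> \<le> a\<^sup>2 + b\<^sup>2"
      using zero_le_power2[of "\<bar>a\<bar> - \<bar>b\<bar>"] by (simp add: power2_diff abs_mult)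
    then show ?thesis by linarith
  qed
  then show "AE x in M. norm (u x * v x) \<le> norm ((u x)\<^sup>2 + (v x)\<^sup>2)"
    by simp
qed

lemma l2_scale: "u \<in> l2 M \<Longrightarrow> (\<lambda>x. c * u x) \<in> l2 M"
  by (auto simp: l2_def power_mult_distrib)

lemma l2_add:
  assumes u: "u \<in> l2 M" and v: "v \<in> l2 M"
  shows "(\<lambda>x. u x + v x) \<in> l2 M"
proof -
  have "integrable M (\<lambda>x. (u x)\<^sup>2 + (v x)\<^sup>2 + 2 * (u x * v x))"
    using u v l2_product_integrable[OF u v] by (auto simp: l2_def)
  then show ?thesis
    using u v by (auto simp: l2_def power2_sum mult.assoc)
qed

lemma l2_diff: "u \<in> l2 M \<Longrightarrow> v \<in> l2 M \<Longrightarrow> (\<lambda>x. u x - v x) \<in> l2 M"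
  using l2_add[OF _ l2_scale[of v M "-1"], of u] by simp

lemma l2_uminus: "u \<in> l2 M \<Longrightarrow> (\<lambda>x. - u x) \<in> l2 M"
  using l2_scale[of u M "-1"] by simp

lemma l2_zero: "(\<lambda>_. 0) \<in> l2 M"
  by (simp add: l2_def)

lemma l2_sum: "(\<And>i. i \<in> I \<Longrightarrow> u i \<in> l2 M) \<Longrightarrow> (\<lambda>x. \<Sum>i\<in>I. u i x) \<in> l2 M"
  by (induction I rule: infinite_finite_induct) (auto simp: l2_zero l2_add)

lemma l2_inner_commute: "l2_inner M u v = l2_inner M v u"
  by (simp add: l2_inner_def mult.commute)

lemma l2_inner_nonneg: "0 \<le> l2_inner M u u"
  by (simp add: l2_inner_def)

lemma l2_norm_square: "(l2_norm M u)\<^sup>2 = l2_inner M u u"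
  by (simp add: l2_norm_def l2_inner_nonneg)

lemma l2_inner_add_left: "u \<in> l2 M \<Longrightarrow> v \<in> l2 M \<Longrightarrow> z \<in> l2 M \<Longrightarrow>
    l2_inner M (\<lambda>x. u x + v x) z = l2_inner M u z + l2_inner M v z"
  by (simp add: l2_inner_def distrib_right l2_product_integrable)

lemma l2_inner_scale_left: "l2_inner M (\<lambda>x. c * u x) z = c * l2_inner M u z"
  by (simp add: l2_inner_def mult.assoc)

lemma l2_inner_self_eq_0: "u \<in> l2 M \<Longrightarrow> l2_inner M u u = 0 \<longleftrightarrow> (AE x in M. u x = 0)"
  unfolding l2_inner_def
  by (subst integral_nonneg_eq_0_iff_AE) (auto simp: l2_product_integrable)

lemma l2_inner_cong_AE:
  "u \<in> borel_measurable M \<Longrightarrow> u' \<in> borel_measurable M \<Longrightarrow> v \<in> borel_measurable M \<Longrightarrow>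
    v' \<in> borel_measurable M \<Longrightarrow> AE x in M. u x = u' x \<Longrightarrow> AE x in M. v x = v' x \<Longrightarrow>
    l2_inner M u v = l2_inner M u' v'"
  unfolding l2_inner_def by (rule integral_cong_AE) auto

lemma nn_integral_l2_square:
  "u \<in> l2 M \<Longrightarrow> (\<integral>\<^sup>+ x. ennreal ((u x)\<^sup>2) \<partial>M) = ennreal ((l2_norm M u)\<^sup>2)"
  unfolding l2_norm_square l2_inner_def
  by (subst nn_integral_eq_integral) (auto simp: l2_product_integrable power2_eq_square)

lemma l2_of_nn_integral:
  assumes u: "u \<in> borel_measurable M" and le: "(\<integral>\<^sup>+ x. ennreal ((u x)\<^sup>2) \<partial>M) \<le> ennreal c" and c: "0 \<le> c"
  shows "u \<in> l2 M" "(l2_norm M u)\<^sup>2 \<le> c"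
proof -
  have "(\<integral>\<^sup>+ x. ennreal ((u x)\<^sup>2) \<partial>M) < \<infinity>"
    using le ennreal_less_top le_less_trans by fastforce
  then have "integrable M (\<lambda>x. (u x)\<^sup>2)"
    using u by (intro integrableI_nonneg) auto
  then show l2: "u \<in> l2 M" using u by (simp add: l2_def)
  show "(l2_norm M u)\<^sup>2 \<le> c"
    using le nn_integral_l2_square[OF l2] c by simp
qed

text \<open>The weights in the subsequence make \<open>\<Sum> 2\<^sup>k \<bar>u\<^sub>k\<^sub>+\<^sub>1 - u\<^sub>k\<bar>\<^sup>2\<close> integrable, so that almost everywhere the
  increments decay geometrically.\<close>

lemma l2_complete:
  assumes u: "\<And>n. u n \<in> l2 M"
    and cauchy: "\<And>e. e > 0 \<Longrightarrow> \<exists>N. \<forall>m\<ge>N. \<forall>n\<ge>N. l2_norm M (\<lambda>x. u m x - u n x) < e"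
  shows "\<exists>v\<in>l2 M. (\<lambda>n. l2_norm M (\<lambda>x. u n x - v x)) \<longlonglongrightarrow> 0"
proof -
  have "\<forall>k. \<exists>N. \<forall>m\<ge>N. \<forall>n\<ge>N. l2_norm M (\<lambda>x. u m x - u n x) < (1/2) ^ k"
    by (intro allI cauchy) simp
  then obtain K where K: "\<And>k m n. m \<ge> K k \<Longrightarrow> n \<ge> K k \<Longrightarrow> l2_norm M (\<lambda>x. u m x - u n x) < (1/2) ^ k"
    by metis
  \<comment> \<open>Any function that grows and dominates the thresholds \<open>K\<close>.\<close>
  define r where "r k = k + (\<Sum>i\<le>k. K i)" for k
  have rK: "r j \<ge> K k" if "k \<le> j" for j k
  proof -
    have "K k \<le> (\<Sum>i\<le>j. K i)" using that by (intro member_le_sum) auto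
    then show ?thesis by (simp add: r_def)
  qed
  have rinf: "r k \<ge> k" for k by (simp add: r_def)
  define a where "a k x = u (r (Suc k)) x - u (r k) x" for k x
  have al2: "a k \<in> l2 M" for k unfolding a_def[abs_def] by (intro l2_diff u)
  have am: "a k \<in> borel_measurable M" for k by (rule l2_measurable[OF al2])
  have "l2_norm M (a k) \<le> (1/2) ^ k" for k
    unfolding a_def[abs_def] by (rule less_imp_le[OF K[OF rK rK]]) auto
  then have asq: "(l2_norm M (a k))\<^sup>2 \<le> ((1/2) ^ k)\<^sup>2" for k
    by (intro power_mono) (simp_all add: l2_norm_def l2_inner_nonneg)
  have "(\<integral>\<^sup>+ x. (\<Sum>k. ennreal (2 ^ k * (a k x)\<^sup>2)) \<partial>M) = (\<Sum>k. \<integral>\<^sup>+ x. ennreal (2 ^ k * (a k x)\<^sup>2) \<partial>M)"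
    using am by (intro nn_integral_suminf) measurable
  also have "\<dots> \<le> (\<Sum>k. ennreal ((1/2) ^ k))"
  proof (intro suminf_le allI)
    fix k
    have "(\<integral>\<^sup>+ x. ennreal (2 ^ k * (a k x)\<^sup>2) \<partial>M) = ennreal (2 ^ k) * (\<integral>\<^sup>+ x. ennreal ((a k x)\<^sup>2) \<partial>M)"
      using am by (simp add: ennreal_mult nn_integral_cmult)
    also have "\<dots> = ennreal (2 ^ k * (l2_norm M (a k))\<^sup>2)"
      by (simp add: nn_integral_l2_square[OF al2] ennreal_mult)
    also have "\<dots> \<le> ennreal (2 ^ k * ((1/2) ^ k)\<^sup>2)"
      by (intro ennreal_leI mult_left_mono asq) simp
    also have "2 ^ k * ((1/2) ^ k)\<^sup>2 = (1/2 :: real) ^ k"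
      by (simp add: power2_eq_square power_divide)
    finally show "(\<integral>\<^sup>+ x. ennreal (2 ^ k * (a k x)\<^sup>2) \<partial>M) \<le> ennreal ((1/2) ^ k)" .
  qed auto
  also have "\<dots> = ennreal (\<Sum>k. (1/2) ^ k)"
    by (intro suminf_ennreal2) (auto intro: summable_geometric)
  also have "\<dots> < \<infinity>" by simp
  finally have "AE x in M. (\<Sum>k. ennreal (2 ^ k * (a k x)\<^sup>2)) \<noteq> \<infinity>"
    using am by (intro nn_integral_PInf_AE) auto
  then have conv: "AE x in M. convergent (\<lambda>k. u (r k) x)"
  proof eventually_elim
    case (elim x)
    then have "summable (\<lambda>k. 2 ^ k * (a k x)\<^sup>2)"
      by (intro summable_suminf_not_top) auto
    then have "(\<lambda>k. 2 ^ k * (a k x)\<^sup>2) \<longlonglongrightarrow> 0" by (rule summable_LIMSEQ_zero)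
    then have "\<forall>\<^sub>F k in sequentially. 2 ^ k * (a k x)\<^sup>2 < 1" by (rule order_tendstoD) simp
    then have "\<forall>\<^sub>F k in sequentially. norm (a k x) \<le> (sqrt (1/2)) ^ k"
    proof eventually_elim
      case (elim k)
      have "(a k x)\<^sup>2 \<le> (1/2) ^ k" using elim by (simp add: power_divide field_simps)
      then have "sqrt ((a k x)\<^sup>2) \<le> sqrt ((1/2) ^ k)" by (rule real_sqrt_le_mono)
      then show ?case by (simp only: real_sqrt_abs real_norm_def real_sqrt_power[of "1/2" k])
    qed
    then have "summable (\<lambda>k. a k x)"
      by (rule summable_comparison_test_ev) (intro summable_geometric, simp add: real_sqrt_lt_1_iff)
    then have "convergent (\<lambda>n. \<Sum>k<n. a k x)" by (simp add: summable_iff_convergent)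
    moreover have "(\<Sum>k<n. a k x) = u (r n) x - u (r 0) x" for n
      unfolding a_def by (rule sum_lessThan_telescope)
    ultimately have "convergent (\<lambda>n. (u (r n) x - u (r 0) x) + u (r 0) x)"
      by (intro convergent_add convergent_const) simp
    then show ?case by simp
  qed
  define v where "v x = lim (\<lambda>k. u (r k) x)" for x
  have um: "u n \<in> borel_measurable M" for n using u by (rule l2_measurable)
  have vm: "v \<in> borel_measurable M" unfolding v_def[abs_def] using um by measurable
  have lim: "AE x in M. (\<lambda>k. u (r k) x) \<longlonglongrightarrow> v x"
    using conv by eventually_elim (simp add: v_def convergent_LIMSEQ_iff)
  have fatou: "(\<lambda>x. u m x - v x) \<in> l2 M \<and> (l2_norm M (\<lambda>x. u m x - v x))\<^sup>2 \<le> ((1/2) ^ k)\<^sup>2"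
    if m: "m \<ge> K k" for m k
  proof -
    have "(\<integral>\<^sup>+ x. ennreal ((u m x - v x)\<^sup>2) \<partial>M)
        = (\<integral>\<^sup>+ x. liminf (\<lambda>j. ennreal ((u m x - u (r j) x)\<^sup>2)) \<partial>M)"
    proof (rule nn_integral_cong_AE)
      show "AE x in M. ennreal ((u m x - v x)\<^sup>2) = liminf (\<lambda>j. ennreal ((u m x - u (r j) x)\<^sup>2))"
        using lim
      proof eventually_elim
        case (elim x)
        have "(\<lambda>j. ennreal ((u m x - u (r j) x)\<^sup>2)) \<longlonglongrightarrow> ennreal ((u m x - v x)\<^sup>2)"
          by (intro tendsto_ennrealI tendsto_intros elim)
        from lim_imp_Liminf[OF sequentially_bot this] show ?case by (rule sym)
      qed
    qed
    also have "\<dots> \<le> liminf (\<lambda>j. \<integral>\<^sup>+ x. ennreal ((u m x - u (r j) x)\<^sup>2) \<partial>M)"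
      using um by (intro nn_integral_liminf) measurable
    also have "\<dots> \<le> ennreal (((1/2) ^ k)\<^sup>2)"
    proof (rule order.trans[OF Liminf_le_Limsup[OF sequentially_bot] Limsup_bounded])
        show "\<forall>\<^sub>F j in sequentially. (\<integral>\<^sup>+ x. ennreal ((u m x - u (r j) x)\<^sup>2) \<partial>M) \<le> ennreal (((1/2) ^ k)\<^sup>2)"
          using eventually_ge_at_top[of k]
        proof eventually_elim
          case (elim j)
          have "l2_norm M (\<lambda>x. u m x - u (r j) x) \<le> (1/2) ^ k"
            using K[OF m rK[OF elim]] by simp
          then show ?case
            by (subst nn_integral_l2_square[OF l2_diff[OF u u]])
               (intro ennreal_leI power_mono, simp_all add: l2_norm_def l2_inner_nonneg)
        qed
    qed
    finally show ?thesis
      using l2_of_nn_integral[of "\<lambda>x. u m x - v x" M "((1/2) ^ k)\<^sup>2"] um vm by simp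
  qed
  have "v \<in> l2 M"
  proof -
    have "(\<lambda>x. u (K 0) x - (u (K 0) x - v x)) \<in> l2 M"
      by (rule l2_diff[OF u conjunct1[OF fatou[of 0 "K 0", OF order_refl]]])
    then show ?thesis by simp
  qed
  moreover have "(\<lambda>n. l2_norm M (\<lambda>x. u n x - v x)) \<longlonglongrightarrow> 0"
  proof (rule LIMSEQ_I)
    fix e :: real assume "0 < e"
    then obtain k where k: "(1/2) ^ k < e" using real_arch_pow_inv[of e "1/2"] by auto
    have "norm (l2_norm M (\<lambda>x. u n x - v x) - 0) < e" if "n \<ge> K k" for n
    proof -
      have "l2_norm M (\<lambda>x. u n x - v x) \<le> (1/2) ^ k"
        using fatou[OF that] by (auto intro: power2_le_imp_le)
      moreover have "0 \<le> l2_norm M (\<lambda>x. u n x - v x)" by (simp add: l2_norm_def l2_inner_nonneg)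
      ultimately show ?thesis using k by simp
    qed
    then show "\<exists>N. \<forall>n\<ge>N. norm (l2_norm M (\<lambda>x. u n x - v x) - 0) < e" by blast
  qed
  ultimately show ?thesis by blast
qed

definition l2_eq :: "'a::euclidean_space itself \<Rightarrow> ('a \<Rightarrow> real) \<Rightarrow> ('a \<Rightarrow> real) \<Rightarrow> bool" where
  "l2_eq _ u v \<longleftrightarrow> u \<in> l2 lborel \<and> v \<in> l2 lborel \<and> (AE x in lborel. u x = v x)"

lemma part_equivp_l2_eq: "part_equivp (l2_eq TYPE('a::euclidean_space))"
proof (rule part_equivpI)
  show "\<exists>x. l2_eq TYPE('a) x x" by (intro exI[of _ "\<lambda>_. 0"]) (simp add: l2_eq_def l2_zero)
  show "symp (l2_eq TYPE('a))" by (rule sympI) (auto simp: l2_eq_def elim: eventually_mono)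
  show "transp (l2_eq TYPE('a))"
  proof (rule transpI)
    fix x y z :: "'a \<Rightarrow> real" assume xy: "l2_eq TYPE('a) x y" and yz: "l2_eq TYPE('a) y z"
    then have "AE t in lborel. x t = y t" "AE t in lborel. y t = z t" by (auto simp: l2_eq_def)
    then have "AE t in lborel. x t = z t" by eventually_elim simp
    then show "l2_eq TYPE('a) x z" using xy yz by (simp add: l2_eq_def)
  qed
qed

quotient_type (overloaded) 'a ltwo = "'a::euclidean_space \<Rightarrow> real" / partial: "l2_eq TYPE('a)"
  by (rule part_equivp_l2_eq)

definition l2_class :: "('a::euclidean_space \<Rightarrow> real) \<Rightarrow> 'a ltwo" where
  "l2_class u = abs_ltwo u"

definition l2_rep :: "'a::euclidean_space ltwo \<Rightarrow> 'a \<Rightarrow> real" where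
  "l2_rep x = rep_ltwo x"

lemma l2_rep: "l2_rep x \<in> l2 lborel" "l2_class (l2_rep x) = x"
  using Quotient_rep_reflp[OF Quotient_ltwo, of x] Quotient_abs_rep[OF Quotient_ltwo, of x]
  by (auto simp: l2_rep_def l2_class_def l2_eq_def)

lemma l2_class_eq_iff:
  "u \<in> l2 lborel \<Longrightarrow> v \<in> l2 lborel \<Longrightarrow> l2_class u = l2_class v \<longleftrightarrow> (AE x in lborel. u x = v x)"
  using Quotient_rel[OF Quotient_ltwo, of u v]
  by (auto simp: l2_class_def l2_eq_def)

lemma l2_rep_class: "u \<in> l2 lborel \<Longrightarrow> AE x in lborel. l2_rep (l2_class u) x = u x"
  using l2_class_eq_iff[of "l2_rep (l2_class u)" u] l2_rep[of "l2_class u"] by simp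

lemma l2_class_cases:
  obtains u where "u \<in> l2 lborel" "x = l2_class u"
  using l2_rep[of x] by metis

instantiation ltwo :: (euclidean_space) real_inner
begin

definition zero_ltwo :: "'a ltwo" where "zero_ltwo = l2_class (\<lambda>_. 0)"
definition plus_ltwo :: "'a ltwo \<Rightarrow> 'a ltwo \<Rightarrow> 'a ltwo" where
  "plus_ltwo x y = l2_class (\<lambda>t. l2_rep x t + l2_rep y t)"
definition uminus_ltwo :: "'a ltwo \<Rightarrow> 'a ltwo" where
  "uminus_ltwo x = l2_class (\<lambda>t. - l2_rep x t)"
definition minus_ltwo :: "'a ltwo \<Rightarrow> 'a ltwo \<Rightarrow> 'a ltwo" where
  "minus_ltwo x y = l2_class (\<lambda>t. l2_rep x t - l2_rep y t)"
definition scaleR_ltwo :: "real \<Rightarrow> 'a ltwo \<Rightarrow> 'a ltwo" where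
  "scaleR_ltwo c x = l2_class (\<lambda>t. c * l2_rep x t)"
definition inner_ltwo :: "'a ltwo \<Rightarrow> 'a ltwo \<Rightarrow> real" where
  "inner_ltwo x y = l2_inner lborel (l2_rep x) (l2_rep y)"
definition norm_ltwo :: "'a ltwo \<Rightarrow> real" where
  "norm_ltwo x = sqrt (inner x x)"
definition sgn_ltwo :: "'a ltwo \<Rightarrow> 'a ltwo" where
  "sgn_ltwo x = scaleR (inverse (norm x)) x"
definition dist_ltwo :: "'a ltwo \<Rightarrow> 'a ltwo \<Rightarrow> real" where
  "dist_ltwo x y = norm (x - y)"
definition uniformity_ltwo :: "('a ltwo \<times> 'a ltwo) filter" where
  "uniformity_ltwo = (INF e\<in>{0<..}. principal {(x, y). dist x y < e})"
definition open_ltwo :: "'a ltwo set \<Rightarrow> bool" where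
  "open_ltwo U \<longleftrightarrow> (\<forall>x\<in>U. \<forall>\<^sub>F (x', y) in uniformity. x' = x \<longrightarrow> y \<in> U)"

lemma l2_class_add:
  assumes u: "u \<in> l2 lborel" and v: "v \<in> l2 lborel"
  shows "l2_class u + l2_class v = l2_class (\<lambda>t. u t + v t)"
  unfolding plus_ltwo_def
proof (subst l2_class_eq_iff)
  show "AE t in lborel. l2_rep (l2_class u) t + l2_rep (l2_class v) t = u t + v t"
    using l2_rep_class[OF u] l2_rep_class[OF v] by eventually_elim simp
qed (intro l2_add l2_rep u v)+

lemma l2_class_scaleR:
  assumes u: "u \<in> l2 lborel"
  shows "c *\<^sub>R l2_class u = l2_class (\<lambda>t. c * u t)"
  unfolding scaleR_ltwo_def
proof (subst l2_class_eq_iff)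
  show "AE t in lborel. c * l2_rep (l2_class u) t = c * u t"
    using l2_rep_class[OF u] by eventually_elim simp
qed (intro l2_scale l2_rep u)+

lemma l2_class_diff:
  assumes u: "u \<in> l2 lborel" and v: "v \<in> l2 lborel"
  shows "l2_class u - l2_class v = l2_class (\<lambda>t. u t - v t)"
  unfolding minus_ltwo_def
proof (subst l2_class_eq_iff)
  show "AE t in lborel. l2_rep (l2_class u) t - l2_rep (l2_class v) t = u t - v t"
    using l2_rep_class[OF u] l2_rep_class[OF v] by eventually_elim simp
qed (intro l2_diff l2_rep u v)+

lemma l2_class_uminus:
  assumes u: "u \<in> l2 lborel"
  shows "- l2_class u = l2_class (\<lambda>t. - u t)"
  unfolding uminus_ltwo_def
proof (subst l2_class_eq_iff)
  show "AE t in lborel. - l2_rep (l2_class u) t = - u t"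
    using l2_rep_class[OF u] by eventually_elim simp
qed (intro l2_uminus l2_rep u)+

lemma l2_class_inner:
  assumes u: "u \<in> l2 lborel" and v: "v \<in> l2 lborel"
  shows "inner (l2_class u) (l2_class v) = l2_inner lborel u v"
  unfolding inner_ltwo_def
  by (intro l2_inner_cong_AE l2_measurable l2_rep u v l2_rep_class)

instance
proof
  fix a b c :: "'a ltwo" and r s :: real
  obtain u where u: "u \<in> l2 lborel" and a: "a = l2_class u" by (rule l2_class_cases)
  obtain v where v: "v \<in> l2 lborel" and b: "b = l2_class v" by (rule l2_class_cases)
  obtain w where w: "w \<in> l2 lborel" and c: "c = l2_class w" by (rule l2_class_cases)
  note cl = l2_class_add l2_class_scaleR l2_class_diff l2_class_uminus l2_add l2_scale l2_diff l2_uminus l2_zero u v w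
  show "dist a b = norm (a - b)" by (rule dist_ltwo_def)
  show "a + b + c = a + (b + c)" by (simp add: a b c cl add.assoc)
  show "a + b = b + a" by (simp add: a b cl add.commute)
  show "0 + a = a" by (simp add: a zero_ltwo_def cl)
  show "- a + a = 0" by (simp add: a zero_ltwo_def cl)
  show "a - b = a + - b" by (simp add: a b cl)
  show "r *\<^sub>R (a + b) = r *\<^sub>R a + r *\<^sub>R b" by (simp add: a b cl distrib_left)
  show "(r + s) *\<^sub>R a = r *\<^sub>R a + s *\<^sub>R a" by (simp add: a cl distrib_right)
  show "r *\<^sub>R s *\<^sub>R a = (r * s) *\<^sub>R a" by (simp add: a cl mult.assoc)
  show "1 *\<^sub>R a = a" by (simp add: a cl)
  show "sgn a = scaleR (inverse (norm a)) a" by (rule sgn_ltwo_def)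
  show "uniformity = (INF e\<in>{0<..}. principal {(x, y :: 'a ltwo). dist x y < e})"
    by (rule uniformity_ltwo_def)
  show "open U \<longleftrightarrow> (\<forall>x\<in>U. \<forall>\<^sub>F (x', y) in uniformity. x' = x \<longrightarrow> y \<in> U)" for U :: "'a ltwo set"
    by (rule open_ltwo_def)
  show "inner a b = inner b a" by (simp add: inner_ltwo_def l2_inner_commute)
  show "inner (a + b) c = inner a c + inner b c"
    by (simp add: a b c cl l2_class_inner l2_inner_add_left)
  show "inner (r *\<^sub>R a) b = r * inner a b"
    by (simp add: a b cl l2_class_inner l2_inner_scale_left)
  show "0 \<le> inner a a" by (simp add: inner_ltwo_def l2_inner_nonneg)
  show "inner a a = 0 \<longleftrightarrow> a = 0"
    by (simp add: a zero_ltwo_def l2_class_inner u l2_inner_self_eq_0 l2_class_eq_iff l2_zero)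
  show "norm a = sqrt (inner a a)" by (rule norm_ltwo_def)
qed

end

lemma norm_l2_class: "u \<in> l2 lborel \<Longrightarrow> norm (l2_class u) = l2_norm lborel u"
  by (simp add: norm_ltwo_def l2_class_inner l2_norm_def)

instance ltwo :: (euclidean_space) complete_space
proof
  fix X :: "nat \<Rightarrow> 'a ltwo" assume C: "Cauchy X"
  define u where "u n = l2_rep (X n)" for n
  have u: "u n \<in> l2 lborel" "X n = l2_class (u n)" for n by (simp_all add: u_def l2_rep)
  have "\<exists>N. \<forall>m\<ge>N. \<forall>n\<ge>N. l2_norm lborel (\<lambda>x. u m x - u n x) < e" if "e > 0" for e
    using metric_CauchyD[OF C that] u by (simp add: dist_norm l2_class_diff norm_l2_class l2_diff)
  from l2_complete[OF u(1) this]
  obtain v where v: "v \<in> l2 lborel" "(\<lambda>n. l2_norm lborel (\<lambda>x. u n x - v x)) \<longlonglongrightarrow> 0" by auto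
  have "norm (X n - l2_class v) = l2_norm lborel (\<lambda>x. u n x - v x)" for n
    by (simp add: u l2_class_diff norm_l2_class l2_diff v(1))
  with v(2) have "(\<lambda>n. norm (X n - l2_class v)) \<longlonglongrightarrow> 0" by simp
  then have "X \<longlonglongrightarrow> l2_class v" by (simp add: tendsto_norm_zero_iff LIM_zero_iff)
  then show "convergent X" by (auto simp: convergent_def)
qed

section \<open>Test functions\<close>

lemma has_derivative_grad:
  fixes u :: "real ^ 'n \<Rightarrow> real"
  assumes "u differentiable (at x)"
  shows "(u has_derivative (\<lambda>h. grad u x \<bullet> h)) (at x)"
proof -
  define D where "D = frechet_derivative u (at x)"
  have D: "(u has_derivative D) (at x)"
    using assms by (simp add: D_def frechet_derivative_works)
  have lin: "linear D" using D by (simp add: has_derivative_linear)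
  have "D h = grad u x \<bullet> h" for h
  proof -
    have "D h = D (\<Sum>i\<in>UNIV. h $ i *\<^sub>R axis i 1)"
      using basis_expansion[of h] by (simp add: scalar_mult_eq_scaleR)
    also have "\<dots> = (\<Sum>i\<in>UNIV. h $ i *\<^sub>R D (axis i 1))"
      by (simp add: linear_sum[OF lin] linear_scale[OF lin])
    finally show ?thesis by (simp add: inner_vec_def grad_def D_def mult.commute)
  qed
  then have "D = (\<lambda>h. grad u x \<bullet> h)" by auto
  with D show ?thesis by simp
qed

lemma grad_eqI:
  fixes u :: "real ^ 'n \<Rightarrow> real"
  assumes "(u has_derivative D) (at x)"
  shows "grad u x $ i = D (axis i 1)"
  using frechet_derivative_at[OF assms] by (simp add: grad_def)

lemma grad_line:
  fixes u :: "real ^ 'n \<Rightarrow> real"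
  assumes "u differentiable (at (x + t *\<^sub>R axis i 1))"
  shows "((\<lambda>s. u (x + s *\<^sub>R axis i 1)) has_real_derivative grad u (x + t *\<^sub>R axis i 1) $ i) (at t)"
proof -
  have 1: "((\<lambda>s. x + s *\<^sub>R axis i 1) has_derivative (\<lambda>s. s *\<^sub>R axis i 1)) (at t)"
    by (auto intro!: derivative_eq_intros)
  have "((\<lambda>s. u (x + s *\<^sub>R axis i 1)) has_derivative
      (\<lambda>s. grad u (x + t *\<^sub>R axis i 1) \<bullet> (s *\<^sub>R axis i 1))) (at t)"
    by (rule has_derivative_compose[OF 1 has_derivative_grad[OF assms]])
  moreover have "(\<lambda>s. grad u (x + t *\<^sub>R axis i 1) \<bullet> (s *\<^sub>R axis i 1)) = (*) (grad u (x + t *\<^sub>R axis i 1) $ i)"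
    by (simp add: fun_eq_iff inner_axis mult.commute)
  ultimately show ?thesis by (simp only: has_field_derivative_def)
qed

lemma grad_add:
  assumes "u differentiable (at x)" "v differentiable (at x)"
  shows "grad (\<lambda>x. u x + v x) x = grad u x + grad v x"
  using grad_eqI[OF has_derivative_add[OF has_derivative_grad has_derivative_grad, OF assms]]
  by (simp add: vec_eq_iff inner_axis)

lemma grad_scale:
  assumes "u differentiable (at x)"
  shows "grad (\<lambda>x. c * u x) x = c *\<^sub>R grad u x"
  using grad_eqI[OF has_derivative_mult_right[OF has_derivative_grad, OF assms, of c]]
  by (simp add: vec_eq_iff inner_axis)

lemma grad_mult:
  assumes "u differentiable (at x)" "v differentiable (at x)"
  shows "grad (\<lambda>x. u x * v x) x = u x *\<^sub>R grad v x + v x *\<^sub>R grad u x"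
  using grad_eqI[OF has_derivative_mult[OF has_derivative_grad has_derivative_grad, OF assms]]
  by (simp add: vec_eq_iff inner_axis mult.commute)

lemma ck_SucD: "ck (Suc k) u \<Longrightarrow> ck k u"
proof (induction k arbitrary: u)
  case 0
  then show ?case
    by (simp add: continuous_at_imp_continuous_on differentiable_imp_continuous_within)
next
  case (Suc k)
  then have "\<forall>x. u differentiable (at x)" and g: "\<forall>i. ck (Suc k) (\<lambda>x. grad u x $ i)"
    using ck.simps(2)[of "Suc k" u] by blast+
  moreover have "\<forall>i. ck k (\<lambda>x. grad u x $ i)" using g Suc.IH by blast
  ultimately show ?case unfolding ck.simps(2)[of k u] by blast
qed

lemma ck_add: "ck k u \<Longrightarrow> ck k v \<Longrightarrow> ck k (\<lambda>x. u x + v x)"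
proof (induction k arbitrary: u v)
  case 0
  then show ?case by (simp add: continuous_on_add)
next
  case (Suc k)
  have d: "\<And>x. u differentiable at x" "\<And>x. v differentiable at x"
    and g: "\<And>i. ck k (\<lambda>x. grad u x $ i)" "\<And>i. ck k (\<lambda>x. grad v x $ i)"
    using Suc.prems by auto
  have "ck k (\<lambda>x. grad u x $ i + grad v x $ i)" for i by (rule Suc.IH[OF g])
  then show ?case using d by (simp add: grad_add)
qed

lemma ck_const: "ck k (\<lambda>_ :: real ^ 'n. c)"
proof (induction k arbitrary: c)
  case (Suc k)
  have "grad (\<lambda>_. c) x $ i = 0" for x :: "real ^ 'n" and i
    by (rule grad_eqI[OF has_derivative_const])
  then show ?case using Suc by simp
qed simp

lemma ck_mult: "ck k u \<Longrightarrow> ck k v \<Longrightarrow> ck k (\<lambda>x. u x * v x)"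
proof (induction k arbitrary: u v)
  case 0
  then show ?case by (auto intro: continuous_on_mult)
next
  case (Suc k)
  have d: "\<And>x. u differentiable at x" "\<And>x. v differentiable at x"
    and g: "\<And>i. ck k (\<lambda>x. grad u x $ i)" "\<And>i. ck k (\<lambda>x. grad v x $ i)"
    using Suc.prems by auto
  have "ck k (\<lambda>x. u x * grad v x $ i + v x * grad u x $ i)" for i
    by (intro ck_add Suc.IH g ck_SucD[OF Suc.prems(1)] ck_SucD[OF Suc.prems(2)])
  then show ?case using d by (simp add: grad_mult)
qed

lemma ck_prod: "finite I \<Longrightarrow> (\<And>i. i \<in> I \<Longrightarrow> ck k (u i)) \<Longrightarrow> ck k (\<lambda>x. \<Prod>i\<in>I. u i x)"
  by (induction I rule: finite_induct) (auto intro: ck_mult ck_const)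

lemma test_function_differentiable: "u \<in> test_functions \<Longrightarrow> u differentiable (at x)"
  and test_function_grad_continuous: "u \<in> test_functions \<Longrightarrow> continuous_on UNIV (\<lambda>x. grad u x $ i)"
  and test_function_continuous: "u \<in> test_functions \<Longrightarrow> continuous_on UNIV u"
proof -
  assume "u \<in> test_functions"
  then have "ck (Suc 0) u" "ck 0 u" unfolding test_functions_def by auto
  then show "u differentiable (at x)" "continuous_on UNIV (\<lambda>x. grad u x $ i)" "continuous_on UNIV u"
    by auto
qed

lemma test_function_bounded_support:
  assumes "u \<in> test_functions"
  obtains R where "R > 0" "\<And>x. R < norm x \<Longrightarrow> u x = 0" "\<And>x. R < norm x \<Longrightarrow> grad u x = 0"
proof -
  have "bounded (closure {x. u x \<noteq> 0})"
    using assms by (auto simp: test_functions_def compact_imp_bounded)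
  then obtain R where R: "R > 0" "\<And>x. x \<in> closure {x. u x \<noteq> 0} \<Longrightarrow> norm x \<le> R"
    unfolding bounded_pos by blast
  have z: "u x = 0" if "R < norm x" for x
    using R(2)[of x] that closure_subset[of "{x. u x \<noteq> 0}"] by fastforce
  have "grad u x = 0" if x: "R < norm x" for x
  proof -
    have "open {y :: real ^ 'b. R < norm y}" by (intro open_Collect_less continuous_intros)
    then have "\<forall>\<^sub>F y in nhds x. R < norm y" using x by (simp add: eventually_nhds) blast
    then have "\<forall>\<^sub>F y in nhds x. 0 = u y" by eventually_elim (simp add: z)
    then have "(u has_derivative (\<lambda>_. 0)) (at x)"
      using has_derivative_transform_eventually[OF has_derivative_const, of 0 u x UNIV] z[OF x]
      by (simp add: eventually_at_filter eventually_mono)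
    from grad_eqI[OF this] show ?thesis by (simp add: vec_eq_iff)
  qed
  with z R(1) show ?thesis by (intro that)
qed

lemma test_functions_subset_support:
  assumes "\<And>k. ck k u" "bounded S" "\<And>x. u x \<noteq> 0 \<Longrightarrow> x \<in> S"
  shows "u \<in> test_functions"
proof -
  have "bounded {x. u x \<noteq> 0}" by (rule bounded_subset[OF assms(2)]) (use assms(3) in auto)
  then show ?thesis using assms(1) by (simp add: test_functions_def compact_closure)
qed

lemma test_functions_bounded: "u \<in> test_functions \<Longrightarrow> bounded {x. u x \<noteq> 0}"
proof -
  assume "u \<in> test_functions"
  then have "compact (closure {x. u x \<noteq> 0})" by (simp add: test_functions_def)
  from bounded_subset[OF compact_imp_bounded[OF this] closure_subset] show ?thesis .
qed

lemma test_functions_ck: "u \<in> test_functions \<Longrightarrow> ck k u"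
  by (simp add: test_functions_def)

lemma test_functions_add:
  assumes "u \<in> test_functions" "v \<in> test_functions"
  shows "(\<lambda>x. u x + v x) \<in> test_functions"
  by (rule test_functions_subset_support[where S = "{x. u x \<noteq> 0} \<union> {x. v x \<noteq> 0}"])
     (use assms in \<open>auto intro!: ck_add intro: test_functions_ck test_functions_bounded\<close>)

lemma test_functions_mult:
  assumes "u \<in> test_functions" "v \<in> test_functions"
  shows "(\<lambda>x. u x * v x) \<in> test_functions"
  by (rule test_functions_subset_support[where S = "{x. u x \<noteq> 0}"])
     (use assms in \<open>auto intro!: ck_mult intro: test_functions_ck test_functions_bounded\<close>)

lemma test_functions_scale:
  assumes "u \<in> test_functions"
  shows "(\<lambda>x. c * u x) \<in> test_functions"
  by (rule test_functions_subset_support[where S = "{x. u x \<noteq> 0}"])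
     (use assms in \<open>auto intro!: ck_mult ck_const intro: test_functions_ck test_functions_bounded\<close>)

lemma test_functions_diff:
  "u \<in> test_functions \<Longrightarrow> v \<in> test_functions \<Longrightarrow> (\<lambda>x. u x - v x) \<in> test_functions"
  using test_functions_add[OF _ test_functions_scale[of v "-1"], of u] by simp

lemma test_functions_zero: "(\<lambda>_. 0) \<in> test_functions"
  by (rule test_functions_subset_support[where S = "{}"]) (auto intro: ck_const)

lemma grad_diff:
  assumes "u differentiable (at x)" "v differentiable (at x)"
  shows "grad (\<lambda>x. u x - v x) x = grad u x - grad v x"
  using grad_eqI[OF has_derivative_diff[OF has_derivative_grad has_derivative_grad, OF assms]]
  by (simp add: vec_eq_iff inner_axis)

lemma integrable_compact_support:
  fixes f :: "real ^ 'n \<Rightarrow> real"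
  assumes f: "continuous_on UNIV f" and z: "\<And>x. R < norm x \<Longrightarrow> f x = 0"
  shows "integrable lborel f"
proof -
  have "set_integrable lborel (cball 0 R) f"
    unfolding set_integrable_def
    by (rule borel_integrable_compact) (auto intro: continuous_on_subset[OF f])
  moreover have "(\<lambda>x. indicator (cball 0 R) x *\<^sub>R f x) = f"
    using z by (auto simp: fun_eq_iff indicator_def not_le)
  ultimately show ?thesis by (simp add: set_integrable_def)
qed

lemma l2_compact_support:
  fixes f :: "real ^ 'n \<Rightarrow> real"
  assumes f: "continuous_on UNIV f" and z: "\<And>x. R < norm x \<Longrightarrow> f x = 0"
  shows "f \<in> l2 lborel"
proof -
  have "integrable lborel (\<lambda>x. (f x)\<^sup>2)"
    by (rule integrable_compact_support[where R = R]) (use z in \<open>auto intro!: continuous_intros f\<close>)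
  then show ?thesis using f by (simp add: l2_def borel_measurable_continuous_onI)
qed

text \<open>A derivative integrates to zero, since it is a limit of difference quotients, whose integrals vanish
  by translation invariance.\<close>

lemma integral_grad_eq_0:
  fixes u :: "real ^ 'n \<Rightarrow> real"
  assumes u: "u \<in> test_functions"
  shows "(LINT x|lborel. grad u x $ i) = 0"
proof -
  obtain R where R: "R > 0" "\<And>x. R < norm x \<Longrightarrow> u x = 0" "\<And>x. R < norm x \<Longrightarrow> grad u x = 0"
    using test_function_bounded_support[OF u] by metis
  let ?e = "axis i (1::real) :: real ^ 'n"
  have ne: "norm ?e = 1" by (simp add: norm_axis_1)
  note uc = test_function_continuous[OF u] and gc = test_function_grad_continuous[OF u, of i]
  have "compact ((\<lambda>x. grad u x $ i) ` cball 0 R)"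
    by (rule compact_continuous_image[OF continuous_on_subset[OF gc]]) auto
  from compact_imp_bounded[OF this] obtain M0 where M0: "\<And>x. x \<in> cball 0 R \<Longrightarrow> \<bar>grad u x $ i\<bar> \<le> M0"
    unfolding bounded_iff by (metis image_eqI real_norm_def)
  define M where "M = max 0 M0"
  have M: "\<bar>grad u x $ i\<bar> \<le> M" for x
    using M0[of x] R(3)[of x] by (cases "norm x \<le> R") (auto simp: M_def not_le)
  have M0: "0 \<le> M" by (simp add: M_def)
  define h where "h n = 1 / (real n + 1)" for n
  have h: "0 < h n" "h n \<le> 1" for n by (auto simp: h_def)
  have h0: "h \<longlonglongrightarrow> 0" unfolding h_def[abs_def] by (rule inverse_Suc_tendsto_0)
  have hf: "filterlim h (at 0) sequentially"
    using h0 h(1) by (auto simp: filterlim_at intro!: always_eventually) (metis less_irrefl)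
  define D where "D n x = (u (x + h n *\<^sub>R ?e) - u x) / h n" for n x
  have ui: "integrable lborel u" by (rule integrable_compact_support[OF uc R(2)])
  have ui': "integrable lborel (\<lambda>x. u (x + c))" for c
  proof (rule integrable_compact_support[where R = "R + norm c"])
    show "continuous_on UNIV (\<lambda>x. u (x + c))"
      by (rule continuous_on_compose2[OF uc]) (auto intro!: continuous_intros)
    fix x :: "real ^ 'n" assume "R + norm c < norm x"
    moreover have "norm x \<le> norm (x + c) + norm c" using norm_triangle_ineq4[of "x + c" c] by simp
    ultimately show "u (x + c) = 0" by (intro R(2)) simp
  qed
  have tr: "(LINT x|lborel. u (x + c)) = (LINT x|lborel. u x)" for c
  proof -
    have um: "u \<in> borel_measurable borel" by (rule borel_measurable_continuous_onI[OF uc])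
    have "(LINT x|lborel. u x) = (LINT x|distr lborel borel ((+) c). u x)" by (simp add: lborel_distr_plus)
    also have "\<dots> = (LINT x|lborel. u (c + x))" by (rule integral_distr) (use um in auto)
    finally show ?thesis by (simp add: add.commute)
  qed
  have D0: "(LINT x|lborel. D n x) = 0" for n
    unfolding D_def using ui ui' tr by simp
  have bound: "\<bar>D n x\<bar> \<le> M * indicator (cball 0 (R + 1)) x" for n x
  proof (cases "norm x \<le> R + 1")
    case True
    have "\<exists>z. 0 < z \<and> z < h n \<and>
        u (x + h n *\<^sub>R ?e) - u (x + 0 *\<^sub>R ?e) = (h n - 0) * (grad u (x + z *\<^sub>R ?e) $ i)"
      using h(1)[of n] by (intro MVT2) (auto intro!: grad_line test_function_differentiable[OF u])
    then obtain z where "u (x + h n *\<^sub>R ?e) - u x = h n * (grad u (x + z *\<^sub>R ?e) $ i)" by auto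
    then have "D n x = grad u (x + z *\<^sub>R ?e) $ i" using h(1)[of n] by (simp add: D_def)
    then show ?thesis using M True by simp
  next
    case False
    have "norm x \<le> norm (x + h n *\<^sub>R ?e) + norm (h n *\<^sub>R ?e)"
      using norm_triangle_ineq4[of "x + h n *\<^sub>R ?e" "h n *\<^sub>R ?e"] by simp
    then have "R < norm (x + h n *\<^sub>R ?e)" using False h[of n] ne by simp
    then show ?thesis using R(2) False M0 by (simp add: D_def)
  qed
  have "(\<lambda>n. LINT x|lborel. D n x) \<longlonglongrightarrow> (LINT x|lborel. grad u x $ i)"
  proof (rule integral_dominated_convergence[where w = "\<lambda>x. M * indicator (cball 0 (R + 1)) x"])
    show "(\<lambda>x. grad u x $ i) \<in> borel_measurable lborel"
      using borel_measurable_continuous_onI[OF gc] by simp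
    show "D n \<in> borel_measurable lborel" for n
      unfolding D_def[abs_def] using ui ui' by (intro borel_measurable_divide borel_measurable_diff) auto
    show "integrable lborel (\<lambda>x. M * indicator (cball (0 :: real ^ 'n) (R + 1)) x)"
      using emeasure_lborel_cball_finite[of "0 :: real ^ 'n" "R + 1"] by simp
    show "AE x in lborel. (\<lambda>n. D n x) \<longlonglongrightarrow> grad u x $ i"
    proof (rule AE_I2)
      fix x
      have "((\<lambda>s. u (x + s *\<^sub>R ?e)) has_real_derivative grad u (x + 0 *\<^sub>R ?e) $ i) (at 0)"
        by (rule grad_line[OF test_function_differentiable[OF u]])
      then have "((\<lambda>s. (u (x + s *\<^sub>R ?e) - u x) / s) \<longlongrightarrow> grad u x $ i) (at 0)"
        by (simp add: DERIV_def)
      from filterlim_compose[OF this hf] show "(\<lambda>n. D n x) \<longlonglongrightarrow> grad u x $ i"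
        by (simp add: D_def)
    qed
    show "AE x in lborel. norm (D n x) \<le> M * indicator (cball 0 (R + 1)) x" for n
      using bound by simp
  qed
  then have "(\<lambda>n. 0) \<longlonglongrightarrow> (LINT x|lborel. grad u x $ i)" by (simp add: D0)
  then show ?thesis by (simp add: LIMSEQ_const_iff)
qed

lemma test_function_product_integrable:
  fixes u v :: "real ^ 'n \<Rightarrow> real"
  assumes u: "u \<in> test_functions" and v: "continuous_on UNIV v"
  shows "integrable lborel (\<lambda>x. u x * v x)" "integrable lborel (\<lambda>x. grad u x $ i * v x)"
proof -
  obtain R where R: "R > 0" "\<And>x. R < norm x \<Longrightarrow> u x = 0" "\<And>x. R < norm x \<Longrightarrow> grad u x = 0"
    using test_function_bounded_support[OF u] by metis
  show "integrable lborel (\<lambda>x. u x * v x)"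
    by (rule integrable_compact_support[where R = R])
       (use R in \<open>auto intro!: continuous_intros v test_function_continuous[OF u]\<close>)
  show "integrable lborel (\<lambda>x. grad u x $ i * v x)"
    by (rule integrable_compact_support[where R = R])
       (use R in \<open>auto intro!: continuous_on_mult v test_function_grad_continuous[OF u]\<close>)
qed

lemma integration_by_parts:
  fixes u v :: "real ^ 'n \<Rightarrow> real"
  assumes u: "u \<in> test_functions" and v: "v \<in> test_functions"
  shows "(LINT x|lborel. grad u x $ i * v x) = - (LINT x|lborel. u x * grad v x $ i)"
proof -
  have "(LINT x|lborel. grad (\<lambda>x. u x * v x) x $ i) = 0"
    by (rule integral_grad_eq_0[OF test_functions_mult[OF u v]])
  then have "(LINT x|lborel. u x * grad v x $ i + grad u x $ i * v x) = 0"
    by (simp add: grad_mult test_function_differentiable[OF u] test_function_differentiable[OF v] mult.commute)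
  then show ?thesis
    using test_function_product_integrable(1)[OF u test_function_grad_continuous[OF v]]
      test_function_product_integrable(2)[OF u test_function_continuous[OF v]]
    by (subst (asm) Bochner_Integration.integral_add) auto
qed

subsection \<open>Smooth bumps\<close>

text \<open>Functions \<open>P(1/x) exp (- c/x)\<close>, extended by zero to \<open>x \<le> 0\<close>. This class is closed under differentiation, so
  smoothness follows by induction from one computation of a derivative.\<close>

definition flat_exp :: "real poly \<Rightarrow> real \<Rightarrow> real \<Rightarrow> real" where
  "flat_exp P c x = (if x > 0 then poly P (1 / x) * exp (- c / x) else 0)"

definition flat_exp_deriv :: "real poly \<Rightarrow> real \<Rightarrow> real poly" where
  "flat_exp_deriv P c = [:0,0,1:] * (smult c P - pderiv P)"

lemma poly_times_exp_tendsto_0: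
  fixes c :: real
  assumes "0 < c"
  shows "((\<lambda>y. poly P y * exp (- c * y)) \<longlongrightarrow> 0) at_top"
  using assms
proof (induction P arbitrary: c)
  case (pCons a P)
  have c: "0 < c / 2" using pCons.prems by simp
  have "((\<lambda>y. a * exp (- c * y) + (y * exp (- (c/2) * y)) * (poly P y * exp (- (c/2) * y))) \<longlongrightarrow> a * 0 + 0 * 0) at_top"
  proof (intro tendsto_intros)
    show "((\<lambda>y. exp (- c * y)) \<longlongrightarrow> 0) at_top" using pCons.prems by real_asymp
    show "((\<lambda>y. y * exp (- (c/2) * y)) \<longlongrightarrow> 0) at_top" using pCons.prems by real_asymp
    show "((\<lambda>y. poly P y * exp (- (c/2) * y)) \<longlongrightarrow> 0) at_top" by (rule pCons.IH[OF c])
  qed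
  moreover have "a * exp (- c * y) + (y * exp (- (c/2) * y)) * (poly P y * exp (- (c/2) * y))
      = poly (pCons a P) y * exp (- c * y)" for y
  proof -
    have "exp (- (c/2) * y) * exp (- (c/2) * y) = exp (- c * y)" by (simp add: exp_add[symmetric])
    then show ?thesis by (simp add: algebra_simps)
  qed
  ultimately show ?case by simp
qed simp

lemma flat_exp_has_derivative:
  assumes c: "0 < c"
  shows "(flat_exp P c has_real_derivative flat_exp (flat_exp_deriv P c) c x) (at x)"
proof -
  consider "x > 0" | "x < 0" | "x = 0" by linarith
  then show ?thesis
  proof cases
    case 1
    have "((\<lambda>x. poly P (1 / x) * exp (- c / x)) has_real_derivative
        poly (pderiv P) (1 / x) * (- 1 / x\<^sup>2) * exp (- c / x) + poly P (1 / x) * (exp (- c / x) * (c / x\<^sup>2))) (at x)"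
      using 1 by (auto intro!: derivative_eq_intros simp: power2_eq_square)
    moreover have "poly (pderiv P) (1 / x) * (- 1 / x\<^sup>2) * exp (- c / x) + poly P (1 / x) * (exp (- c / x) * (c / x\<^sup>2))
        = flat_exp (flat_exp_deriv P c) c x"
      using 1 by (simp add: flat_exp_def flat_exp_deriv_def power2_eq_square field_simps)
    ultimately have d: "((\<lambda>x. poly P (1 / x) * exp (- c / x)) has_real_derivative flat_exp (flat_exp_deriv P c) c x) (at x)"
      by simp
    have "\<forall>\<^sub>F y in nhds x. y > 0" using 1 eventually_nhds_in_open[of "{0<..}" x] by simp
    then have "\<forall>\<^sub>F y in nhds x. poly P (1 / y) * exp (- c / y) = flat_exp P c y"
      by eventually_elim (simp add: flat_exp_def)
    from iffD1[OF DERIV_cong_ev[OF refl this refl] d] show ?thesis .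
  next
    case 2
    have "\<forall>\<^sub>F y in nhds x. y < 0" using 2 eventually_nhds_in_open[of "{..<0}" x] by simp
    then have "\<forall>\<^sub>F y in nhds x. 0 = flat_exp P c y"
      by eventually_elim (simp add: flat_exp_def)
    then have "((\<lambda>_. 0) has_real_derivative 0) (at x) \<longleftrightarrow> (flat_exp P c has_real_derivative 0) (at x)"
      by (intro DERIV_cong_ev refl)
    then show ?thesis using 2 by (simp add: flat_exp_def)
  next
    case 3
    have "((\<lambda>h. flat_exp P c h / h) \<longlongrightarrow> 0) (at_right 0)"
    proof (rule Lim_transform_eventually)
      have "((\<lambda>h. poly (pCons 0 P) (inverse h) * exp (- c * inverse h)) \<longlongrightarrow> 0) (at_right 0)"
        by (rule filterlim_compose[OF poly_times_exp_tendsto_0[OF c] filterlim_inverse_at_top_right])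
      then show "((\<lambda>h. poly (pCons 0 P) (inverse h) * exp (- c * inverse h)) \<longlongrightarrow> 0) (at_right 0)" .
      show "\<forall>\<^sub>F h in at_right 0. poly (pCons 0 P) (inverse h) * exp (- c * inverse h) = flat_exp P c h / h"
        using eventually_at_right_less[of 0]
        by eventually_elim (simp add: flat_exp_def inverse_eq_divide)
    qed
    moreover have "((\<lambda>h. flat_exp P c h / h) \<longlongrightarrow> 0) (at_left 0)"
    proof (rule Lim_transform_eventually)
      show "((\<lambda>h. 0) \<longlongrightarrow> 0) (at_left (0::real))" by simp
      have "\<forall>\<^sub>F h in at_left 0. h < (0::real)" by (simp add: eventually_at_left_field) (meson less_minus_one_simps(1))
      then show "\<forall>\<^sub>F h in at_left 0. 0 = flat_exp P c h / h" by eventually_elim (simp add: flat_exp_def)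
    qed
    ultimately have "((\<lambda>h. flat_exp P c h / h) \<longlongrightarrow> 0) (at 0)" by (simp add: filterlim_split_at)
    then show ?thesis by (simp add: 3 DERIV_def flat_exp_def)
  qed
qed

lemma ck_flat_exp:
  fixes i :: "'n::finite"
  assumes c: "0 < c"
  shows "ck k (\<lambda>x. flat_exp P c (s * x $ i + t))"
proof (induction k arbitrary: P)
  have der: "((\<lambda>x. flat_exp P c (s * x $ i + t)) has_derivative
      (\<lambda>h. flat_exp (flat_exp_deriv P c) c (s * x $ i + t) * (s * h $ i))) (at x)" for P and x :: "real ^ 'n"
  proof -
    have "((\<lambda>x. s * x $ i + t) has_derivative (\<lambda>h. s * h $ i)) (at x)"
      by (auto intro!: derivative_eq_intros bounded_linear.has_derivative[OF bounded_linear_vec_nth])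
    from has_derivative_compose[OF this flat_exp_has_derivative[OF c, unfolded has_field_derivative_def]]
    show ?thesis by simp
  qed
  {
    case 0
    show ?case using der
      by (auto intro!: continuous_at_imp_continuous_on has_derivative_continuous)
  next
    case (Suc k)
    have "grad (\<lambda>x. flat_exp P c (s * x $ i + t)) x $ j
        = (if i = j then s else 0) * flat_exp (flat_exp_deriv P c) c (s * x $ i + t)" for x j
      using grad_eqI[OF der[of P x], of j] by (simp add: axis_def)
    moreover have "ck k (\<lambda>x. (if i = j then s else 0) * flat_exp (flat_exp_deriv P c) c (s * x $ i + t))" for j
      by (intro ck_mult ck_const Suc.IH)
    moreover have "(\<lambda>x. flat_exp P c (s * x $ i + t)) differentiable (at x)" for x
      using der[of P x] unfolding differentiable_def by blast
    ultimately show ?case by simp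
  }
qed

text \<open>The parameter \<open>c\<close> sets the length scale of the transition: as \<open>c \<rightarrow> 0\<close> the bumps increase to indicator functions,
  and with \<open>c\<close> the side of a cell they have a gradient of the order of its inverse.\<close>

definition bump1 :: "real \<Rightarrow> real \<Rightarrow> real \<Rightarrow> real \<Rightarrow> real" where
  "bump1 c a b t = flat_exp 1 c (t - a) * flat_exp 1 c (b - t)"

definition bump :: "real \<Rightarrow> real ^ 'n \<Rightarrow> real ^ 'n \<Rightarrow> real ^ 'n \<Rightarrow> real" where
  "bump c a b x = (\<Prod>i\<in>UNIV. bump1 c (a $ i) (b $ i) (x $ i))"

lemma flat_exp_range: "0 < c \<Longrightarrow> 0 \<le> flat_exp 1 c x" "0 < c \<Longrightarrow> flat_exp 1 c x \<le> 1"
  by (auto simp: flat_exp_def)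

lemma bump1_range: "0 < c \<Longrightarrow> 0 \<le> bump1 c a b t" "0 < c \<Longrightarrow> bump1 c a b t \<le> 1"
  unfolding bump1_def using flat_exp_range by (auto intro: mult_le_one)

lemma bump_range: "0 < c \<Longrightarrow> 0 \<le> bump c a b x" "0 < c \<Longrightarrow> bump c a b x \<le> 1"
  unfolding bump_def using bump1_range by (auto intro: prod_nonneg prod_le_1)

lemma bump_eq_0: "x \<notin> box a b \<Longrightarrow> bump c a b x = 0"
proof -
  assume "x \<notin> box a b"
  then obtain i where "\<not> (a $ i < x $ i \<and> x $ i < b $ i)" unfolding mem_box_cart by blast
  then have "bump1 c (a $ i) (b $ i) (x $ i) = 0" by (auto simp: bump1_def flat_exp_def)
  then show ?thesis unfolding bump_def by (intro prod_zero) auto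
qed

lemma bump_test_function:
  assumes c: "0 < c"
  shows "bump c a b \<in> test_functions"
proof (rule test_functions_subset_support[where S = "box a b"])
  fix k
  have "ck k (\<lambda>x. flat_exp 1 c (1 * x $ i + (- a $ i)) * flat_exp 1 c ((-1) * x $ i + b $ i))" for i
    by (intro ck_mult ck_flat_exp c)
  then have "ck k (\<lambda>x. \<Prod>i\<in>UNIV. flat_exp 1 c (1 * x $ i + (- a $ i)) * flat_exp 1 c ((-1) * x $ i + b $ i))"
    by (intro ck_prod) auto
  then show "ck k (bump c a b)" by (simp add: bump_def[abs_def] bump1_def)
qed (use bump_eq_0 in \<open>auto simp: bounded_box\<close>)

lemma bump_tendsto_indicator:
  "(\<lambda>n. bump (1 / (real n + 1)) a b x) \<longlonglongrightarrow> indicator (box a b) x"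
proof (cases "x \<in> box a b")
  case True
  have fl: "(\<lambda>n. flat_exp 1 (1 / (real n + 1)) t) \<longlonglongrightarrow> 1" if "t > 0" for t
  proof -
    have "(\<lambda>n. exp (- (1 / (real n + 1)) / t)) \<longlonglongrightarrow> exp (- 0 / t)"
      using that by (intro tendsto_intros inverse_Suc_tendsto_0) auto
    then show ?thesis using that by (simp add: flat_exp_def)
  qed
  have "(\<lambda>n. bump (1 / (real n + 1)) a b x) \<longlonglongrightarrow> (\<Prod>i\<in>(UNIV::'a set). 1 * 1)"
    unfolding bump_def bump1_def
    by (intro tendsto_prod tendsto_mult fl) (use True in \<open>auto simp: mem_box_cart\<close>)
  then show ?thesis using True by simp
qed (simp add: bump_eq_0)

section \<open>The fundamental lemma of the calculus of variations\<close>

lemma eventually_mem_centered_box: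
  fixes x :: "'a::euclidean_space"
  shows "\<forall>\<^sub>F n in sequentially. x \<in> box (- (real n *\<^sub>R One)) (real n *\<^sub>R One)"
proof -
  have "x \<in> (\<Union>n::nat. box (- (real n *\<^sub>R One)) (real n *\<^sub>R One))"
    by (subst UN_box_eq_UNIV) simp
  then obtain N :: nat where N: "x \<in> box (- (real N *\<^sub>R One)) (real N *\<^sub>R One)" by blast
  have "x \<in> box (- (real n *\<^sub>R One)) (real n *\<^sub>R One)" if n: "n \<ge> N" for n
    unfolding mem_box
  proof
    fix i :: 'a assume i: "i \<in> Basis"
    have "- real N < x \<bullet> i" "x \<bullet> i < real N" using N i by (auto simp: mem_box)
    then show "- (real n *\<^sub>R One) \<bullet> i < x \<bullet> i \<and> x \<bullet> i < (real n *\<^sub>R One) \<bullet> i"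
      using n i by simp
  qed
  then show ?thesis unfolding eventually_sequentially by blast
qed

text \<open>The boxes form a generator of the Borel sets that is stable under intersection.\<close>

lemma AE_zero_of_box_integrals:
  fixes f :: "'a::euclidean_space \<Rightarrow> real"
  assumes f: "integrable lborel f" and box: "\<And>a b. (LINT x:box a b|lborel. f x) = 0"
  shows "AE x in lborel. f x = 0"
proof -
  have si: "set_integrable lborel A f" if "A \<in> sets borel" for A
    unfolding set_integrable_def by (rule integrable_mult_indicator[OF _ f]) (simp add: that)
  have total: "(LINT x|lborel. f x) = 0"
  proof -
    have "(\<lambda>n. LINT x|lborel. indicator (box (- (real n *\<^sub>R One)) (real n *\<^sub>R One)) x *\<^sub>R f x) \<longlonglongrightarrow> (LINT x|lborel. f x)"
    proof (rule integral_dominated_convergence[where w = "\<lambda>x. \<bar>f x\<bar>"])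
      show "AE x in lborel. (\<lambda>n. indicator (box (- (real n *\<^sub>R One)) (real n *\<^sub>R One)) x *\<^sub>R f x) \<longlonglongrightarrow> f x"
      proof (rule AE_I2)
        fix x :: 'a
        have "\<forall>\<^sub>F n in sequentially. f x = indicator (box (- (real n *\<^sub>R One)) (real n *\<^sub>R One)) x *\<^sub>R f x"
          using eventually_mem_centered_box[of x] by eventually_elim simp
        then show "(\<lambda>n. indicator (box (- (real n *\<^sub>R One)) (real n *\<^sub>R One)) x *\<^sub>R f x) \<longlonglongrightarrow> f x"
          by (rule Lim_transform_eventually[OF tendsto_const])
      qed
    qed (use f in \<open>auto simp: indicator_def\<close>)
    then show ?thesis using box by (simp add: set_lebesgue_integral_def LIMSEQ_const_iff)
  qed
  have stable: "Int_stable (range (\<lambda>(a, b). box a b :: 'a set))"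
    by (auto simp: Int_stable_def box_Int_box)
  have subset_Pow: "range (\<lambda>(a, b). box a b :: 'a set) \<subseteq> Pow UNIV" by simp
  have gen: "sets (borel :: 'a measure) = sigma_sets UNIV (range (\<lambda>(a, b). box a b))"
    by (subst borel_eq_box) (rule sets_measure_of, simp)
  have "(LINT x:A|lborel. f x) = 0" if "A \<in> sigma_sets UNIV (range (\<lambda>(a, b). box a b :: 'a set))" for A
    using that
  proof (induction rule: sigma_sets_induct_disjoint[OF stable subset_Pow, consumes 1,
      case_names basic empty compl union])
    case (basic A) then show ?case using box by auto
  next
    case empty then show ?case by (simp add: set_lebesgue_integral_def)
  next
    case (compl A)
    then have "A \<in> sets borel" using gen by simp
    have "(LINT x:UNIV - A|lborel. f x) = (LINT x|lborel. f x - indicator A x *\<^sub>R f x)"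
      unfolding set_lebesgue_integral_def by (intro Bochner_Integration.integral_cong) (auto simp: indicator_def)
    also have "\<dots> = (LINT x|lborel. f x) - (LINT x:A|lborel. f x)"
      unfolding set_lebesgue_integral_def
      using f si[OF \<open>A \<in> sets borel\<close>] by (intro Bochner_Integration.integral_diff) (auto simp: set_integrable_def)
    finally show ?case using total compl by simp
  next
    case (union A)
    then have A: "A i \<in> sets borel" for i using gen by auto
    have "(LINT x:(\<Union>i. A i)|lborel. f x) = (\<Sum>i. (LINT x:(A i)|lborel. f x))"
      using A union by (intro lebesgue_integral_countable_add si) (auto simp: disjoint_family_on_def)
    then show ?case using union by simp
  qed
  then have "(LINT x:A|lborel. f x) = (LINT x:A|lborel. 0)" if "A \<in> sets lborel" for A
    using that gen by (simp add: set_lebesgue_integral_def)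
  from density_unique_real[OF f _ this] show ?thesis by simp
qed

text \<open>Bumps converge boundedly to indicators of boxes, and a locally integrable function is localized to large boxes.\<close>

lemma AE_zero_of_test_integrals:
  fixes z :: "real ^ 'n \<Rightarrow> real"
  assumes z: "z \<in> borel_measurable borel" and loc: "\<And>a b. set_integrable lborel (cbox a b) z"
    and orth: "\<And>\<psi>. \<psi> \<in> test_functions \<Longrightarrow> (LINT x|lborel. z x * \<psi> x) = 0"
  shows "AE x in lborel. z x = 0"
proof -
  have box0: "(LINT x:box a b|lborel. z x) = 0" for a b
  proof -
    have "(\<lambda>n. LINT x|lborel. z x * bump (1 / (real n + 1)) a b x) \<longlonglongrightarrow> (LINT x|lborel. z x * indicator (box a b) x)"
    proof (rule integral_dominated_convergence[where w = "\<lambda>x. norm (indicator (cbox a b) x *\<^sub>R z x)"])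
      show "(\<lambda>x. z x * indicator (box a b) x) \<in> borel_measurable lborel" using z by simp
      have "bump c a b \<in> borel_measurable borel" if "0 < c" for c
        using test_function_continuous[OF bump_test_function[OF that]] by (rule borel_measurable_continuous_onI)
      then show "(\<lambda>x. z x * bump (1 / (real n + 1)) a b x) \<in> borel_measurable lborel" for n
        using z by simp
      show "integrable lborel (\<lambda>x. norm (indicator (cbox a b) x *\<^sub>R z x))"
        using loc[of a b] unfolding set_integrable_def by (rule integrable_norm)
      show "AE x in lborel. (\<lambda>n. z x * bump (1 / (real n + 1)) a b x) \<longlonglongrightarrow> z x * indicator (box a b) x"
        by (intro AE_I2 tendsto_intros bump_tendsto_indicator)
      show "AE x in lborel. norm (z x * bump (1 / (real n + 1)) a b x) \<le> norm (indicator (cbox a b) x *\<^sub>R z x)" for n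
      proof (rule AE_I2)
        fix x
        show "norm (z x * bump (1 / (real n + 1)) a b x) \<le> norm (indicator (cbox a b) x *\<^sub>R z x)"
        proof (cases "x \<in> cbox a b")
          case True
          have "\<bar>bump (1 / (real n + 1)) a b x\<bar> \<le> 1"
            using bump_range[of "1 / (real n + 1)" a b x] by simp
          then have "\<bar>z x\<bar> * \<bar>bump (1 / (real n + 1)) a b x\<bar> \<le> \<bar>z x\<bar> * 1" by (intro mult_left_mono) auto
          then show ?thesis using True by (simp add: abs_mult)
        next
          case False
          then have "x \<notin> box a b" using box_subset_cbox by blast
          then show ?thesis by (simp add: bump_eq_0)
        qed
      qed
    qed
    then show ?thesis
      using orth[OF bump_test_function] by (simp add: set_lebesgue_integral_def LIMSEQ_const_iff mult.commute)
  qed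
  have "AE x in lborel. indicator (box (- (real n *\<^sub>R One)) (real n *\<^sub>R One)) x * z x = 0" for n :: nat
  proof (rule AE_zero_of_box_integrals)
    let ?B = "box (- (real n *\<^sub>R One)) (real n *\<^sub>R One) :: (real ^ 'n) set"
    have "set_integrable lborel ?B z"
      by (rule set_integrable_subset[OF loc]) (auto intro: box_subset_cbox[THEN subsetD])
    then show "integrable lborel (\<lambda>x. indicator ?B x * z x)" by (simp add: set_integrable_def)
    fix a b :: "real ^ 'n"
    obtain c d where cd: "box a b \<inter> ?B = box c d"
      using box_Int_box[of a b] by blast
    have "(LINT x:box a b|lborel. indicator ?B x * z x) = (LINT x:box c d|lborel. z x)"
      unfolding set_lebesgue_integral_def cd[symmetric]
      by (intro Bochner_Integration.integral_cong) (auto simp: indicator_def)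
    then show "(LINT x:box a b|lborel. indicator ?B x * z x) = 0" using box0 by simp
  qed
  then have "AE x in lborel. \<forall>n::nat. indicator (box (- (real n *\<^sub>R One)) (real n *\<^sub>R One)) x * z x = 0"
    by (subst AE_all_countable) blast
  then show ?thesis
  proof eventually_elim
    case (elim x)
    obtain N :: nat where "x \<in> box (- (real N *\<^sub>R One)) (real N *\<^sub>R One)"
      using eventually_mem_centered_box[of x] unfolding eventually_sequentially by blast
    then show ?case using elim[rule_format, of N] by simp
  qed
qed

section \<open>The Dirichlet form of a continuous potential as a closed gradient\<close>

locale potential =
  fixes w :: "real ^ 'n \<Rightarrow> real"
  assumes continuous_w: "continuous_on UNIV w"
begin

text \<open>The isometry from \<open>L\<^sup>2(\<mu>\<^sup>w)\<close> onto \<open>L\<^sup>2\<close> of Lebesgue measure, so that one Hilbert space serves for all potentials.\<close>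

definition weighted :: "(real ^ 'n \<Rightarrow> real) \<Rightarrow> (real ^ 'n) ltwo" where
  "weighted u = l2_class (\<lambda>x. u x * exp (- (w x / 2)))"

definition unweighted :: "(real ^ 'n) ltwo \<Rightarrow> real ^ 'n \<Rightarrow> real" where
  "unweighted y = (\<lambda>x. l2_rep y x * exp (w x / 2))"

lemma w_measurable: "w \<in> borel_measurable borel"
  by (rule borel_measurable_continuous_onI[OF continuous_w])

lemma sets_mu: "sets (mu w) = sets borel"
  by (simp add: mu_def)

lemma measurable_mu: "u \<in> borel_measurable (mu w) \<longleftrightarrow> u \<in> borel_measurable borel"
  by (simp add: measurable_cong_sets[OF sets_mu refl])

lemma exp_weight: "(a * exp (- (w x / 2))) * (b * exp (- (w x / 2))) = exp (- w x) * (a * b)"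
proof -
  have "exp (- (w x / 2)) * exp (- (w x / 2)) = exp (- w x)" by (simp add: exp_add[symmetric])
  then show ?thesis by (simp add: mult_ac)
qed

lemma exp_cancel: "(a * exp (- (w x / 2))) * exp (w x / 2) = a" "(a * exp (w x / 2)) * exp (- (w x / 2)) = a"
proof -
  have "exp (- (w x / 2)) * exp (w x / 2) = 1" by (simp add: exp_add[symmetric])
  then show "(a * exp (- (w x / 2))) * exp (w x / 2) = a" "(a * exp (w x / 2)) * exp (- (w x / 2)) = a"
    by (simp_all add: mult.assoc mult.commute)
qed

lemma AE_mu: "(AE x in mu w. P x) \<longleftrightarrow> (AE x in lborel. P x)"
  unfolding mu_def using w_measurable by (subst AE_density) (auto simp: exp_gt_zero)

lemma l2_mu_iff: "u \<in> l2 (mu w) \<longleftrightarrow> (\<lambda>x. u x * exp (- (w x / 2))) \<in> l2 lborel"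
proof -
  have m: "u \<in> borel_measurable borel \<longleftrightarrow> (\<lambda>x. u x * exp (- (w x / 2))) \<in> borel_measurable borel"
  proof
    assume "(\<lambda>x. u x * exp (- (w x / 2))) \<in> borel_measurable borel"
    then have "(\<lambda>x. (u x * exp (- (w x / 2))) * exp (w x / 2)) \<in> borel_measurable borel"
      using w_measurable by measurable
    then show "u \<in> borel_measurable borel" by (simp only: exp_cancel)
  next
    assume "u \<in> borel_measurable borel"
    then show "(\<lambda>x. u x * exp (- (w x / 2))) \<in> borel_measurable borel"
      using w_measurable by measurable
  qed
  have "integrable (mu w) (\<lambda>x. (u x)\<^sup>2) \<longleftrightarrow> integrable lborel (\<lambda>x. (u x * exp (- (w x / 2)))\<^sup>2)"
    if "u \<in> borel_measurable borel"
    unfolding mu_def using that w_measurable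
    by (subst integrable_density) (simp_all add: power2_eq_square exp_weight)
  then show ?thesis using m by (auto simp: l2_def measurable_mu)
qed

lemma weighted_l2: "u \<in> l2 (mu w) \<Longrightarrow> (\<lambda>x. u x * exp (- (w x / 2))) \<in> l2 lborel"
  by (simp add: l2_mu_iff)

lemma l2_inner_mu:
  assumes "u \<in> borel_measurable borel" "v \<in> borel_measurable borel"
  shows "l2_inner (mu w) u v = (LINT x|lborel. u x * v x * exp (- w x))"
  unfolding l2_inner_def mu_def using assms w_measurable
  by (subst integral_density) (auto simp: mult_ac)

lemma l2_mu_measurable: "u \<in> l2 (mu w) \<Longrightarrow> u \<in> borel_measurable borel"
  using l2_measurable[of u "mu w"] by (simp add: measurable_mu)

lemma inner_weighted:
  assumes u: "u \<in> l2 (mu w)" and v: "v \<in> l2 (mu w)"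
  shows "inner (weighted u) (weighted v) = l2_inner (mu w) u v"
  unfolding weighted_def l2_class_inner[OF weighted_l2[OF u] weighted_l2[OF v]]
    l2_inner_mu[OF l2_mu_measurable[OF u] l2_mu_measurable[OF v]]
  by (simp add: l2_inner_def exp_weight mult.commute)

lemma norm_weighted: "u \<in> l2 (mu w) \<Longrightarrow> norm (weighted u) = l2_norm (mu w) u"
  by (simp add: norm_eq_sqrt_inner inner_weighted l2_norm_def)

lemma weighted_add: "u \<in> l2 (mu w) \<Longrightarrow> v \<in> l2 (mu w) \<Longrightarrow>
    weighted (\<lambda>x. u x + v x) = weighted u + weighted v"
  by (simp add: weighted_def l2_class_add weighted_l2 distrib_right)

lemma weighted_diff: "u \<in> l2 (mu w) \<Longrightarrow> v \<in> l2 (mu w) \<Longrightarrow>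
    weighted (\<lambda>x. u x - v x) = weighted u - weighted v"
  by (simp add: weighted_def l2_class_diff weighted_l2 left_diff_distrib)

lemma weighted_scale: "u \<in> l2 (mu w) \<Longrightarrow> weighted (\<lambda>x. c * u x) = c *\<^sub>R weighted u"
  by (simp add: weighted_def l2_class_scaleR weighted_l2 mult.assoc)

lemma weighted_uminus: "u \<in> l2 (mu w) \<Longrightarrow> weighted (\<lambda>x. - u x) = - weighted u"
  using weighted_scale[of u "-1"] by simp

lemma weighted_zero: "weighted (\<lambda>_. 0) = 0"
  by (simp add: weighted_def zero_ltwo_def)

lemma weighted_sum:
  assumes "\<And>i. i \<in> I \<Longrightarrow> u i \<in> l2 (mu w)"
  shows "weighted (\<lambda>x. \<Sum>i\<in>I. u i x) = (\<Sum>i\<in>I. weighted (u i))"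
  using assms
  by (induction I rule: infinite_finite_induct) (auto simp: weighted_zero weighted_add l2_sum)

lemma weighted_eq_iff:
  assumes "u \<in> l2 (mu w)" "v \<in> l2 (mu w)"
  shows "weighted u = weighted v \<longleftrightarrow> (AE x in mu w. u x = v x)"
  using assms by (simp add: weighted_def l2_class_eq_iff weighted_l2 AE_mu)

lemma unweighted: "unweighted y \<in> l2 (mu w)" "weighted (unweighted y) = y"
proof -
  have e: "(\<lambda>x. unweighted y x * exp (- (w x / 2))) = l2_rep y"
    by (simp only: unweighted_def exp_cancel)
  show "unweighted y \<in> l2 (mu w)" unfolding l2_mu_iff e by (rule l2_rep)
  show "weighted (unweighted y) = y" unfolding weighted_def e by (rule l2_rep)
qed

lemma l2_mu_compact_support:
  assumes "continuous_on UNIV f" and "\<And>x. R < norm x \<Longrightarrow> f x = 0"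
  shows "f \<in> l2 (mu w)"
  unfolding l2_mu_iff
  by (rule l2_compact_support[where R = R])
     (use assms in \<open>auto intro!: continuous_intros continuous_w\<close>)

lemma test_function_l2:
  assumes u: "u \<in> test_functions"
  shows "u \<in> l2 (mu w)" "(\<lambda>x. grad u x $ i) \<in> l2 (mu w)"
proof -
  obtain R where R: "R > 0" "\<And>x. R < norm x \<Longrightarrow> u x = 0" "\<And>x. R < norm x \<Longrightarrow> grad u x = 0"
    using test_function_bounded_support[OF u] by metis
  show "u \<in> l2 (mu w)"
    by (rule l2_mu_compact_support[OF test_function_continuous[OF u] R(2)])
  show "(\<lambda>x. grad u x $ i) \<in> l2 (mu w)"
    by (rule l2_mu_compact_support[OF test_function_grad_continuous[OF u], where R = R]) (simp add: R(3))
qed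

text \<open>The factor \<open>1/2\<close> of the form is absorbed into the gradient.\<close>

definition wgrad :: "(real ^ 'n \<Rightarrow> real) \<Rightarrow> (real ^ 'n) ltwo ^ 'n" where
  "wgrad u = (\<chi> i. (1 / sqrt 2) *\<^sub>R weighted (\<lambda>x. grad u x $ i))"

lemma wgrad_add: "u \<in> test_functions \<Longrightarrow> v \<in> test_functions \<Longrightarrow>
    wgrad (\<lambda>x. u x + v x) = wgrad u + wgrad v"
  by (simp add: wgrad_def vec_eq_iff grad_add test_function_differentiable weighted_add
      test_function_l2 scaleR_add_right)

lemma wgrad_diff: "u \<in> test_functions \<Longrightarrow> v \<in> test_functions \<Longrightarrow>
    wgrad (\<lambda>x. u x - v x) = wgrad u - wgrad v"
  by (simp add: wgrad_def vec_eq_iff grad_diff test_function_differentiable weighted_diff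
      test_function_l2 scaleR_diff_right)

lemma wgrad_scale: "u \<in> test_functions \<Longrightarrow> wgrad (\<lambda>x. c * u x) = c *\<^sub>R wgrad u"
  by (simp add: wgrad_def vec_eq_iff grad_scale test_function_differentiable weighted_scale
      test_function_l2)

lemma pre_form_eq:
  assumes u: "u \<in> test_functions" and v: "v \<in> test_functions"
  shows "pre_form w u v = inner (wgrad u) (wgrad v)"
proof -
  have int: "integrable lborel (\<lambda>x. (grad u x $ i * grad v x $ i) * exp (- w x))" for i
  proof -
    have "integrable lborel (\<lambda>x. grad u x $ i * (grad v x $ i * exp (- w x)))"
      by (intro test_function_product_integrable(2)[OF u] continuous_intros continuous_w
          continuous_on_mult test_function_grad_continuous[OF v])
    then show ?thesis by (simp add: mult.assoc)
  qed
  have "(LINT x|lborel. (grad u x \<bullet> grad v x) * exp (- w x))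
      = (LINT x|lborel. (\<Sum>i\<in>UNIV. (grad u x $ i * grad v x $ i) * exp (- w x)))"
    by (simp add: inner_vec_def sum_distrib_right)
  also have "\<dots> = (\<Sum>i\<in>UNIV. LINT x|lborel. (grad u x $ i * grad v x $ i) * exp (- w x))"
    using int by (intro Bochner_Integration.integral_sum) auto
  also have "\<dots> = (\<Sum>i\<in>UNIV. l2_inner (mu w) (\<lambda>x. grad u x $ i) (\<lambda>x. grad v x $ i))"
    by (simp add: l2_inner_mu l2_mu_measurable test_function_l2 u v)
  also have "\<dots> = (\<Sum>i\<in>UNIV. inner (weighted (\<lambda>x. grad u x $ i)) (weighted (\<lambda>x. grad v x $ i)))"
    by (simp add: inner_weighted test_function_l2 u v)
  finally show ?thesis
    by (simp add: pre_form_def inner_vec_def wgrad_def sum_divide_distrib)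
qed

text \<open>The gradient on test functions; its closure turns the form into the square of a closed gradient.\<close>

definition graph0 :: "((real ^ 'n) ltwo \<times> ((real ^ 'n) ltwo ^ 'n)) set" where
  "graph0 = {(weighted u, wgrad u) | u. u \<in> test_functions}"

definition graph :: "((real ^ 'n) ltwo \<times> ((real ^ 'n) ltwo ^ 'n)) set" where
  "graph = closure graph0"

lemma subspace_graph0: "subspace graph0"
proof (rule subspaceI)
  have "wgrad (\<lambda>_. 0) = 0" using wgrad_scale[OF test_functions_zero, of 0] by simp
  then show "0 \<in> graph0"
    unfolding graph0_def zero_prod_def using test_functions_zero weighted_zero by (intro CollectI exI[of _ "\<lambda>_. 0"]) auto
next
  fix x y assume "x \<in> graph0" "y \<in> graph0"
  then obtain u v where u: "u \<in> test_functions" "x = (weighted u, wgrad u)"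
    and v: "v \<in> test_functions" "y = (weighted v, wgrad v)" unfolding graph0_def by auto
  then have "x + y = (weighted (\<lambda>x. u x + v x), wgrad (\<lambda>x. u x + v x))"
    by (simp add: weighted_add test_function_l2 wgrad_add)
  then show "x + y \<in> graph0" unfolding graph0_def using test_functions_add[OF u(1) v(1)] by blast
next
  fix c x assume "x \<in> graph0"
  then obtain u where u: "u \<in> test_functions" "x = (weighted u, wgrad u)" unfolding graph0_def by auto
  then have "c *\<^sub>R x = (weighted (\<lambda>x. c * u x), wgrad (\<lambda>x. c * u x))"
    by (simp add: weighted_scale test_function_l2 wgrad_scale)
  then show "c *\<^sub>R x \<in> graph0" unfolding graph0_def using test_functions_scale[OF u(1)] by blast
qed

text \<open>The fundamental lemma applies to the locally integrable function \<open>z h\<close>. The weight \<open>h\<close> is \<open>exp (- w/2)\<close> for the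
  density of test functions and \<open>exp (w/2)\<close> for closability.\<close>

lemma orthogonal_to_test_functions:
  fixes z :: "(real ^ 'n) ltwo"
  assumes h: "continuous_on UNIV h" "\<And>x. 0 < h x"
    and orth: "\<And>\<psi>. \<psi> \<in> test_functions \<Longrightarrow> inner z (l2_class (\<lambda>x. \<psi> x * h x)) = 0"
  shows "z = 0"
proof -
  define f where "f x = l2_rep z x * h x" for x
  have zm: "l2_rep z \<in> borel_measurable borel" using l2_measurable[OF l2_rep(1)[of z]] by simp
  have hm: "h \<in> borel_measurable borel" by (rule borel_measurable_continuous_onI[OF h(1)])
  have fm: "f \<in> borel_measurable borel" unfolding f_def[abs_def] using zm hm by measurable
  have "AE x in lborel. f x = 0"
  proof (rule AE_zero_of_test_integrals[OF fm])
    fix a b :: "real ^ 'n"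
    have hl2: "(\<lambda>x. indicator (cbox a b) x * h x) \<in> l2 lborel"
    proof -
      have "set_integrable lborel (cbox a b) (\<lambda>x. (h x)\<^sup>2)"
        unfolding set_integrable_def
        by (rule borel_integrable_compact) (auto intro!: continuous_intros continuous_on_subset[OF h(1)])
      then have "integrable lborel (\<lambda>x. (indicator (cbox a b) x * h x)\<^sup>2)"
        unfolding set_integrable_def
        by (rule Bochner_Integration.integrable_cong[THEN iffD1, rotated 2]) (auto simp: indicator_def)
      then show ?thesis using hm by (simp add: l2_def)
    qed
    have "integrable lborel (\<lambda>x. l2_rep z x * (indicator (cbox a b) x * h x))"
      by (rule l2_product_integrable[OF l2_rep(1) hl2])
    then show "set_integrable lborel (cbox a b) f"
      by (simp add: set_integrable_def f_def mult_ac)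
  next
    fix \<psi> :: "real ^ 'n \<Rightarrow> real" assume psi: "\<psi> \<in> test_functions"
    obtain R where R: "\<And>x. R < norm x \<Longrightarrow> \<psi> x = 0"
      using test_function_bounded_support[OF psi] by metis
    have "(\<lambda>x. \<psi> x * h x) \<in> l2 lborel"
      by (rule l2_compact_support[where R = R])
         (use R in \<open>auto intro!: continuous_intros h test_function_continuous[OF psi]\<close>)
    from l2_class_inner[OF l2_rep(1)[of z] this] orth[OF psi]
    show "(LINT x|lborel. f x * \<psi> x) = 0"
      by (simp add: l2_rep l2_inner_def f_def mult_ac)
  qed
  then have "AE x in lborel. l2_rep z x = 0"
    by eventually_elim (use h(2) in \<open>simp add: f_def less_imp_neq[THEN not_sym]\<close>)
  then have "l2_class (l2_rep z) = l2_class (\<lambda>_. 0)"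
    by (subst l2_class_eq_iff) (auto simp: l2_rep l2_zero)
  then show ?thesis by (simp add: l2_rep zero_ltwo_def)
qed

text \<open>If \<open>u\<^sub>n \<rightarrow> 0\<close> and \<open>\<nabla>u\<^sub>n \<rightarrow> g\<close>, integrate by parts against a test function. Multiplying the test function
  by \<open>exp (w/2)\<close> turns the unweighted integrals into inner products of the Hilbert space.\<close>

lemma closable: "(0, g) \<in> graph \<Longrightarrow> g = 0"
proof -
  assume "(0, g) \<in> graph"
  then obtain p where p: "\<And>n. p n \<in> graph0" "p \<longlonglongrightarrow> (0, g)"
    unfolding graph_def closure_sequential by blast
  then have "\<forall>n. \<exists>u. u \<in> test_functions \<and> p n = (weighted u, wgrad u)" unfolding graph0_def by blast
  then obtain u where u: "\<And>n. u n \<in> test_functions" "\<And>n. p n = (weighted (u n), wgrad (u n))" by metis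
  have lim1: "(\<lambda>n. weighted (u n)) \<longlonglongrightarrow> 0" and lim2: "(\<lambda>n. wgrad (u n)) \<longlonglongrightarrow> g"
    using tendsto_fst[OF p(2)] tendsto_snd[OF p(2)] by (simp_all add: u(2))
  have "g $ i = 0" for i
  proof (rule orthogonal_to_test_functions[where h = "\<lambda>x. exp (w x / 2)"])
    show "continuous_on UNIV (\<lambda>x. exp (w x / 2))" by (intro continuous_intros continuous_w) simp
    fix \<psi> :: "real ^ 'n \<Rightarrow> real" assume psi: "\<psi> \<in> test_functions"
    obtain R where R: "\<And>x. R < norm x \<Longrightarrow> \<psi> x = 0" "\<And>x. R < norm x \<Longrightarrow> grad \<psi> x = 0"
      using test_function_bounded_support[OF psi] by metis
    have l1: "(\<lambda>x. \<psi> x * exp (w x / 2)) \<in> l2 lborel"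
      by (rule l2_compact_support[where R = R])
         (use R in \<open>auto intro!: continuous_intros continuous_w test_function_continuous[OF psi]\<close>)
    have l2: "(\<lambda>x. grad \<psi> x $ i * exp (w x / 2)) \<in> l2 lborel"
      by (rule l2_compact_support[where R = R])
         (use R in \<open>auto intro!: continuous_on_mult continuous_intros continuous_w test_function_grad_continuous[OF psi]\<close>)
    have e: "(a * exp (- (w x / 2))) * (b * exp (w x / 2)) = a * b" for a b x
      using exp_cancel(1)[of a x] by (metis mult.assoc mult.commute)
    have parts: "inner (wgrad (u n) $ i) (l2_class (\<lambda>x. \<psi> x * exp (w x / 2)))
        = - (1 / sqrt 2) * inner (weighted (u n)) (l2_class (\<lambda>x. grad \<psi> x $ i * exp (w x / 2)))" for n
      unfolding wgrad_def weighted_def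
      using integration_by_parts[OF u(1)[of n] psi, of i]
      by (simp add: l2_class_inner[OF weighted_l2[OF test_function_l2(2)[OF u(1)]] l1]
          l2_class_inner[OF weighted_l2[OF test_function_l2(1)[OF u(1)]] l2] l2_inner_def e)
    have "(\<lambda>n. inner (wgrad (u n) $ i) (l2_class (\<lambda>x. \<psi> x * exp (w x / 2))))
        \<longlonglongrightarrow> inner (g $ i) (l2_class (\<lambda>x. \<psi> x * exp (w x / 2)))"
      by (intro tendsto_intros tendsto_vec_nth lim2)
    moreover have "(\<lambda>n. - (1 / sqrt 2) * inner (weighted (u n)) (l2_class (\<lambda>x. grad \<psi> x $ i * exp (w x / 2))))
        \<longlonglongrightarrow> - (1 / sqrt 2) * inner 0 (l2_class (\<lambda>x. grad \<psi> x $ i * exp (w x / 2)))"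
      by (intro tendsto_intros lim1)
    ultimately show "inner (g $ i) (l2_class (\<lambda>x. \<psi> x * exp (w x / 2))) = 0"
      unfolding parts using LIMSEQ_unique by force
  qed simp
  then show "g = 0" by (simp add: vec_eq_iff)
qed

sublocale F: closed_gradient graph
proof
  show "subspace graph" unfolding graph_def by (rule subspace_closure[OF subspace_graph0])
  show "closed graph" by (simp add: graph_def)
  show "\<And>g. (0, g) \<in> graph \<Longrightarrow> g = 0" by (rule closable)
  fix z assume z: "\<And>v k. (v, k) \<in> graph \<Longrightarrow> inner z v = 0"
  show "z = 0"
  proof (rule orthogonal_to_test_functions[where h = "\<lambda>x. exp (- (w x / 2))"])
    show "continuous_on UNIV (\<lambda>x. exp (- (w x / 2)))" by (intro continuous_intros continuous_w) simp
    fix \<psi> :: "real ^ 'n \<Rightarrow> real" assume "\<psi> \<in> test_functions"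
    then have "(weighted \<psi>, wgrad \<psi>) \<in> graph"
      unfolding graph_def graph0_def by (intro subsetD[OF closure_subset]) blast
    from z[OF this] show "inner z (l2_class (\<lambda>x. \<psi> x * exp (- (w x / 2)))) = 0"
      by (simp add: weighted_def)
  qed simp
qed

lemma test_function_graph: "u \<in> test_functions \<Longrightarrow> (weighted u, wgrad u) \<in> graph"
  unfolding graph_def graph0_def by (intro subsetD[OF closure_subset]) blast

lemma form_approx_iff:
  assumes u: "u \<in> l2 (mu w)"
  shows "form_approx w \<phi> u \<longleftrightarrow> (\<forall>n. \<phi> n \<in> test_functions) \<and>
    (\<lambda>n. weighted (\<phi> n)) \<longlonglongrightarrow> weighted u \<and> Cauchy (\<lambda>n. wgrad (\<phi> n))"
proof (cases "\<forall>n. \<phi> n \<in> test_functions")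
  case True
  then have t: "\<phi> n \<in> test_functions" for n by simp
  have n1: "l2_norm (mu w) (\<lambda>x. \<phi> n x - u x) = norm (weighted (\<phi> n) - weighted u)" for n
    by (simp add: norm_weighted[symmetric] l2_diff test_function_l2 t u weighted_diff)
  have n2: "pre_form w (\<lambda>x. \<phi> m x - \<phi> n x) (\<lambda>x. \<phi> m x - \<phi> n x) = (norm (wgrad (\<phi> m) - wgrad (\<phi> n)))\<^sup>2" for m n
    by (simp add: pre_form_eq test_functions_diff t wgrad_diff power2_norm_eq_inner)
  have "(\<forall>\<epsilon>>0. \<exists>N. \<forall>m\<ge>N. \<forall>n\<ge>N. (norm (wgrad (\<phi> m) - wgrad (\<phi> n)))\<^sup>2 < \<epsilon>) \<longleftrightarrow> Cauchy (\<lambda>n. wgrad (\<phi> n))"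
  proof
    assume L: "\<forall>\<epsilon>>0. \<exists>N. \<forall>m\<ge>N. \<forall>n\<ge>N. (norm (wgrad (\<phi> m) - wgrad (\<phi> n)))\<^sup>2 < \<epsilon>"
    show "Cauchy (\<lambda>n. wgrad (\<phi> n))"
    proof (rule metric_CauchyI)
      fix e :: real assume e: "0 < e"
      then have "0 < e\<^sup>2" by simp
      from L[rule_format, OF this] obtain N where
        N: "\<forall>m\<ge>N. \<forall>n\<ge>N. (norm (wgrad (\<phi> m) - wgrad (\<phi> n)))\<^sup>2 < e\<^sup>2" by blast
      have "dist (wgrad (\<phi> m)) (wgrad (\<phi> n)) < e" if "m \<ge> N" "n \<ge> N" for m n
        unfolding dist_norm
        by (rule power_less_imp_less_base[of _ 2]) (use N that e in auto)
      then show "\<exists>N. \<forall>m\<ge>N. \<forall>n\<ge>N. dist (wgrad (\<phi> m)) (wgrad (\<phi> n)) < e" by blast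
    qed
  next
    assume C: "Cauchy (\<lambda>n. wgrad (\<phi> n))"
    show "\<forall>\<epsilon>>0. \<exists>N. \<forall>m\<ge>N. \<forall>n\<ge>N. (norm (wgrad (\<phi> m) - wgrad (\<phi> n)))\<^sup>2 < \<epsilon>"
    proof (intro allI impI)
      fix e :: real assume e: "0 < e"
      obtain N where N: "\<And>m n. m \<ge> N \<Longrightarrow> n \<ge> N \<Longrightarrow> norm (wgrad (\<phi> m) - wgrad (\<phi> n)) < sqrt e"
        using metric_CauchyD[OF C, of "sqrt e"] e by (auto simp: dist_norm)
      have "(norm (wgrad (\<phi> m) - wgrad (\<phi> n)))\<^sup>2 < e" if "m \<ge> N" "n \<ge> N" for m n
        using power_strict_mono[OF N[OF that], of 2] e by simp
      then show "\<exists>N. \<forall>m\<ge>N. \<forall>n\<ge>N. (norm (wgrad (\<phi> m) - wgrad (\<phi> n)))\<^sup>2 < e" by blast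
    qed
  qed
  then show ?thesis
    unfolding form_approx_def n1 n2 tendsto_norm_zero_iff LIM_zero_iff by (rule arg_cong)
next
  case False
  then have "\<not> form_approx w \<phi> u" unfolding form_approx_def by (rule contrapos_nn) (erule conjunct1)
  with False show ?thesis by blast
qed

lemma form_approx_limit:
  assumes u: "u \<in> l2 (mu w)" and ap: "form_approx w \<phi> u"
  obtains g where "(weighted u, g) \<in> graph" "(\<lambda>n. wgrad (\<phi> n)) \<longlonglongrightarrow> g"
proof -
  note a = iffD1[OF form_approx_iff[OF u] ap]
  have t: "\<phi> n \<in> test_functions" for n using a by blast
  have l: "(\<lambda>n. weighted (\<phi> n)) \<longlonglongrightarrow> weighted u" and C: "Cauchy (\<lambda>n. wgrad (\<phi> n))"
    using a by blast+
  obtain g where g: "(\<lambda>n. wgrad (\<phi> n)) \<longlonglongrightarrow> g" using Cauchy_convergent[OF C] unfolding convergent_def by blast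
  have "(\<lambda>n. (weighted (\<phi> n), wgrad (\<phi> n))) \<longlonglongrightarrow> (weighted u, g)" by (intro tendsto_Pair l g)
  then have "(weighted u, g) \<in> graph"
    by (rule closed_sequentially[OF F.closed_Gam, rotated]) (rule test_function_graph[OF t])
  from that[OF this g] show thesis .
qed

lemma graph_approx:
  assumes u: "u \<in> l2 (mu w)" and g: "(weighted u, g) \<in> graph"
  obtains \<phi> where "form_approx w \<phi> u"
proof -
  obtain p where p: "\<And>n. p n \<in> graph0" "p \<longlonglongrightarrow> (weighted u, g)"
    using g unfolding graph_def closure_sequential by blast
  then have "\<forall>n. \<exists>u. u \<in> test_functions \<and> p n = (weighted u, wgrad u)" unfolding graph0_def by blast
  then obtain \<phi> where \<phi>: "\<And>n. \<phi> n \<in> test_functions" "\<And>n. p n = (weighted (\<phi> n), wgrad (\<phi> n))" by metis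
  have "(\<lambda>n. weighted (\<phi> n)) \<longlonglongrightarrow> weighted u" "(\<lambda>n. wgrad (\<phi> n)) \<longlonglongrightarrow> g"
    using tendsto_fst[OF p(2)] tendsto_snd[OF p(2)] by (simp_all add: \<phi>(2))
  then have "form_approx w \<phi> u"
    unfolding form_approx_iff[OF u] using \<phi>(1) LIMSEQ_imp_Cauchy by blast
  then show thesis by (rule that)
qed

lemma graph_unique: "(u, g) \<in> graph \<Longrightarrow> (u, h) \<in> graph \<Longrightarrow> g = h"
  using F.single_Gam[of "g - h"] F.Gam_diff[of u g u h] by simp

lemma form_domain_iff: "u \<in> form_domain w \<longleftrightarrow> u \<in> l2 (mu w) \<and> (\<exists>g. (weighted u, g) \<in> graph)"
proof
  assume "u \<in> form_domain w"
  then obtain \<phi> where u: "u \<in> l2 (mu w)" and ap: "form_approx w \<phi> u" unfolding form_domain_def by blast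
  show "u \<in> l2 (mu w) \<and> (\<exists>g. (weighted u, g) \<in> graph)"
    by (rule form_approx_limit[OF u ap]) (use u in blast)
next
  assume "u \<in> l2 (mu w) \<and> (\<exists>g. (weighted u, g) \<in> graph)"
  then obtain g where u: "u \<in> l2 (mu w)" and g: "(weighted u, g) \<in> graph" by blast
  show "u \<in> form_domain w"
    by (rule graph_approx[OF u g]) (use u in \<open>auto simp: form_domain_def\<close>)
qed

lemma dirichlet_form_eq:
  assumes u: "u \<in> l2 (mu w)" "(weighted u, g) \<in> graph" and v: "v \<in> l2 (mu w)" "(weighted v, h) \<in> graph"
  shows "dirichlet_form w u v = inner g h"
  unfolding dirichlet_form_def
proof (rule the_equality)
  have all: "(\<lambda>n. pre_form w (\<phi> n) (\<psi> n)) \<longlonglongrightarrow> inner g h" if ap: "form_approx w \<phi> u" "form_approx w \<psi> v" for \<phi> \<psi>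
  proof -
    obtain g' where g': "(weighted u, g') \<in> graph" "(\<lambda>n. wgrad (\<phi> n)) \<longlonglongrightarrow> g'"
      by (rule form_approx_limit[OF u(1) ap(1)])
    obtain h' where h': "(weighted v, h') \<in> graph" "(\<lambda>n. wgrad (\<psi> n)) \<longlonglongrightarrow> h'"
      by (rule form_approx_limit[OF v(1) ap(2)])
    have "g' = g" "h' = h"
      by (rule graph_unique[OF g'(1) u(2)], rule graph_unique[OF h'(1) v(2)])
    then have "(\<lambda>n. inner (wgrad (\<phi> n)) (wgrad (\<psi> n))) \<longlonglongrightarrow> inner g h"
      using g'(2) h'(2) by (auto intro: tendsto_inner)
    moreover have "pre_form w (\<phi> n) (\<psi> n) = inner (wgrad (\<phi> n)) (wgrad (\<psi> n))" for n
      using ap by (intro pre_form_eq) (auto simp: form_approx_def)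
    ultimately show ?thesis by simp
  qed
  then show "\<forall>\<phi> \<psi>. form_approx w \<phi> u \<and> form_approx w \<psi> v \<longrightarrow> (\<lambda>n. pre_form w (\<phi> n) (\<psi> n)) \<longlonglongrightarrow> inner g h"
    by blast
  fix e assume e: "\<forall>\<phi> \<psi>. form_approx w \<phi> u \<and> form_approx w \<psi> v \<longrightarrow> (\<lambda>n. pre_form w (\<phi> n) (\<psi> n)) \<longlonglongrightarrow> e"
  obtain \<phi> where \<phi>: "form_approx w \<phi> u" by (rule graph_approx[OF u])
  obtain \<psi> where \<psi>: "form_approx w \<psi> v" by (rule graph_approx[OF v])
  show "e = inner g h"
    by (rule LIMSEQ_unique[OF e[rule_format, OF conjI[OF \<phi> \<psi>]] all[OF \<phi> \<psi>]])
qed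

lemma generator_iff:
  "(u, f) \<in> generator w \<longleftrightarrow> u \<in> l2 (mu w) \<and> f \<in> l2 (mu w) \<and> (weighted u, - weighted f) \<in> F.A"
proof
  assume "(u, f) \<in> generator w"
  then have u: "u \<in> form_domain w" and f: "f \<in> l2 (mu w)"
    and eq: "\<And>v. v \<in> form_domain w \<Longrightarrow> dirichlet_form w u v = l2_inner (mu w) (\<lambda>x. - f x) v"
    unfolding generator_def by auto
  obtain g where g: "u \<in> l2 (mu w)" "(weighted u, g) \<in> graph" using u form_domain_iff by blast
  have "inner g h = inner (- weighted f) y" if yh: "(y, h) \<in> graph" for y h
  proof -
    have v: "unweighted y \<in> l2 (mu w)" "(weighted (unweighted y), h) \<in> graph"
      using yh by (simp_all add: unweighted)
    then have "unweighted y \<in> form_domain w" using form_domain_iff by blast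
    from eq[OF this] show ?thesis
      unfolding dirichlet_form_eq[OF g v] inner_weighted[OF l2_uminus[OF f] v(1), symmetric]
      by (simp add: weighted_uminus f unweighted)
  qed
  then show "u \<in> l2 (mu w) \<and> f \<in> l2 (mu w) \<and> (weighted u, - weighted f) \<in> F.A"
    unfolding F.A_def using g f by blast
next
  assume r: "u \<in> l2 (mu w) \<and> f \<in> l2 (mu w) \<and> (weighted u, - weighted f) \<in> F.A"
  then obtain g where g: "u \<in> l2 (mu w)" "(weighted u, g) \<in> graph" and f: "f \<in> l2 (mu w)"
    and eq: "\<And>y h. (y, h) \<in> graph \<Longrightarrow> inner g h = inner (- weighted f) y"
    unfolding F.A_def by blast
  have "dirichlet_form w u v = l2_inner (mu w) (\<lambda>x. - f x) v" if v: "v \<in> form_domain w" for v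
  proof -
    obtain h where h: "v \<in> l2 (mu w)" "(weighted v, h) \<in> graph" using v form_domain_iff by blast
    show ?thesis
      unfolding dirichlet_form_eq[OF g h] inner_weighted[OF l2_uminus[OF f] h(1), symmetric]
      by (simp add: eq[OF h(2)] weighted_uminus f)
  qed
  moreover have "u \<in> form_domain w" using g form_domain_iff by blast
  ultimately show "(u, f) \<in> generator w" unfolding generator_def using f by blast
qed

lemma neg_generator_iff:
  "(u, g) \<in> neg_generator w \<longleftrightarrow> u \<in> l2 (mu w) \<and> g \<in> l2 (mu w) \<and> (weighted u, weighted g) \<in> F.A"
proof -
  have "(u, g) \<in> neg_generator w \<longleftrightarrow> (u, \<lambda>x. - g x) \<in> generator w"
  proof
    assume "(u, g) \<in> neg_generator w"
    then obtain f where "(u, f) \<in> generator w" "g = (\<lambda>x. - f x)" unfolding neg_generator_def by blast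
    then show "(u, \<lambda>x. - g x) \<in> generator w" by simp
  next
    assume "(u, \<lambda>x. - g x) \<in> generator w"
    then show "(u, g) \<in> neg_generator w" unfolding neg_generator_def
      by (intro CollectI exI[of _ u] exI[of _ "\<lambda>x. - g x"]) simp
  qed
  also have "\<dots> \<longleftrightarrow> u \<in> l2 (mu w) \<and> g \<in> l2 (mu w) \<and> (weighted u, weighted g) \<in> F.A"
    unfolding generator_iff using l2_uminus[of g "mu w"] l2_uminus[of "\<lambda>x. - g x" "mu w"]
    by (auto simp: weighted_uminus)
  finally show ?thesis .
qed

section \<open>Spectrum and semigroup of the Dirichlet form\<close>

lemma weighted_diff_scale: "g \<in> l2 (mu w) \<Longrightarrow> u \<in> l2 (mu w) \<Longrightarrow>
   (\<lambda>x. g x - l * u x) \<in> l2 (mu w) \<and> weighted (\<lambda>x. g x - l * u x) = weighted g - l *\<^sub>R weighted u"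
  by (simp add: weighted_diff weighted_scale l2_scale l2_diff)

lemma resolvent_set_eq: "resolvent_set (mu w) (neg_generator w) = F.rset"
proof -
  have 1: "(\<forall>f\<in>l2 (mu w). \<exists>(u, g)\<in>neg_generator w. AE x in mu w. g x - l * u x = f x)
      \<longleftrightarrow> (\<forall>f. \<exists>(u, g)\<in>F.A. g - l *\<^sub>R u = f)" for l
  proof
    assume L: "\<forall>f\<in>l2 (mu w). \<exists>(u, g)\<in>neg_generator w. AE x in mu w. g x - l * u x = f x"
    show "\<forall>f. \<exists>(u, g)\<in>F.A. g - l *\<^sub>R u = f"
    proof
      fix f
      obtain u g where ug: "(u, g) \<in> neg_generator w" "AE x in mu w. g x - l * u x = unweighted f x"
        using L unweighted(1)[of f] by blast
      then have "u \<in> l2 (mu w)" "g \<in> l2 (mu w)" "(weighted u, weighted g) \<in> F.A" by (auto simp: neg_generator_iff)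
      moreover from this ug(2) have "weighted g - l *\<^sub>R weighted u = f"
        using weighted_diff_scale[of g u l] weighted_eq_iff[of "\<lambda>x. g x - l * u x" "unweighted f"]
        by (simp add: unweighted)
      ultimately show "\<exists>(u, g)\<in>F.A. g - l *\<^sub>R u = f" by blast
    qed
  next
    assume R: "\<forall>f. \<exists>(u, g)\<in>F.A. g - l *\<^sub>R u = f"
    show "\<forall>f\<in>l2 (mu w). \<exists>(u, g)\<in>neg_generator w. AE x in mu w. g x - l * u x = f x"
    proof
      fix f assume f: "f \<in> l2 (mu w)"
      obtain a b where ab: "(a, b) \<in> F.A" "b - l *\<^sub>R a = weighted f" using R by blast
      have "AE x in mu w. unweighted b x - l * unweighted a x = f x"
        using weighted_diff_scale[OF unweighted(1) unweighted(1), of b l a] ab(2) f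
        by (subst weighted_eq_iff[symmetric]) (auto simp: unweighted)
      moreover have "(unweighted a, unweighted b) \<in> neg_generator w"
        using ab(1) by (simp add: neg_generator_iff unweighted)
      ultimately show "\<exists>(u, g)\<in>neg_generator w. AE x in mu w. g x - l * u x = f x" by blast
    qed
  qed
  have 2: "(\<forall>(u, g)\<in>neg_generator w. l2_norm (mu w) u \<le> C * l2_norm (mu w) (\<lambda>x. g x - l * u x))
      \<longleftrightarrow> (\<forall>(u, g)\<in>F.A. norm u \<le> C * norm (g - l *\<^sub>R u))" for l C
  proof
    assume L: "\<forall>(u, g)\<in>neg_generator w. l2_norm (mu w) u \<le> C * l2_norm (mu w) (\<lambda>x. g x - l * u x)"
    show "\<forall>(u, g)\<in>F.A. norm u \<le> C * norm (g - l *\<^sub>R u)"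
    proof (intro ballI, clarify)
      fix a b assume "(a, b) \<in> F.A"
      then have "(unweighted a, unweighted b) \<in> neg_generator w" by (simp add: neg_generator_iff unweighted)
      with L have "l2_norm (mu w) (unweighted a) \<le> C * l2_norm (mu w) (\<lambda>x. unweighted b x - l * unweighted a x)" by blast
      then show "norm a \<le> C * norm (b - l *\<^sub>R a)"
        using weighted_diff_scale[OF unweighted(1) unweighted(1), of b l a]
        by (simp add: norm_weighted[symmetric] unweighted)
    qed
  next
    assume R: "\<forall>(u, g)\<in>F.A. norm u \<le> C * norm (g - l *\<^sub>R u)"
    show "\<forall>(u, g)\<in>neg_generator w. l2_norm (mu w) u \<le> C * l2_norm (mu w) (\<lambda>x. g x - l * u x)"
    proof (intro ballI, clarify)
      fix u g assume ug: "(u, g) \<in> neg_generator w"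
      then have m: "u \<in> l2 (mu w)" "g \<in> l2 (mu w)" "(weighted u, weighted g) \<in> F.A" by (auto simp: neg_generator_iff)
      with R have "norm (weighted u) \<le> C * norm (weighted g - l *\<^sub>R weighted u)" by blast
      then show "l2_norm (mu w) u \<le> C * l2_norm (mu w) (\<lambda>x. g x - l * u x)"
        using weighted_diff_scale[OF m(2,1), of l] norm_weighted[of "\<lambda>x. g x - l * u x"]
        by (simp add: norm_weighted m)
    qed
  qed
  show ?thesis unfolding resolvent_set_def F.rset_def 1 2 ..
qed

text \<open>An isolated point of the spectrum that is an eigenvalue of finite multiplicity is a discrete point in the abstract
  sense: the isometry carries a finite spanning set of the eigenspace to a finite spanning set.\<close>

lemma essential_spectrumI:
  assumes l: "l \<notin> F.rset" "\<not> F.discrete_at l"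
  shows "l \<in> essential_spectrum (mu w) (neg_generator w)"
proof -
  let ?S = "l2_spectrum (mu w) (neg_generator w)"
  have S: "?S = - F.rset" by (simp add: l2_spectrum_def resolvent_set_eq)
  have False if iso: "l isolated_in ?S" and fin: "eigenvalue_finite_mult (mu w) (neg_generator w) l"
  proof -
    obtain T where T: "open T" "T \<inter> ?S = {l}" using iso unfolding isolated_in_def by blast
    then obtain \<delta> where \<delta>: "\<delta> > 0" "ball l \<delta> \<subseteq> T" using open_contains_ball by blast
    have "m \<in> F.rset" if "0 < \<bar>m - l\<bar>" "\<bar>m - l\<bar> < \<delta>" for m
    proof -
      have "m \<in> T" using \<delta>(2) that(2) by (auto simp: dist_real_def abs_minus_commute)
      then show ?thesis using T(2) that(1) S by auto
    qed
    moreover obtain B where B: "finite B" "B \<subseteq> eigenspace (neg_generator w) l"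
      and span: "\<And>u. u \<in> eigenspace (neg_generator w) l \<Longrightarrow> \<exists>c. AE x in mu w. u x = (\<Sum>b\<in>B. c b * b x)"
      using fin unfolding eigenvalue_finite_mult_def by blast
    have Bl2: "b \<in> l2 (mu w)" if "b \<in> B" for b
      using B(2) that by (auto simp: eigenspace_def neg_generator_iff)
    have "y \<in> span (weighted ` B)" if y: "(y, l *\<^sub>R y) \<in> F.A" for y
    proof -
      have "unweighted y \<in> eigenspace (neg_generator w) l"
        using y by (simp add: eigenspace_def neg_generator_iff unweighted l2_scale weighted_scale)
      from span[OF this] obtain c where c: "AE x in mu w. unweighted y x = (\<Sum>b\<in>B. c b * b x)" by blast
      have "weighted (unweighted y) = weighted (\<lambda>x. \<Sum>b\<in>B. c b * b x)"
      proof (subst weighted_eq_iff)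
        show "(\<lambda>x. \<Sum>b\<in>B. c b * b x) \<in> l2 (mu w)" by (rule l2_sum) (rule l2_scale[OF Bl2])
      qed (rule unweighted, rule c)
      also have "\<dots> = (\<Sum>b\<in>B. weighted (\<lambda>x. c b * b x))"
        by (intro weighted_sum l2_scale Bl2)
      also have "\<dots> = (\<Sum>b\<in>B. c b *\<^sub>R weighted b)"
        by (intro sum.cong refl weighted_scale Bl2)
      finally have "y = (\<Sum>b\<in>B. c b *\<^sub>R weighted b)" unfolding unweighted .
      then show ?thesis by (simp only:) (intro span_sum span_scale span_base imageI)
    qed
    then have "\<exists>B. finite B \<and> (\<forall>u. (u, l *\<^sub>R u) \<in> F.A \<longrightarrow> u \<in> span B)"
      using B(1) by (intro exI[of _ "weighted ` B"]) auto
    ultimately have "F.discrete_at l" unfolding F.discrete_at_def using \<delta>(1) by blast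
    with l show False by simp
  qed
  then show ?thesis using l(1) S unfolding essential_spectrum_def by auto
qed

text \<open>The essential spectrum meets \<open>[0,\<epsilon>]\<close> for all \<open>\<epsilon> > 0\<close>, and the spectrum is nonnegative.\<close>

lemma lambda_ess_eq_0:
  assumes low: "\<And>\<eta>. 0 < \<eta> \<Longrightarrow> \<exists>u k. F.low_energy \<eta> u k"
  shows "lambda_ess w = 0"
proof (rule antisym)
  show "lambda_ess w \<le> 0"
  proof (rule ereal_le_epsilon2)
    fix \<epsilon> :: real assume \<epsilon>: "0 < \<epsilon>"
    obtain u k where "F.low_energy (\<epsilon> / 2) u k" using low[of "\<epsilon> / 2"] \<epsilon> by auto
    from F.low_energy_spectrum[OF this, of \<epsilon>] \<epsilon>
    obtain l where l: "0 \<le> l" "l \<le> \<epsilon>" "l \<notin> F.rset" "\<not> F.discrete_at l" by auto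
    have "lambda_ess w \<le> ereal l"
      unfolding lambda_ess_def by (intro Inf_lower imageI essential_spectrumI l)
    also have "\<dots> \<le> 0 + ereal \<epsilon>" using l by simp
    finally show "lambda_ess w \<le> 0 + ereal \<epsilon>" .
  qed
  show "0 \<le> lambda_ess w"
    unfolding lambda_ess_def
  proof (rule Inf_greatest, clarify)
    fix l assume "l \<in> essential_spectrum (mu w) (neg_generator w)"
    then have "l \<notin> F.rset" by (auto simp: essential_spectrum_def l2_spectrum_def resolvent_set_eq)
    then show "0 \<le> ereal l" using F.negative_in_rset[of l] by (cases "l < 0") auto
  qed
qed

lemma tendsto_scaled_difference_iff:
  assumes Tu: "\<And>t. 0 < t \<Longrightarrow> Tu t \<in> l2 (mu w)" and u: "u \<in> l2 (mu w)" and g: "g \<in> l2 (mu w)"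
  shows "((\<lambda>t. l2_norm (mu w) (\<lambda>x. (Tu t x - u x) / t - g x)) \<longlongrightarrow> 0) (at_right 0) \<longleftrightarrow>
    ((\<lambda>t. (1 / t) *\<^sub>R (weighted (Tu t) - weighted u)) \<longlongrightarrow> weighted g) (at_right 0)"
proof -
  have "l2_norm (mu w) (\<lambda>x. (Tu t x - u x) / t - g x)
      = norm ((1 / t) *\<^sub>R (weighted (Tu t) - weighted u) - weighted g)" if t: "0 < t" for t
  proof -
    have "(\<lambda>x. (Tu t x - u x) / t - g x) = (\<lambda>x. (1 / t) * (Tu t x - u x) - g x)" by simp
    then show ?thesis
      by (simp only: norm_weighted[symmetric] l2_diff l2_scale Tu[OF t] u g weighted_diff weighted_scale)
  qed
  note eq = this
  have "\<forall>\<^sub>F t in at_right 0. l2_norm (mu w) (\<lambda>x. (Tu t x - u x) / t - g x)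
      = norm ((1 / t) *\<^sub>R (weighted (Tu t) - weighted u) - weighted g)"
    using eventually_at_right_less[of "0::real"] by eventually_elim (rule eq)
  then have "((\<lambda>t. l2_norm (mu w) (\<lambda>x. (Tu t x - u x) / t - g x)) \<longlongrightarrow> 0) (at_right 0) \<longleftrightarrow>
      ((\<lambda>t. norm ((1 / t) *\<^sub>R (weighted (Tu t) - weighted u) - weighted g)) \<longlongrightarrow> 0) (at_right 0)"
    by (intro filterlim_cong refl)
  then show ?thesis by (simp add: tendsto_norm_zero_iff LIM_zero_iff)
qed

lemma tendsto_difference_iff:
  fixes Tu :: "real \<Rightarrow> real ^ 'n \<Rightarrow> real"
  assumes Tu: "\<And>t. 0 < t \<Longrightarrow> Tu t \<in> l2 (mu w)" and u: "u \<in> l2 (mu w)"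
  shows "((\<lambda>t. l2_norm (mu w) (\<lambda>x. Tu t x - u x)) \<longlongrightarrow> 0) (at_right 0) \<longleftrightarrow>
    ((\<lambda>t. weighted (Tu t)) \<longlongrightarrow> weighted u) (at_right 0)"
proof -
  have "l2_norm (mu w) (\<lambda>x. Tu t x - u x) = norm (weighted (Tu t) - weighted u)" if t: "0 < t" for t
    by (simp only: norm_weighted[symmetric] l2_diff Tu[OF t] u weighted_diff)
  note eq = this
  have "\<forall>\<^sub>F t in at_right 0. l2_norm (mu w) (\<lambda>x. Tu t x - u x) = norm (weighted (Tu t) - weighted u)"
    using eventually_at_right_less[of "0::real"] by eventually_elim (rule eq)
  then have "((\<lambda>t. l2_norm (mu w) (\<lambda>x. Tu t x - u x)) \<longlongrightarrow> 0) (at_right 0) \<longleftrightarrow>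
      ((\<lambda>t. norm (weighted (Tu t) - weighted u)) \<longlongrightarrow> 0) (at_right 0)"
    by (intro filterlim_cong refl)
  then show ?thesis by (simp add: tendsto_norm_zero_iff LIM_zero_iff)
qed

text \<open>Existence guarantees that \<^const>\<open>semigroup_of\<close> really chooses a semigroup with the right generator.\<close>

lemma semigroup_exists:
  "semigroup_generated_by (mu w) (generator w) (\<lambda>t f. unweighted (F.S t (weighted f)))"
  unfolding semigroup_generated_by_def
proof (intro conjI allI impI ballI)
  fix t :: real and f assume t: "0 < t" and f: "f \<in> l2 (mu w)"
  show "unweighted (F.S t (weighted f)) \<in> l2 (mu w)" by (rule unweighted)
  show "l2_norm (mu w) (unweighted (F.S t (weighted f))) \<le> l2_norm (mu w) f"
    using F.S_norm[OF t, of "weighted f"] by (simp add: norm_weighted[symmetric] unweighted f)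
  fix g a b assume g: "g \<in> l2 (mu w)"
  show "AE x in mu w. unweighted (F.S t (weighted (\<lambda>y. a * f y + b * g y))) x
      = a * unweighted (F.S t (weighted f)) x + b * unweighted (F.S t (weighted g)) x"
    by (subst weighted_eq_iff[symmetric])
       (simp_all add: unweighted l2_add l2_scale f g weighted_add weighted_scale
         linear_add[OF F.S_linear[OF t]] linear_scale[OF F.S_linear[OF t]])
next
  fix s t :: real and f assume st: "0 < s" "0 < t" and f: "f \<in> l2 (mu w)"
  have "F.S (s + t) (weighted f) = F.S s (F.S t (weighted f))"
    using F.contraction_semigroup_S st unfolding contraction_semigroup_def by blast
  then show "AE x in mu w. unweighted (F.S (s + t) (weighted f)) x
      = unweighted (F.S s (weighted (unweighted (F.S t (weighted f))))) x"
    by (simp add: unweighted)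
next
  fix f assume f: "f \<in> l2 (mu w)"
  show "((\<lambda>t. l2_norm (mu w) (\<lambda>x. unweighted (F.S t (weighted f)) x - f x)) \<longlongrightarrow> 0) (at_right 0)"
    by (subst tendsto_difference_iff) (simp_all add: unweighted f F.S_strongly_continuous)
next
  fix u g assume u: "u \<in> l2 (mu w)" and g: "g \<in> l2 (mu w)"
  show "(u, g) \<in> generator w \<longleftrightarrow>
      ((\<lambda>t. l2_norm (mu w) (\<lambda>x. (unweighted (F.S t (weighted u)) x - u x) / t - g x)) \<longlongrightarrow> 0) (at_right 0)"
    by (subst tendsto_scaled_difference_iff)
       (simp_all add: unweighted u g generator_iff F.S_generator)
qed

text \<open>The chosen semigroup acts on functions and is well defined only up to null sets. Transporting it to the Hilbert
  space gives a contraction semigroup with the same generator, to which the abstract criterion applies.\<close>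

lemma noncompactI:
  assumes low: "F.low_energy \<eta> u k" and \<eta>: "0 \<le> \<eta>"
  shows "noncompact_semigroup w"
proof -
  define T where "T = semigroup_of w"
  have gen: "semigroup_generated_by (mu w) (generator w) T"
    unfolding T_def semigroup_of_def
    by (rule someI[of "semigroup_generated_by (mu w) (generator w)", OF semigroup_exists])
  have gen_limit: "\<forall>u \<in> l2 (mu w). \<forall>g \<in> l2 (mu w). (u, g) \<in> generator w \<longleftrightarrow>
        ((\<lambda>t. l2_norm (mu w) (\<lambda>x. (T t u x - u x) / t - g x)) \<longlongrightarrow> 0) (at_right 0)"
    using gen unfolding semigroup_generated_by_def by (elim conjE)
  have Tl2: "T t f \<in> l2 (mu w)" if "0 < t" "f \<in> l2 (mu w)" for t f
    using gen that unfolding semigroup_generated_by_def by blast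
  have Tlin0: "weighted (T t (\<lambda>y. a * f y + b * g y)) = a *\<^sub>R weighted (T t f) + b *\<^sub>R weighted (T t g)"
    if t: "0 < t" and f: "f \<in> l2 (mu w)" and g: "g \<in> l2 (mu w)" for t f g a b
  proof -
    have "AE x in mu w. T t (\<lambda>y. a * f y + b * g y) x = a * T t f x + b * T t g x"
      using gen t f g unfolding semigroup_generated_by_def by blast
    then have "weighted (T t (\<lambda>y. a * f y + b * g y)) = weighted (\<lambda>x. a * T t f x + b * T t g x)"
      by (subst weighted_eq_iff) (auto intro!: Tl2 l2_add l2_scale t f g)
    then show ?thesis by (simp add: weighted_add weighted_scale l2_scale Tl2 t f g)
  qed
  have Tnorm: "norm (weighted (T t f)) \<le> norm (weighted f)" if t: "0 < t" and f: "f \<in> l2 (mu w)" for t f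
  proof -
    have "l2_norm (mu w) (T t f) \<le> l2_norm (mu w) f"
      using gen t f unfolding semigroup_generated_by_def by blast
    then show ?thesis by (simp add: norm_weighted Tl2 t f)
  qed
  have Tcong: "weighted (T t f) = weighted (T t g)"
    if t: "0 < t" and f: "f \<in> l2 (mu w)" and g: "g \<in> l2 (mu w)" and fg: "weighted f = weighted g" for t f g
  proof -
    have fg2: "(\<lambda>y. 1 * f y + (-1) * g y) \<in> l2 (mu w)" by (intro l2_add l2_scale f g)
    have "weighted (\<lambda>y. 1 * f y + (-1) * g y) = 0"
      using weighted_diff[OF f g] fg by simp
    then have "weighted (T t (\<lambda>y. 1 * f y + (-1) * g y)) = 0" using Tnorm[OF t fg2] by simp
    then show ?thesis unfolding Tlin0[OF t f g] by simp
  qed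
  define T' where "T' t y = weighted (T t (unweighted y))" for t y
  have T'eq: "T' t (weighted f) = weighted (T t f)" if "0 < t" "f \<in> l2 (mu w)" for t f
    unfolding T'_def using that by (intro Tcong) (simp_all add: unweighted)
  have "contraction_semigroup F.A T'"
    unfolding contraction_semigroup_def
  proof (intro conjI allI impI)
    fix t :: real assume t: "0 < t"
    have lin: "T' t (a *\<^sub>R x + b *\<^sub>R y) = a *\<^sub>R T' t x + b *\<^sub>R T' t y" for a b x y
    proof -
      have "a *\<^sub>R x + b *\<^sub>R y = weighted (\<lambda>s. a * unweighted x s + b * unweighted y s)"
        by (simp add: weighted_add weighted_scale l2_scale unweighted)
      then have "T' t (a *\<^sub>R x + b *\<^sub>R y) = weighted (T t (\<lambda>s. a * unweighted x s + b * unweighted y s))"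
        by (simp only:) (intro T'eq t l2_add l2_scale unweighted)
      then show ?thesis by (simp add: Tlin0 t unweighted T'_def)
    qed
    show "linear (T' t)"
      using lin[of 1 _ 1] lin[of _ _ 0] by (intro linearI) simp_all
    show "norm (T' t f) \<le> norm f" for f
      using Tnorm[OF t unweighted(1)[of f]] by (simp add: T'_def unweighted)
  next
    fix s t :: real and f assume st: "0 < s" "0 < t"
    have "AE x in mu w. T (s + t) (unweighted f) x = T s (T t (unweighted f)) x"
      using gen st unweighted(1)[of f] unfolding semigroup_generated_by_def by blast
    then have "weighted (T (s + t) (unweighted f)) = weighted (T s (T t (unweighted f)))"
      using st by (subst weighted_eq_iff) (auto intro!: Tl2 unweighted)
    then show "T' (s + t) f = T' s (T' t f)"
      using T'eq[OF st(1) Tl2[OF st(2) unweighted(1)[of f]]] by (simp add: T'_def)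
  next
    fix f
    have "((\<lambda>t. l2_norm (mu w) (\<lambda>x. T t (unweighted f) x - unweighted f x)) \<longlongrightarrow> 0) (at_right 0)"
      using gen unweighted(1)[of f] unfolding semigroup_generated_by_def by blast
    then show "((\<lambda>t. T' t f) \<longlongrightarrow> f) (at_right 0)"
      by (subst (asm) tendsto_difference_iff) (simp_all add: Tl2 unweighted T'_def)
  next
    fix x g
    have "(x, g) \<in> F.A \<longleftrightarrow> (unweighted x, \<lambda>t. - unweighted g t) \<in> generator w"
      by (simp add: generator_iff unweighted l2_uminus weighted_uminus)
    also have "\<dots> \<longleftrightarrow> ((\<lambda>t. l2_norm (mu w) (\<lambda>s. (T t (unweighted x) s - unweighted x s) / t - (- unweighted g s))) \<longlongrightarrow> 0) (at_right 0)"
      by (rule gen_limit[rule_format, OF unweighted(1) l2_uminus[OF unweighted(1)]])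
    also have "\<dots> \<longleftrightarrow> ((\<lambda>t. (1 / t) *\<^sub>R (T' t x - x)) \<longlongrightarrow> - g) (at_right 0)"
      by (subst tendsto_scaled_difference_iff) (simp_all add: Tl2 unweighted T'_def l2_uminus weighted_uminus)
    finally show "(x, g) \<in> F.A \<longleftrightarrow> ((\<lambda>t. (1 / t) *\<^sub>R (T' t x - x)) \<longlongrightarrow> - g) (at_right 0)" .
  qed
  from F.low_energy_noncompact[OF this low \<eta>]
  obtain t x where t: "t > 0" and x: "\<And>n::nat. norm (x n) \<le> 1"
    and non: "\<not> (\<exists>r g. strict_mono (r :: nat \<Rightarrow> nat) \<and> (\<lambda>n. T' t (x (r n))) \<longlonglongrightarrow> g)"
    by blast
  have "\<not> compact_operator (mu w) (T t)"
  proof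
    assume C: "compact_operator (mu w) (T t)"
    have b: "(\<forall>n. unweighted (x n) \<in> l2 (mu w)) \<and> (\<exists>C. \<forall>n. l2_norm (mu w) (unweighted (x n)) \<le> C)"
      using x by (auto simp: unweighted norm_weighted[symmetric] intro!: exI[of _ 1])
    obtain r g where rg: "strict_mono (r :: nat \<Rightarrow> nat)" "g \<in> l2 (mu w)"
      "(\<lambda>n. l2_norm (mu w) (\<lambda>s. T t (unweighted (x (r n))) s - g s)) \<longlonglongrightarrow> 0"
      using C[unfolded compact_operator_def, rule_format, OF b] by blast
    have "l2_norm (mu w) (\<lambda>s. T t (unweighted (x (r n))) s - g s) = norm (T' t (x (r n)) - weighted g)" for n
      by (simp add: norm_weighted[symmetric] T'_def weighted_diff Tl2 t unweighted rg(2) l2_diff)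
    with rg(3) have "(\<lambda>n. T' t (x (r n))) \<longlonglongrightarrow> weighted g"
      by (simp add: tendsto_norm_zero_iff LIM_zero_iff)
    with non rg(1) show False by blast
  qed
  then show ?thesis using t unfolding noncompact_semigroup_def compact_semigroup_def T_def by blast
qed

text \<open>A zero of a nonnegative function is a minimum. So disjoint supports of nonnegative functions make the gradients
  orthogonal pointwise.\<close>

lemma grad_zero_at_zero:
  assumes "u differentiable (at x)" "\<And>y. 0 \<le> u y" "u x = 0"
  shows "grad u x = (0 :: real ^ 'n)"
proof -
  have "grad u x $ i = 0" for i
  proof -
    have "((\<lambda>s. u (x + s *\<^sub>R axis i 1)) has_real_derivative grad u (x + 0 *\<^sub>R axis i 1) $ i) (at 0)"
      using assms(1) by (intro grad_line) simp
    then have "grad u (x + 0 *\<^sub>R axis i 1) $ i = 0"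
      by (rule DERIV_local_min[where d = 1]) (use assms in auto)
    then show ?thesis by simp
  qed
  then show ?thesis by (simp add: vec_eq_iff)
qed

lemma low_energy_of_test_functions:
  fixes \<psi> :: "nat \<Rightarrow> real ^ 'n \<Rightarrow> real"
  assumes t: "\<And>n. \<psi> n \<in> test_functions" and pos: "\<And>n x. 0 \<le> \<psi> n x"
    and disj: "\<And>i j x. i \<noteq> j \<Longrightarrow> \<psi> i x = 0 \<or> \<psi> j x = 0"
    and norm: "\<And>n. 0 < l2_inner (mu w) (\<psi> n) (\<psi> n)"
    and energy: "\<And>n. pre_form w (\<psi> n) (\<psi> n) \<le> \<eta> * l2_inner (mu w) (\<psi> n) (\<psi> n)"
  shows "\<exists>u k. F.low_energy \<eta> u k"
proof -
  define a where "a n = 1 / norm (weighted (\<psi> n))" for n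
  have nsq: "l2_inner (mu w) (\<psi> n) (\<psi> n) = (norm (weighted (\<psi> n)))\<^sup>2" for n
    by (simp add: power2_norm_eq_inner inner_weighted test_function_l2 t)
  have npos: "0 < norm (weighted (\<psi> n))" for n using norm[of n] nsq[of n] by auto
  have o1: "inner (weighted (\<psi> i)) (weighted (\<psi> j)) = 0" if "i \<noteq> j" for i j
  proof -
    have "(\<lambda>x. \<psi> i x * \<psi> j x) = (\<lambda>_. 0)" using disj[OF that] by auto
    then show ?thesis by (simp add: inner_weighted test_function_l2 t l2_inner_def)
  qed
  have o2: "inner (wgrad (\<psi> i)) (wgrad (\<psi> j)) = 0" if ij: "i \<noteq> j" for i j
  proof -
    have "grad (\<psi> i) x \<bullet> grad (\<psi> j) x = 0" for x
      using disj[OF ij, of x] grad_zero_at_zero[OF test_function_differentiable[OF t] pos] by force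
    then show ?thesis by (simp add: pre_form_eq[symmetric] t pre_form_def)
  qed
  have "F.low_energy \<eta> (\<lambda>n. a n *\<^sub>R weighted (\<psi> n)) (\<lambda>n. a n *\<^sub>R wgrad (\<psi> n))"
    unfolding F.low_energy_def
  proof (intro conjI allI impI)
    fix n
    show "(a n *\<^sub>R weighted (\<psi> n), a n *\<^sub>R wgrad (\<psi> n)) \<in> graph"
      by (intro F.Gam_scale test_function_graph t)
    show "norm (a n *\<^sub>R weighted (\<psi> n)) = 1" using npos[of n] by (simp add: a_def)
    have "(norm (a n *\<^sub>R wgrad (\<psi> n)))\<^sup>2 = pre_form w (\<psi> n) (\<psi> n) / (norm (weighted (\<psi> n)))\<^sup>2"
      by (simp add: a_def pre_form_eq t power2_norm_eq_inner[symmetric] power_divide)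
    also have "\<dots> \<le> \<eta>" using energy[of n] npos[of n] by (simp add: nsq divide_le_eq)
    finally show "(norm (a n *\<^sub>R wgrad (\<psi> n)))\<^sup>2 \<le> \<eta>" .
  qed (use o1 o2 in auto)
  then show ?thesis by blast
qed

end

section \<open>Test functions on the cells of a grid\<close>

definition cell :: "real \<Rightarrow> int ^ 'n \<Rightarrow> (real ^ 'n) set" where
  "cell L k = {x. \<forall>i. L * k $ i \<le> x $ i \<and> x $ i < L * (real_of_int (k $ i) + 1)}"

definition cell_mass :: "(real ^ 'n \<Rightarrow> real) \<Rightarrow> real \<Rightarrow> int ^ 'n \<Rightarrow> real" where
  "cell_mass v L k = (LINT x:cell L k|lborel. exp (- v x))"

lemma finite_int_vectors: "finite {k :: int ^ 'n. \<forall>i. \<bar>k $ i\<bar> \<le> m}"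
  and card_int_vectors: "0 \<le> m \<Longrightarrow> card {k :: int ^ 'n. \<forall>i. \<bar>k $ i\<bar> \<le> m} \<le> nat (2 * m + 1) ^ CARD('n)"
proof -
  let ?P = "PiE (UNIV :: 'n set) (\<lambda>_. {-m..m})"
  have sub: "{k :: int ^ 'n. \<forall>i. \<bar>k $ i\<bar> \<le> m} \<subseteq> vec_lambda ` ?P"
  proof
    fix k :: "int ^ 'n" assume "k \<in> {k. \<forall>i. \<bar>k $ i\<bar> \<le> m}"
    then have "(\<lambda>i. k $ i) \<in> ?P" by (auto simp: abs_le_iff) (smt (verit))
    moreover have "k = vec_lambda (\<lambda>i. k $ i)" by simp
    ultimately show "k \<in> vec_lambda ` ?P" by blast
  qed
  have fin: "finite ?P" by (intro finite_PiE) auto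
  show "finite {k :: int ^ 'n. \<forall>i. \<bar>k $ i\<bar> \<le> m}"
    by (rule finite_subset[OF sub]) (use fin in auto)
  assume "0 \<le> m"
  have "card {k :: int ^ 'n. \<forall>i. \<bar>k $ i\<bar> \<le> m} \<le> card (vec_lambda ` ?P)"
    by (rule card_mono[OF _ sub]) (use fin in auto)
  also have "\<dots> \<le> card ?P" by (rule card_image_le[OF fin])
  also have "\<dots> = nat (2 * m + 1) ^ CARD('n)"
    by (subst card_PiE) auto
  finally show "card {k :: int ^ 'n. \<forall>i. \<bar>k $ i\<bar> \<le> m} \<le> nat (2 * m + 1) ^ CARD('n)" .
qed

lemma cell_subset_cbox: "cell L k \<subseteq> cbox (\<chi> i. L * k $ i) (\<chi> i. L * (real_of_int (k $ i) + 1))"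
  by (auto simp: cell_def mem_box_cart less_imp_le)

lemma cell_measurable [measurable]: "cell L k \<in> sets borel"
  unfolding cell_def by measurable

lemma emeasure_cell:
  fixes k :: "int ^ 'n"
  assumes L: "0 < L"
  shows "emeasure lborel (cell L k) = ennreal (L ^ CARD('n))"
proof -
  let ?a = "\<chi> i. L * k $ i :: real ^ 'n" and ?b = "\<chi> i. L * (real_of_int (k $ i) + 1) :: real ^ 'n"
  have prod: "(\<Prod>e\<in>Basis. (?b - ?a) \<bullet> e) = L ^ CARD('n)"
  proof -
    have "(?b - ?a) \<bullet> e = L" if "e \<in> Basis" for e
      using that by (auto simp: Basis_vec_def inner_axis algebra_simps)
    then show ?thesis by (simp add: prod_constant)
  qed
  have le: "\<And>e. e \<in> Basis \<Longrightarrow> ?a \<bullet> e \<le> ?b \<bullet> e"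
    using L by (auto simp: Basis_vec_def inner_axis)
  have "emeasure lborel (cell L k) \<le> emeasure lborel (cbox ?a ?b)"
    by (intro emeasure_mono cell_subset_cbox) auto
  moreover have "emeasure lborel (box ?a ?b) \<le> emeasure lborel (cell L k)"
  proof (rule emeasure_mono)
    show "box ?a ?b \<subseteq> cell L k" by (auto simp: cell_def mem_box_cart less_imp_le)
  qed (simp add: cell_measurable)
  ultimately show ?thesis
    using le prod by (simp add: emeasure_lborel_cbox emeasure_lborel_box)
qed

lemma cell_integrable:
  assumes "continuous_on UNIV f"
  shows "set_integrable lborel (cell L k) (f :: real ^ 'n \<Rightarrow> real)"
proof (rule set_integrable_subset)
  show "set_integrable lborel (cbox (\<chi> i. L * k $ i) (\<chi> i. L * (real_of_int (k $ i) + 1))) f"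
    unfolding set_integrable_def
    by (rule borel_integrable_compact) (auto intro: continuous_on_subset[OF assms])
qed (use cell_subset_cbox in \<open>auto simp: cell_measurable\<close>)

lemma cell_integral_const:
  fixes k :: "int ^ 'n"
  shows "0 < L \<Longrightarrow> (LINT x:cell L k|lborel. c) = c * L ^ CARD('n)"
  using emeasure_cell[of L k]
  by (simp add: set_lebesgue_integral_def measure_def)

lemma exists_cell:
  assumes L: "0 < L"
  shows "\<exists>k. x \<in> cell L k"
proof
  have "L * of_int \<lfloor>x $ i / L\<rfloor> \<le> x $ i \<and> x $ i < L * (of_int \<lfloor>x $ i / L\<rfloor> + 1)" for i
  using floor_divide_lower[OF L, of "x $ i"] floor_divide_upper[OF L, of "x $ i"]
    by (simp add: mult.commute)
  then show "x \<in> cell L (\<chi> i. \<lfloor>x $ i / L\<rfloor>)" by (simp add: cell_def)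
qed

text \<open>Supported in the cell and its neighbours, with transitions on the scale of the side \<open>L\<close>.\<close>

definition cell_bump :: "real \<Rightarrow> int ^ 'n \<Rightarrow> real ^ 'n \<Rightarrow> real" where
  "cell_bump L k = bump L (\<chi> i. L * (real_of_int (k $ i) - 1)) (\<chi> i. L * (real_of_int (k $ i) + 2))"

lemma cell_bump_support:
  "cell_bump L k x \<noteq> 0 \<Longrightarrow> L * (real_of_int (k $ i) - 1) < x $ i \<and> x $ i < L * (real_of_int (k $ i) + 2)"
  using bump_eq_0[of x "\<chi> i. L * (real_of_int (k $ i) - 1)" "\<chi> i. L * (real_of_int (k $ i) + 2)" L]
  unfolding cell_bump_def by (force simp: mem_box_cart)

lemma cell_bump_lower:
  fixes k :: "int ^ 'n"
  assumes L: "0 < L" and x: "x \<in> cell L k"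
  shows "exp (- 2 * real CARD('n)) \<le> cell_bump L k x"
proof -
  have f: "exp (- 1) \<le> flat_exp 1 L s" if "L \<le> s" for s
    using that L by (simp add: flat_exp_def)
  have "exp (- 2) \<le> bump1 L (L * (real_of_int (k $ i) - 1)) (L * (real_of_int (k $ i) + 2)) (x $ i)" for i
  proof -
    have "L \<le> x $ i - L * (real_of_int (k $ i) - 1)" "L \<le> L * (real_of_int (k $ i) + 2) - x $ i"
      using x[unfolded cell_def] by (auto simp: algebra_simps less_imp_le)
    from mult_mono[OF f[OF this(1)] f[OF this(2)]] show ?thesis
      by (simp add: bump1_def exp_add[symmetric] flat_exp_range L)
  qed
  then have "(\<Prod>i\<in>(UNIV :: 'n set). exp (- 2)) \<le> cell_bump L k x"
    unfolding cell_bump_def bump_def by (intro prod_mono) auto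
  moreover have "(\<Prod>i\<in>(UNIV :: 'n set). exp (- 2 :: real)) = exp (- 2 * real CARD('n))"
    by (simp add: exp_of_nat_mult[symmetric] mult.commute)
  ultimately show ?thesis by simp
qed

lemma flat_exp_deriv_bound:
  assumes L: "0 < L"
  shows "0 \<le> flat_exp (flat_exp_deriv 1 L) L s" "flat_exp (flat_exp_deriv 1 L) L s \<le> 2 / L"
proof -
  have "flat_exp (flat_exp_deriv 1 L) L s = (if s > 0 then (1 / L) * ((L / s)\<^sup>2 * exp (- (L / s))) else 0)"
    using L by (simp add: flat_exp_def flat_exp_deriv_def power2_eq_square)
  moreover have "(L / s)\<^sup>2 * exp (- (L / s)) \<le> 2" if "s > 0"
  proof -
    define z where "z = L / s"
    have z: "0 \<le> z" using that L by (simp add: z_def)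
    have "z\<^sup>2 \<le> 2 * exp z" using exp_lower_Taylor_quadratic[OF z] z by simp
    then show ?thesis unfolding z_def[symmetric] by (simp add: exp_minus field_simps)
  qed
  ultimately show "0 \<le> flat_exp (flat_exp_deriv 1 L) L s" "flat_exp (flat_exp_deriv 1 L) L s \<le> 2 / L"
    using L by (auto intro: divide_right_mono)
qed

lemma bump1_has_derivative:
  assumes L: "0 < L"
  shows "\<exists>D. (bump1 L a b has_real_derivative D) (at t) \<and> \<bar>D\<bar> \<le> 2 / L"
proof -
  let ?f = "flat_exp 1 L" and ?g = "flat_exp (flat_exp_deriv 1 L) L"
  have "((\<lambda>t. ?f (t - a)) has_real_derivative ?g (t - a) * 1) (at t)"
    by (rule DERIV_chain2[OF flat_exp_has_derivative[OF L]]) (auto intro!: derivative_eq_intros)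
  then have d1: "((\<lambda>t. ?f (t - a)) has_real_derivative ?g (t - a)) (at t)" by simp
  have d2: "((\<lambda>t. ?f (b - t)) has_real_derivative ?g (b - t) * (- 1)) (at t)"
    by (rule DERIV_chain2[OF flat_exp_has_derivative[OF L]]) (auto intro!: derivative_eq_intros)
  have "(bump1 L a b has_real_derivative ?g (t - a) * ?f (b - t) + ?g (b - t) * (- 1) * ?f (t - a)) (at t)"
    unfolding bump1_def[abs_def] by (rule DERIV_mult[OF d1 d2])
  moreover have "\<bar>?g (t - a) * ?f (b - t) + ?g (b - t) * (- 1) * ?f (t - a)\<bar> \<le> 2 / L"
  proof -
    have b: "0 \<le> ?g s * ?f r \<and> ?g s * ?f r \<le> 2 / L" for s r
    proof -
      have "?g s * ?f r \<le> (2 / L) * 1"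
        using flat_exp_deriv_bound[OF L] flat_exp_range[OF L] L by (intro mult_mono) auto
      then show ?thesis using flat_exp_deriv_bound[OF L] flat_exp_range[OF L] by simp
    qed
    have "?g (b - t) * (- 1) * ?f (t - a) = - (?g (b - t) * ?f (t - a))" by simp
    moreover note conjunct1[OF b[of "t - a" "b - t"]] conjunct2[OF b[of "t - a" "b - t"]]
      conjunct1[OF b[of "b - t" "t - a"]] conjunct2[OF b[of "b - t" "t - a"]]
    ultimately show ?thesis by linarith
  qed
  ultimately show ?thesis by blast
qed

lemma grad_bump_bound:
  assumes L: "0 < L"
  shows "\<bar>grad (bump L a b) x $ i\<bar> \<le> 2 / L"
proof -
  define c where "c = (\<Prod>j\<in>UNIV - {i}. bump1 L (a $ j) (b $ j) (x $ j))"
  have c: "0 \<le> c" "c \<le> 1"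
    unfolding c_def using bump1_range[OF L] by (auto intro: prod_nonneg prod_le_1)
  have split: "bump L a b (x + s *\<^sub>R axis i 1) = bump1 L (a $ i) (b $ i) (x $ i + s) * c" for s
  proof -
    have "bump L a b (x + s *\<^sub>R axis i 1)
        = bump1 L (a $ i) (b $ i) ((x + s *\<^sub>R axis i 1) $ i)
          * (\<Prod>j\<in>UNIV - {i}. bump1 L (a $ j) (b $ j) ((x + s *\<^sub>R axis i 1) $ j))"
      unfolding bump_def by (rule prod.remove) auto
    also have "(\<Prod>j\<in>UNIV - {i}. bump1 L (a $ j) (b $ j) ((x + s *\<^sub>R axis i 1) $ j)) = c"
      unfolding c_def by (intro prod.cong refl) (auto simp: axis_def)
    finally show ?thesis by simp
  qed
  obtain D where D: "(bump1 L (a $ i) (b $ i) has_real_derivative D) (at (x $ i + 0))" "\<bar>D\<bar> \<le> 2 / L"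
    using bump1_has_derivative[OF L] by blast
  have "((\<lambda>s. x $ i + s) has_real_derivative 1) (at 0)" by (auto intro!: derivative_eq_intros)
  from DERIV_cmult_right[OF DERIV_chain2[OF D(1) this], of c]
  have "((\<lambda>s. bump L a b (x + s *\<^sub>R axis i 1)) has_real_derivative D * c) (at 0)"
    by (simp add: split)
  moreover have "((\<lambda>s. bump L a b (x + s *\<^sub>R axis i 1)) has_real_derivative grad (bump L a b) (x + 0 *\<^sub>R axis i 1) $ i) (at 0)"
    by (rule grad_line[OF test_function_differentiable[OF bump_test_function[OF L]]])
  ultimately have "grad (bump L a b) x $ i = D * c" using DERIV_unique by fastforce
  then have "\<bar>grad (bump L a b) x $ i\<bar> = \<bar>D\<bar> * c" using c by (simp add: abs_mult)
  also have "\<dots> \<le> (2 / L) * 1" using D(2) c L by (intro mult_mono) auto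
  finally show ?thesis by simp
qed

context potential
begin

lemma exp_cell_integrable: "set_integrable lborel (cell L k) (\<lambda>x. exp (- w x))"
  by (intro cell_integrable continuous_intros continuous_w)

lemma cell_bump_test: "0 < L \<Longrightarrow> cell_bump L k \<in> test_functions"
  unfolding cell_bump_def by (rule bump_test_function)

lemma cell_bump_norm:
  fixes k :: "int ^ 'n"
  assumes L: "0 < L"
  shows "exp (- 4 * real CARD('n)) * cell_mass w L k \<le> l2_inner (mu w) (cell_bump L k) (cell_bump L k)"
proof -
  note t = cell_bump_test[OF L, of k]
  have m: "cell_bump L k \<in> borel_measurable borel"
    by (rule borel_measurable_continuous_onI[OF test_function_continuous[OF t]])
  have "exp (- 4 * real CARD('n)) * cell_mass w L k
      = (LINT x|lborel. exp (- 4 * real CARD('n)) * (indicator (cell L k) x *\<^sub>R exp (- w x)))"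
    by (simp add: cell_mass_def set_lebesgue_integral_def)
  also have "\<dots> \<le> (LINT x|lborel. cell_bump L k x * cell_bump L k x * exp (- w x))"
  proof (rule integral_mono)
    show "integrable lborel (\<lambda>x. exp (- 4 * real CARD('n)) * (indicator (cell L k) x *\<^sub>R exp (- w x)))"
      using exp_cell_integrable[of L k] by (simp add: set_integrable_def)
    have "integrable lborel (\<lambda>x. cell_bump L k x * (cell_bump L k x * exp (- w x)))"
      by (intro test_function_product_integrable(1)[OF t] continuous_intros continuous_w test_function_continuous[OF t])
    then show "integrable lborel (\<lambda>x. cell_bump L k x * cell_bump L k x * exp (- w x))" by (simp add: mult.assoc)
    fix x
    show "exp (- 4 * real CARD('n)) * (indicator (cell L k) x *\<^sub>R exp (- w x))
        \<le> cell_bump L k x * cell_bump L k x * exp (- w x)"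
    proof (cases "x \<in> cell L k")
      case True
      have "exp (- 2 * real CARD('n)) * exp (- 2 * real CARD('n)) \<le> cell_bump L k x * cell_bump L k x"
        using cell_bump_lower[OF L True] by (intro mult_mono) (auto intro: order_trans[OF less_imp_le[OF exp_gt_zero]])
      moreover have "exp (- 2 * real CARD('n)) * exp (- 2 * real CARD('n)) = exp (- 4 * real CARD('n))"
        by (simp add: exp_add[symmetric])
      ultimately show ?thesis using True by (simp add: mult_right_mono)
    qed simp
  qed
  also have "\<dots> = l2_inner (mu w) (cell_bump L k) (cell_bump L k)"
    by (rule l2_inner_mu[OF m m, symmetric])
  finally show ?thesis .
qed

definition neighbours :: "(int ^ 'n) set" where
  "neighbours = {j. \<forall>i. \<bar>j $ i\<bar> \<le> 1}"

lemma finite_neighbours: "finite neighbours"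
  unfolding neighbours_def by (rule finite_int_vectors)

lemma cell_bump_support_neighbours:
  assumes L: "0 < L" and x: "cell_bump L k x \<noteq> 0"
  shows "\<exists>j\<in>neighbours. x \<in> cell L (k + j)"
proof -
  obtain m where m: "x \<in> cell L m" using exists_cell[OF L] by blast
  have "\<bar>m $ i - k $ i\<bar> \<le> 1" for i
  proof -
    have 1: "L * m $ i \<le> x $ i" "x $ i < L * (real_of_int (m $ i) + 1)" using m by (auto simp: cell_def)
    have 2: "L * (real_of_int (k $ i) - 1) < x $ i" "x $ i < L * (real_of_int (k $ i) + 2)" using cell_bump_support[OF x] by auto
    have "L * m $ i < L * (real_of_int (k $ i) + 2)" "L * (real_of_int (k $ i) - 1) < L * (real_of_int (m $ i) + 1)" using 1 2 by linarith+
    then have "real_of_int (m $ i) < real_of_int (k $ i) + 2" "real_of_int (k $ i) - 1 < real_of_int (m $ i) + 1"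
      using L by simp_all
    then show ?thesis by linarith
  qed
  then have "m - k \<in> neighbours" by (simp add: neighbours_def)
  then show ?thesis using m by (intro bexI[of _ "m - k"]) auto
qed

text \<open>The gradient is of order \<open>1/L\<close> and vanishes off the cell and its neighbours.\<close>

lemma cell_bump_energy:
  fixes k :: "int ^ 'n"
  assumes L: "0 < L"
  shows "pre_form w (cell_bump L k) (cell_bump L k)
    \<le> (2 * real CARD('n) / L\<^sup>2) * (\<Sum>j\<in>neighbours. cell_mass w L (k + j))"
proof -
  note t = cell_bump_test[OF L, of k]
  let ?g = "grad (cell_bump L k)"
  have bound: "(?g x \<bullet> ?g x) * exp (- w x)
      \<le> (4 * real CARD('n) / L\<^sup>2) * (\<Sum>j\<in>neighbours. indicator (cell L (k + j)) x *\<^sub>R exp (- w x))" for x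
  proof (cases "cell_bump L k x = 0")
    case True
    have "?g x = 0"
      by (rule grad_zero_at_zero[OF test_function_differentiable[OF t] _ True])
         (simp add: cell_bump_def bump_range L)
    then show ?thesis by (simp add: sum_nonneg)
  next
    case False
    then obtain j where j: "j \<in> neighbours" "x \<in> cell L (k + j)" using cell_bump_support_neighbours[OF L] by blast
    have "?g x \<bullet> ?g x = (\<Sum>i\<in>UNIV. (?g x $ i)\<^sup>2)" by (simp add: inner_vec_def power2_eq_square)
    also have "\<dots> \<le> (\<Sum>i\<in>(UNIV :: 'n set). (2 / L)\<^sup>2)"
      using grad_bump_bound[OF L] unfolding cell_bump_def
      by (intro sum_mono power2_le_iff_abs_le[THEN iffD2]) (use L in auto)
    also have "\<dots> = 4 * real CARD('n) / L\<^sup>2" by (simp add: power_divide)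
    finally have "(?g x \<bullet> ?g x) * exp (- w x) \<le> (4 * real CARD('n) / L\<^sup>2) * exp (- w x)"
      by (intro mult_right_mono) auto
    also have "\<dots> \<le> (4 * real CARD('n) / L\<^sup>2) * (\<Sum>j\<in>neighbours. indicator (cell L (k + j)) x *\<^sub>R exp (- w x))"
    proof (rule mult_left_mono)
      have "exp (- w x) = indicator (cell L (k + j)) x *\<^sub>R exp (- w x)" using j by simp
      also have "\<dots> \<le> (\<Sum>j\<in>neighbours. indicator (cell L (k + j)) x *\<^sub>R exp (- w x))"
        using j finite_neighbours by (intro member_le_sum) auto
      finally show "exp (- w x) \<le> (\<Sum>j\<in>neighbours. indicator (cell L (k + j)) x *\<^sub>R exp (- w x))" .
    qed simp
    finally show ?thesis .
  qed
  have int: "integrable lborel (\<lambda>x. (4 * real CARD('n) / L\<^sup>2) * (\<Sum>j\<in>neighbours. indicator (cell L (k + j)) x *\<^sub>R exp (- w x)))"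
    using exp_cell_integrable[of L] unfolding set_integrable_def
    by (intro integrable_mult_right Bochner_Integration.integrable_sum) auto
  have "integrable lborel (\<lambda>x. ?g x $ i * (?g x $ i * exp (- w x)))" for i
    by (intro test_function_product_integrable(2)[OF t] continuous_on_mult continuous_intros continuous_w
        test_function_grad_continuous[OF t])
  then have "integrable lborel (\<lambda>x. \<Sum>i\<in>UNIV. ?g x $ i * (?g x $ i * exp (- w x)))"
    by (intro Bochner_Integration.integrable_sum)
  moreover have "(\<Sum>i\<in>UNIV. ?g x $ i * (?g x $ i * exp (- w x))) = (?g x \<bullet> ?g x) * exp (- w x)" for x
    by (simp add: inner_vec_def sum_distrib_right mult.assoc)
  ultimately have int': "integrable lborel (\<lambda>x. (?g x \<bullet> ?g x) * exp (- w x))" by simp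
  have "pre_form w (cell_bump L k) (cell_bump L k) = 1 / 2 * (LINT x|lborel. (?g x \<bullet> ?g x) * exp (- w x))"
    by (simp add: pre_form_def)
  also have "\<dots> \<le> 1 / 2 * (LINT x|lborel. (4 * real CARD('n) / L\<^sup>2) * (\<Sum>j\<in>neighbours. indicator (cell L (k + j)) x *\<^sub>R exp (- w x)))"
    by (intro mult_left_mono integral_mono int int' bound) auto
  also have "(LINT x|lborel. (4 * real CARD('n) / L\<^sup>2) * (\<Sum>j\<in>neighbours. indicator (cell L (k + j)) x *\<^sub>R exp (- w x)))
      = (4 * real CARD('n) / L\<^sup>2) * (\<Sum>j\<in>neighbours. cell_mass w L (k + j))"
  proof -
    have "(LINT x|lborel. (\<Sum>j\<in>neighbours. indicator (cell L (k + j)) x *\<^sub>R exp (- w x)))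
        = (\<Sum>j\<in>neighbours. cell_mass w L (k + j))"
      unfolding cell_mass_def set_lebesgue_integral_def
      using exp_cell_integrable[of L] unfolding set_integrable_def
      by (intro Bochner_Integration.integral_sum) auto
    then show ?thesis by simp
  qed
  finally show ?thesis by simp
qed

text \<open>Integrating \<open>2 s - s\<^sup>2 exp w \<le> exp (-w)\<close> turns an upper bound on the mass for \<open>-w\<close> into a lower bound for \<open>w\<close>.\<close>

lemma cell_mass_lower:
  fixes k :: "int ^ 'n"
  assumes L: "1 \<le> L" and M: "cell_mass (\<lambda>x. - w x) L k \<le> M" "0 < M"
  shows "1 / M \<le> cell_mass w L k"
proof -
  define V where "V = L ^ CARD('n)"
  have V: "1 \<le> V" using L by (simp add: V_def)
  \<comment> \<open>The value that maximizes the resulting bound \<open>2 s V - s\<^sup>2 M\<close>.\<close>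
  define s where "s = V / M"
  have pw: "2 * s - s\<^sup>2 * exp (w x) \<le> exp (- w x)" for x
  proof -
    have "0 \<le> exp (- w x) * (1 - s * exp (w x))\<^sup>2" by simp
    also have "\<dots> = exp (- w x) - 2 * s * (exp (- w x) * exp (w x)) + s\<^sup>2 * exp (w x) * (exp (- w x) * exp (w x))"
      by (simp add: power2_eq_square algebra_simps)
    also have "exp (- w x) * exp (w x) = 1" by (simp add: exp_add[symmetric])
    finally show ?thesis by simp
  qed
  have i1: "set_integrable lborel (cell L k) (\<lambda>x. exp (w x))"
    by (intro cell_integrable continuous_intros continuous_w)
  have i2: "set_integrable lborel (cell L k) (\<lambda>x. 2 * s - s\<^sup>2 * exp (w x))"
    by (intro cell_integrable continuous_intros continuous_w)
  have i3: "set_integrable lborel (cell L k) (\<lambda>x. 2 * s)"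
    by (intro cell_integrable continuous_intros)
  have "(LINT x:cell L k|lborel. 2 * s - s\<^sup>2 * exp (w x)) = 2 * s * V - s\<^sup>2 * cell_mass (\<lambda>x. - w x) L k"
    using L i1 i3 by (subst set_integral_diff) (auto simp: cell_integral_const cell_mass_def V_def)
  moreover have "(LINT x:cell L k|lborel. 2 * s - s\<^sup>2 * exp (w x)) \<le> cell_mass w L k"
    unfolding cell_mass_def by (rule set_integral_mono[OF i2 exp_cell_integrable]) (rule pw)
  moreover have "s\<^sup>2 * cell_mass (\<lambda>x. - w x) L k \<le> s\<^sup>2 * M" using M by (intro mult_left_mono) auto
  moreover have "2 * s * V - s\<^sup>2 * M = V\<^sup>2 / M"
    using M by (simp add: s_def power2_eq_square field_simps)
  moreover have "1 / M \<le> V\<^sup>2 / M" using V M by (intro divide_right_mono) auto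
  ultimately show ?thesis by linarith
qed

lemma cell_mass_pos: "1 \<le> L \<Longrightarrow> 0 < cell_mass w L k"
proof -
  assume L: "1 \<le> L"
  define M where "M = max 1 (cell_mass (\<lambda>x. - w x) L k)"
  have "1 / M \<le> cell_mass w L k" by (rule cell_mass_lower[OF L]) (auto simp: M_def)
  moreover have "0 < 1 / M" by (simp add: M_def)
  ultimately show ?thesis by linarith
qed

text \<open>The masses for \<open>w\<close> and for \<open>-w\<close>, relative to the value at the origin. The constant \<open>1/8\<close> only has to be small: the
  argument below compares cells at distances \<open>N\<close> and \<open>2 N\<close>.\<close>

definition subexponential_cells :: bool where
  "subexponential_cells \<longleftrightarrow> (\<forall>L::nat. 1 \<le> L \<longrightarrow> (\<forall>\<^sub>F N in sequentially. \<forall>k. (\<forall>i. \<bar>k $ i\<bar> \<le> int N) \<longrightarrow>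
      exp (w 0) * cell_mass w (real L) k \<le> exp (real N / 8) \<and>
      exp (- w 0) * cell_mass (\<lambda>x. - w x) (real L) k \<le> exp (real N / 8)))"

text \<open>If every far cell had a neighbour of more than \<open>e\<close> times its mass, following such neighbours from a cell at
  distance \<open>N\<close> would produce a cell at distance at most \<open>2 N\<close> whose mass is exponentially large in \<open>N\<close>.\<close>

lemma exists_far_good_cell:
  fixes L :: nat and m :: nat
  assumes sub: subexponential_cells and L: "1 \<le> L"
  shows "\<exists>k. (\<exists>i. int m \<le> \<bar>k $ i\<bar>) \<and> (\<forall>j\<in>neighbours. cell_mass w L (k + j) \<le> exp 1 * cell_mass w L k)"
proof (rule ccontr)
  assume "\<not> ?thesis"
  then have bad: "\<exists>j\<in>neighbours. exp 1 * cell_mass w L k < cell_mass w L (k + j)"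
    if "\<exists>i. int m \<le> \<bar>k $ i\<bar>" for k :: "int ^ 'n"
    using that by force
  obtain N0 where N0: "\<And>N k. N \<ge> N0 \<Longrightarrow> (\<forall>i. \<bar>k $ i\<bar> \<le> int N) \<Longrightarrow>
      exp (w 0) * cell_mass w (real L) k \<le> exp (real N / 8) \<and>
      exp (- w 0) * cell_mass (\<lambda>x. - w x) (real L) k \<le> exp (real N / 8)"
    using sub L unfolding subexponential_cells_def eventually_sequentially by meson
  \<comment> \<open>Starting at distance \<open>N\<close>, a path of \<open>N - m \<ge> N/2\<close> steps stays outside the distance \<open>m\<close>. Its gain \<open>exp (N/2)\<close>
     exceeds the ratio \<open>exp (2 N/8 + N/8)\<close> of the bounds.\<close>
  define N where "N = N0 + 2 * m + 1"
  define k0 :: "int ^ 'n" where "k0 = (\<chi> i. int N)"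
  have path: "t \<le> N - m \<Longrightarrow> \<exists>k. (\<forall>i. \<bar>k $ i - k0 $ i\<bar> \<le> int t) \<and> exp (real t) * cell_mass w L k0 \<le> cell_mass w L k" for t
  proof (induction t)
    case 0
    then show ?case by (intro exI[of _ k0]) auto
  next
    case (Suc t)
    then obtain k where k: "\<And>i. \<bar>k $ i - k0 $ i\<bar> \<le> int t" "exp (real t) * cell_mass w L k0 \<le> cell_mass w L k" by auto
    have "int m \<le> \<bar>k $ i\<bar>" for i using k(1)[of i] Suc.prems by (simp add: k0_def N_def)
    then obtain j where j: "j \<in> neighbours" "exp 1 * cell_mass w L k < cell_mass w L (k + j)"
      using bad[of k] by blast
    have "\<bar>(k + j) $ i - k0 $ i\<bar> \<le> int (Suc t)" for i
    proof -
      have "\<bar>j $ i\<bar> \<le> 1" using j(1) by (simp add: neighbours_def)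
      then show ?thesis using k(1)[of i] by simp
    qed
    moreover have "exp (real (Suc t)) * cell_mass w L k0 \<le> cell_mass w L (k + j)"
    proof -
      have "exp (real (Suc t)) * cell_mass w L k0 = exp 1 * (exp (real t) * cell_mass w L k0)"
        by (simp add: exp_add)
      also have "\<dots> \<le> exp 1 * cell_mass w L k" using k(2) by (intro mult_left_mono) auto
      finally show ?thesis using j(2) by linarith
    qed
    ultimately show ?case by blast
  qed
  obtain k where k: "\<And>i. \<bar>k $ i - k0 $ i\<bar> \<le> int (N - m)"
    "exp (real (N - m)) * cell_mass w L k0 \<le> cell_mass w L k"
    using path[of "N - m"] by auto
  have "\<bar>k $ i\<bar> \<le> int (2 * N)" for i using k(1)[of i] by (simp add: k0_def N_def)
  then have up: "exp (w 0) * cell_mass w L k \<le> exp (real (2 * N) / 8)"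
    using N0[of "2 * N" k] by (simp add: N_def)
  have "exp (- w 0) * cell_mass (\<lambda>x. - w x) L k0 \<le> exp (real N / 8)"
    using N0[of N k0] by (simp add: k0_def N_def)
  then have "cell_mass (\<lambda>x. - w x) L k0 \<le> exp (w 0) * exp (real N / 8)"
    by (simp add: exp_minus field_simps)
  then have "1 / (exp (w 0) * exp (real N / 8)) \<le> cell_mass w L k0"
    using L by (intro cell_mass_lower) auto
  then have low: "exp (- (real N / 8)) \<le> exp (w 0) * cell_mass w L k0"
    by (simp add: exp_minus field_simps)
  have "exp (real (N - m) - real N / 8) = exp (real (N - m)) * exp (- (real N / 8))"
    by (simp add: exp_add[symmetric])
  also have "\<dots> \<le> exp (real (N - m)) * (exp (w 0) * cell_mass w L k0)"
    using low by (intro mult_left_mono) auto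
  also have "\<dots> = exp (w 0) * (exp (real (N - m)) * cell_mass w L k0)" by simp
  also have "\<dots> \<le> exp (w 0) * cell_mass w L k" using k(2) by (intro mult_left_mono) auto
  also have "\<dots> \<le> exp (real (2 * N) / 8)" by (rule up)
  finally have "real (N - m) - real N / 8 \<le> real (2 * N) / 8" by simp
  moreover have "real (N - m) = real N - real m" "real N = real N0 + 2 * real m + 1" "real (2 * N) = 2 * real N"
    by (simp_all add: N_def)
  moreover have "0 \<le> real N0" "0 \<le> real m" by simp_all
  ultimately show False by linarith
qed

text \<open>The Rayleigh quotient of the bump at a good cell is at most a constant times \<open>L\<^sup>-\<^sup>2\<close>, with a constant that only depends
  on the dimension; the side \<open>L\<close> is chosen accordingly. Good cells are picked farther and farther out, so that the
  supports of the bumps are disjoint.\<close>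

lemma low_energy_of_subexponential_cells:
  assumes sub: subexponential_cells and \<eta>: "0 < \<eta>"
  shows "\<exists>u k. F.low_energy \<eta> u k"
proof -
  define C where "C = 2 * real CARD('n) * (real (card (neighbours)) * exp 1) * exp (4 * real CARD('n))"
  have C0: "0 \<le> C" by (simp add: C_def)
  obtain L0 :: nat where L0: "C / \<eta> < real L0" using reals_Archimedean2 by blast
  define L where "L = Suc L0"
  have L: "1 \<le> L" "0 < real L" "1 \<le> real L" by (auto simp: L_def)
  have "C / \<eta> \<le> real L * 1" using L0 by (simp add: L_def)
  also have "\<dots> \<le> real L * real L" using L by (intro mult_left_mono) auto
  finally have CL: "C / (real L)\<^sup>2 \<le> \<eta>" using \<eta> L by (simp add: field_simps power2_eq_square)
  define good where "good k \<longleftrightarrow> (\<forall>j\<in>neighbours. cell_mass w L (k + j) \<le> exp 1 * cell_mass w L k)" for k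
  have energy: "pre_form w (cell_bump L k) (cell_bump L k) \<le> \<eta> * l2_inner (mu w) (cell_bump L k) (cell_bump L k)"
    if "good k" for k
  proof -
    let ?I = "l2_inner (mu w) (cell_bump L k) (cell_bump L k)"
    have "(\<Sum>j\<in>neighbours. cell_mass w L (k + j)) \<le> (\<Sum>j\<in>neighbours. exp 1 * cell_mass w L k)"
      using that unfolding good_def by (intro sum_mono) auto
    then have s: "(\<Sum>j\<in>neighbours. cell_mass w L (k + j)) \<le> real (card neighbours) * exp 1 * cell_mass w L k" by simp
    have n: "cell_mass w L k \<le> exp (4 * real CARD('n)) * ?I"
      using cell_bump_norm[OF L(2), of k] by (simp add: exp_minus field_simps)
    have "pre_form w (cell_bump L k) (cell_bump L k)
        \<le> (2 * real CARD('n) / (real L)\<^sup>2) * (real (card neighbours) * exp 1 * cell_mass w L k)"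
      by (rule order_trans[OF cell_bump_energy[OF L(2)] mult_left_mono[OF s]]) auto
    also have "\<dots> \<le> (2 * real CARD('n) / (real L)\<^sup>2) * (real (card neighbours) * exp 1 * (exp (4 * real CARD('n)) * ?I))"
      using n by (intro mult_left_mono) auto
    also have "\<dots> = (C / (real L)\<^sup>2) * ?I" by (simp add: C_def)
    also have "\<dots> \<le> \<eta> * ?I" using CL by (intro mult_right_mono l2_inner_nonneg)
    finally show ?thesis .
  qed
  define b where "b k = (\<Sum>i\<in>UNIV. \<bar>k $ i\<bar>)" for k :: "int ^ 'n"
  have bi: "\<bar>k $ i\<bar> \<le> b k" for k i unfolding b_def by (intro member_le_sum) auto
  have b0: "0 \<le> b k" for k by (simp add: b_def sum_nonneg)
  have ex: "\<exists>k'. good k' \<and> (\<exists>i. b k + 4 \<le> \<bar>k' $ i\<bar>)" for k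
    using exists_far_good_cell[OF sub L(1), of "nat (b k + 4)"] b0[of k] unfolding good_def by auto
  \<comment> \<open>Two bumps overlap only if the indices of their cells differ by less than \<open>3\<close> in every coordinate.\<close>
  have "\<exists>s. \<forall>n. good (s n) \<and> (\<exists>i. b (s n) + 4 \<le> \<bar>s (Suc n) $ i\<bar>)"
    by (rule dependent_nat_choice) (use ex in blast)+
  then obtain s where s: "\<And>n. good (s n)" "\<And>n. \<exists>i. b (s n) + 4 \<le> \<bar>s (Suc n) $ i\<bar>" by blast
  have mono: "b (s m) \<le> b (s n)" if "m \<le> n" for m n
  proof (rule lift_Suc_mono_le[OF _ that])
    fix n
    obtain i where "b (s n) + 4 \<le> \<bar>s (Suc n) $ i\<bar>" using s(2) by blast
    then show "b (s n) \<le> b (s (Suc n))" using bi[of "s (Suc n)" i] by linarith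
  qed
  have disj: "cell_bump L (s m) x = 0 \<or> cell_bump L (s n) x = 0" if mn: "m < n" for m n x
  proof (rule ccontr)
    assume "\<not> ?thesis"
    then have nz: "cell_bump L (s m) x \<noteq> 0" "cell_bump L (s n) x \<noteq> 0" by auto
    obtain n' where n': "n = Suc n'" "m \<le> n'" using mn by (cases n) auto
    obtain i where i: "b (s n') + 4 \<le> \<bar>s n $ i\<bar>" using s(2)[of n'] n' by blast
    have "L * (real_of_int (s m $ i) - 1) < L * (real_of_int (s n $ i) + 2)" "L * (real_of_int (s n $ i) - 1) < L * (real_of_int (s m $ i) + 2)"
      using cell_bump_support[OF nz(1), of i] cell_bump_support[OF nz(2), of i] by linarith+
    then have "real_of_int (s m $ i) - 1 < real_of_int (s n $ i) + 2"
      "real_of_int (s n $ i) - 1 < real_of_int (s m $ i) + 2" using L by simp_all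
    then have "\<bar>s n $ i - s m $ i\<bar> < 3" by linarith
    moreover have "\<bar>s m $ i\<bar> \<le> b (s n')" using bi[of "s m" i] mono[OF n'(2)] by linarith
    ultimately show False using i by linarith
  qed
  show ?thesis
  proof (rule low_energy_of_test_functions)
    show "cell_bump L (s n) \<in> test_functions" for n by (rule cell_bump_test[OF L(2)])
    show "0 \<le> cell_bump L (s n) x" for n x by (simp add: cell_bump_def bump_range(1)[OF L(2)])
    show "cell_bump L (s i) x = 0 \<or> cell_bump L (s j) x = 0" if "i \<noteq> j" for i j x
      using disj[of i j x] disj[of j i x] that by (cases "i < j") auto
    show "0 < l2_inner (mu w) (cell_bump L (s n)) (cell_bump L (s n))" for n
      using cell_bump_norm[OF L(2), of "s n"] cell_mass_pos[OF L(3), of "s n"]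
      by (smt (verit) exp_gt_zero zero_less_mult_iff)
    show "pre_form w (cell_bump L (s n)) (cell_bump L (s n)) \<le> \<eta> * l2_inner (mu w) (cell_bump L (s n)) (cell_bump L (s n))" for n
      by (rule energy[OF s(1)])
  qed
qed

theorem noncompact_of_subexponential_cells:
  assumes subexponential_cells
  shows "noncompact_semigroup w" "lambda_ess w = 0"
proof -
  obtain u k where "F.low_energy 1 u k" using low_energy_of_subexponential_cells[OF assms, of 1] by auto
  then show "noncompact_semigroup w" by (rule noncompactI) simp
  show "lambda_ess w = 0" by (rule lambda_ess_eq_0[OF low_energy_of_subexponential_cells[OF assms]])
qed

end

section \<open>Gaussian increments\<close>

text \<open>Completing the square in the Gaussian density.\<close>

lemma nn_integral_exp_gaussian:
  assumes Q: "prob_space Q" and X: "centered_gaussian Q X"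
  shows "(\<integral>\<^sup>+ \<omega>. ennreal (exp (t * X \<omega>)) \<partial>Q) = ennreal (exp (t\<^sup>2 * (LINT \<omega>|Q. (X \<omega>)\<^sup>2) / 2))"
proof -
  interpret Q: prob_space Q by (rule Q)
  have Xm: "X \<in> borel_measurable Q" using X by (simp add: centered_gaussian_def)
  consider "AE \<omega> in Q. X \<omega> = 0"
    | s where "s > 0" "distributed Q lborel X (\<lambda>x. ennreal (normal_density 0 s x))"
    using X unfolding centered_gaussian_def by blast
  then show ?thesis
  proof cases
    case 1
    have "(\<integral>\<^sup>+ \<omega>. ennreal (exp (t * X \<omega>)) \<partial>Q) = (\<integral>\<^sup>+ \<omega>. 1 \<partial>Q)"
      by (rule nn_integral_cong_AE) (use 1 in eventually_elim, simp)
    moreover have "(LINT \<omega>|Q. (X \<omega>)\<^sup>2) = (LINT \<omega>|Q. 0)"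
      by (rule integral_cong_AE) (use Xm 1 in auto)
    ultimately show ?thesis by (simp add: Q.emeasure_space_1)
  next
    case (2 s)
    have "Q.expectation X = 0" by (rule Q.normal_distributed_expectation[OF 2])
    then have var: "(LINT \<omega>|Q. (X \<omega>)\<^sup>2) = s\<^sup>2"
      using Q.normal_distributed_variance[OF 2] by simp
    have dens: "normal_density 0 s x * exp (t * x) = exp (t\<^sup>2 * s\<^sup>2 / 2) * normal_density (t * s\<^sup>2) s x" for x
    proof -
      have "- x\<^sup>2 / (2 * s\<^sup>2) + t * x = t\<^sup>2 * s\<^sup>2 / 2 + - (x - t * s\<^sup>2)\<^sup>2 / (2 * s\<^sup>2)"
        using 2(1) by (simp add: power2_eq_square field_simps)
      then have "exp (- x\<^sup>2 / (2 * s\<^sup>2)) * exp (t * x) = exp (t\<^sup>2 * s\<^sup>2 / 2) * exp (- (x - t * s\<^sup>2)\<^sup>2 / (2 * s\<^sup>2))"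
        unfolding exp_add[symmetric] by simp
      then show ?thesis by (simp add: normal_density_def)
    qed
    have "(\<integral>\<^sup>+ \<omega>. ennreal (exp (t * X \<omega>)) \<partial>Q) = (\<integral>\<^sup>+ x. ennreal (normal_density 0 s x) * ennreal (exp (t * x)) \<partial>lborel)"
      by (rule distributed_nn_integral[OF 2(2), symmetric]) measurable
    also have "\<dots> = (\<integral>\<^sup>+ x. ennreal (exp (t\<^sup>2 * s\<^sup>2 / 2)) * ennreal (normal_density (t * s\<^sup>2) s x) \<partial>lborel)"
      by (simp add: ennreal_mult'[symmetric] dens)
    also have "\<dots> = ennreal (exp (t\<^sup>2 * s\<^sup>2 / 2)) * (\<integral>\<^sup>+ x. ennreal (normal_density (t * s\<^sup>2) s x) \<partial>lborel)"
      by (rule nn_integral_cmult) measurable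
    also have "(\<integral>\<^sup>+ x. ennreal (normal_density (t * s\<^sup>2) s x) \<partial>lborel) = 1"
      using 2(1) by (subst nn_integral_eq_integral) auto
    finally show ?thesis by (simp add: var)
  qed
qed

lemma dyadic_bracket:
  fixes r :: real
  assumes "1 \<le> r"
  shows "\<exists>n. r \<le> 2 ^ n \<and> 2 ^ n \<le> 2 * r"
proof -
  have ex: "\<exists>n. r \<le> 2 ^ n" using real_arch_pow[of 2 r] by (auto intro: less_imp_le)
  define n where "n = (LEAST n. r \<le> 2 ^ n)"
  have n: "r \<le> 2 ^ n" unfolding n_def by (rule LeastI_ex[OF ex])
  moreover have "2 ^ n \<le> 2 * r"
  proof (cases n)
    case (Suc m)
    then have "\<not> r \<le> 2 ^ m" using not_less_Least[of m "\<lambda>n. r \<le> 2 ^ n"] by (simp add: n_def)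
    then show ?thesis using Suc by simp
  qed (use assms in simp)
  ultimately show ?thesis by blast
qed

text \<open>A regularly varying function of index \<open>\<beta> < 1\<close> grows by a factor less than \<open>2\<^sup>q\<close>, \<open>q = (1 + \<beta>)/2\<close>, under
  doubling.\<close>

lemma regularly_varying_growth:
  fixes \<sigma> :: "real \<Rightarrow> real"
  assumes mono: "mono_on {0..} \<sigma>" and pos: "\<And>r. 0 \<le> r \<Longrightarrow> 0 \<le> \<sigma> r"
    and rv: "regularly_varying_at_infinity \<sigma> \<beta>" and \<beta>: "0 < \<beta>" "\<beta> < 1"
  shows "\<exists>q C. 0 < q \<and> q < 1 \<and> 0 \<le> C \<and> (\<forall>r\<ge>1. \<sigma> r \<le> C * r powr q)"
proof -
  define q where "q = (1 + \<beta>) / 2"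
  have q: "0 < q" "q < 1" "\<beta> < q" using \<beta> by (auto simp: q_def)
  have "((\<lambda>x. \<sigma> (2 * x) / \<sigma> x) \<longlongrightarrow> 2 powr \<beta>) at_top" "\<forall>\<^sub>F x in at_top. \<sigma> x > 0"
    using rv unfolding regularly_varying_at_infinity_def by auto
  moreover have "(2::real) powr \<beta> < 2 powr q" using q by simp
  ultimately have "\<forall>\<^sub>F x in at_top. \<sigma> (2 * x) / \<sigma> x < 2 powr q \<and> \<sigma> x > 0"
    by (intro eventually_conj order_tendstoD(2))
  then obtain r1 where r1: "\<And>x. x \<ge> r1 \<Longrightarrow> \<sigma> (2 * x) / \<sigma> x < 2 powr q \<and> \<sigma> x > 0"
    unfolding eventually_at_top_linorder by blast
  define r0 where "r0 = max 1 r1"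
  have r0: "1 \<le> r0" by (simp add: r0_def)
  have double: "\<sigma> (2 * x) \<le> 2 powr q * \<sigma> x" if "x \<ge> r0" for x
    using r1[of x] that by (auto simp: r0_def pos_divide_less_eq)
  have iter: "\<sigma> (2 ^ n * r0) \<le> (2 powr q) ^ n * \<sigma> r0" for n
  proof (induction n)
    case (Suc n)
    have "1 * r0 \<le> 2 ^ n * r0" using r0 by (intro mult_right_mono) auto
    then have "\<sigma> (2 * (2 ^ n * r0)) \<le> 2 powr q * \<sigma> (2 ^ n * r0)" by (intro double) simp
    also have "\<dots> \<le> 2 powr q * ((2 powr q) ^ n * \<sigma> r0)" using Suc by (intro mult_left_mono) auto
    finally show ?case by (simp add: mult.assoc)
  qed simp
  have "\<sigma> r \<le> (2 powr q * \<sigma> r0) * r powr q" if r: "1 \<le> r" for r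
  proof -
    obtain n where n: "r \<le> 2 ^ n" "2 ^ n \<le> 2 * r" using dyadic_bracket[OF r] by blast
    have "2 ^ n * 1 \<le> 2 ^ n * r0" using r0 by (intro mult_left_mono) auto
    then have "r \<le> 2 ^ n * r0" using n(1) by linarith
    then have "\<sigma> r \<le> \<sigma> (2 ^ n * r0)" using r r0 by (intro mono_onD[OF mono]) auto
    also have "\<dots> \<le> (2 powr q) ^ n * \<sigma> r0" by (rule iter)
    also have "(2 powr q) ^ n = (2 ^ n) powr q"
      by (simp add: powr_powr powr_realpow[symmetric] mult.commute)
    also have "\<dots> * \<sigma> r0 \<le> (2 * r) powr q * \<sigma> r0"
      using n(2) q r0 by (intro mult_right_mono powr_mono2 pos) auto
    also have "(2 * r) powr q = 2 powr q * r powr q" using r by (simp add: powr_mult)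
    finally show ?thesis by (simp add: mult_ac)
  qed
  moreover have "0 \<le> 2 powr q * \<sigma> r0" using pos[of r0] r0 by simp
  ultimately show ?thesis using q by blast
qed

text \<open>The largest of the exponents serves for the sum.\<close>

lemma sum_squares_growth:
  fixes \<sigma> :: "nat \<Rightarrow> real \<Rightarrow> real"
  assumes "finite I" and "\<And>i r. i \<in> I \<Longrightarrow> 0 \<le> r \<Longrightarrow> 0 \<le> \<sigma> i r"
    and "\<And>i. i \<in> I \<Longrightarrow> \<exists>q C. 0 < q \<and> q < 1 \<and> 0 \<le> C \<and> (\<forall>r\<ge>1. \<sigma> i r \<le> C * r powr q)"
  shows "\<exists>q C. 0 < q \<and> q < 1 \<and> 0 \<le> C \<and> (\<forall>r\<ge>1. (\<Sum>i\<in>I. (\<sigma> i r)\<^sup>2) \<le> C * r powr (2 * q))"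
  using assms
proof (induction I rule: finite_induct)
  case empty
  show ?case by (intro exI[of _ "1/2"] exI[of _ 0]) auto
next
  case (insert i I)
  obtain q C where q: "0 < q" "q < 1" "0 \<le> C" "\<And>r. 1 \<le> r \<Longrightarrow> (\<Sum>i\<in>I. (\<sigma> i r)\<^sup>2) \<le> C * r powr (2 * q)"
    using insert.IH insert.prems by (metis insertCI)
  obtain p D where p: "0 < p" "p < 1" "0 \<le> D" "\<And>r. 1 \<le> r \<Longrightarrow> \<sigma> i r \<le> D * r powr p"
    using insert.prems(2)[of i] by auto
  define m where "m = max p q"
  have m: "0 < m" "m < 1" "p \<le> m" "q \<le> m" using p q by (auto simp: m_def)
  have "(\<Sum>i\<in>insert i I. (\<sigma> i r)\<^sup>2) \<le> (D\<^sup>2 + C) * r powr (2 * m)" if r: "1 \<le> r" for r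
  proof -
    have "(\<sigma> i r)\<^sup>2 \<le> (D * r powr p)\<^sup>2"
      using p(4)[OF r] insert.prems(1)[of i r] r by (intro power_mono) auto
    also have "\<dots> = D\<^sup>2 * r powr (2 * p)"
      using r by (simp add: power_mult_distrib power2_eq_square powr_add[symmetric])
    also have "\<dots> \<le> D\<^sup>2 * r powr (2 * m)" using m r by (intro mult_left_mono powr_mono) auto
    finally have 1: "(\<sigma> i r)\<^sup>2 \<le> D\<^sup>2 * r powr (2 * m)" .
    have "C * r powr (2 * q) \<le> C * r powr (2 * m)" using m r q(3) by (intro mult_left_mono powr_mono) auto
    then have 2: "(\<Sum>i\<in>I. (\<sigma> i r)\<^sup>2) \<le> C * r powr (2 * m)" using q(4)[OF r] by linarith
    show ?thesis using 1 2 insert.hyps by (simp add: distrib_right)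
  qed
  moreover have "0 \<le> D\<^sup>2 + C" using q(3) by simp
  ultimately show ?case using m by blast
qed

section \<open>The mass of cells in a random potential\<close>

locale continuous_field = prob_space Q for Q :: "'w measure" +
  fixes W :: "real ^ 'n \<Rightarrow> 'w \<Rightarrow> real"
  assumes W_measurable: "W x \<in> borel_measurable Q"
    and W_continuous: "\<omega> \<in> space Q \<Longrightarrow> continuous_on UNIV (\<lambda>x. W x \<omega>)"
begin

lemma grid_tendsto:
  fixes x :: "real ^ 'n"
  shows "(\<lambda>n. (\<chi> i. of_int \<lfloor>(real n + 1) * x $ i\<rfloor> / (real n + 1))) \<longlonglongrightarrow> x"
proof (rule vec_tendstoI)
  fix i
  have "(\<lambda>n. of_int \<lfloor>(real n + 1) * x $ i\<rfloor> / (real n + 1) - x $ i) \<longlonglongrightarrow> 0"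
  proof (rule Lim_null_comparison[OF _ inverse_Suc_tendsto_0])
    have "norm (of_int \<lfloor>(real n + 1) * x $ i\<rfloor> / (real n + 1) - x $ i) \<le> 1 / (real n + 1)" for n
    proof -
      have "of_int \<lfloor>(real n + 1) * x $ i\<rfloor> / (real n + 1) - x $ i
          = (of_int \<lfloor>(real n + 1) * x $ i\<rfloor> - (real n + 1) * x $ i) / (real n + 1)"
        by (simp add: field_simps)
      moreover have "\<bar>of_int \<lfloor>(real n + 1) * x $ i\<rfloor> - (real n + 1) * x $ i\<bar> \<le> 1" by linarith
      ultimately show ?thesis by (simp add: divide_right_mono)
    qed
    then show "\<forall>\<^sub>F n in sequentially. norm (of_int \<lfloor>(real n + 1) * x $ i\<rfloor> / (real n + 1) - x $ i) \<le> 1 / (real n + 1)"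
      by simp
  qed
  then show "(\<lambda>n. (\<chi> i. of_int \<lfloor>(real n + 1) * x $ i\<rfloor> / (real n + 1)) $ i) \<longlonglongrightarrow> x $ i"
    by (simp add: LIM_zero_iff)
qed

text \<open>By continuity \<open>W\<close> is the limit of its values at the lattice points of finer and finer grids, and these depend on the
  position through countably many values only.\<close>

lemma W_jointly_measurable: "(\<lambda>p. W (fst p) (snd p)) \<in> borel_measurable (lborel \<Otimes>\<^sub>M Q)"
proof (rule borel_measurable_LIMSEQ_real)
  let ?idx = "\<lambda>n x. (\<chi> i. \<lfloor>(real n + 1) * x $ i\<rfloor>) :: int ^ 'n"
  let ?pt = "\<lambda>n k. (\<chi> i. of_int (k $ i) / (real n + 1)) :: real ^ 'n"
  fix p :: "(real ^ 'n) \<times> 'w" assume p: "p \<in> space (lborel \<Otimes>\<^sub>M Q)"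
  have c: "continuous_on UNIV (\<lambda>x. W x (snd p))" using p by (intro W_continuous) (auto simp: space_pair_measure)
  have "(\<lambda>n. W (\<chi> i. of_int \<lfloor>(real n + 1) * fst p $ i\<rfloor> / (real n + 1)) (snd p)) \<longlonglongrightarrow> W (fst p) (snd p)"
    by (rule continuous_on_tendsto_compose[OF c grid_tendsto]) auto
  then show "(\<lambda>n. W (?pt n (?idx n (fst p))) (snd p)) \<longlonglongrightarrow> W (fst p) (snd p)" by simp
next
  let ?idx = "\<lambda>n x. (\<chi> i. \<lfloor>(real n + 1) * x $ i\<rfloor>) :: int ^ 'n"
  let ?pt = "\<lambda>n k. (\<chi> i. of_int (k $ i) / (real n + 1)) :: real ^ 'n"
  fix n
  have idx: "?idx n \<in> measurable lborel (count_space UNIV)"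
  proof (subst measurable_count_space_eq_countable)
    show "countable (UNIV :: (int ^ 'n) set)" by simp
    have "?idx n -` {k} = cell (1 / (real n + 1)) k" for k
    proof -
      have "\<lfloor>(real n + 1) * y\<rfloor> = m \<longleftrightarrow> (1 / (real n + 1)) * m \<le> y \<and> y < (1 / (real n + 1)) * (of_int m + 1)" for y m
        by (simp add: floor_eq_iff field_simps)
      note eq = this
      show ?thesis by (intro set_eqI) (simp add: cell_def vec_eq_iff eq)
    qed
    then show "?idx n \<in> space lborel \<rightarrow> UNIV \<and> (\<forall>a\<in>UNIV. ?idx n -` {a} \<inter> space lborel \<in> sets lborel)"
      by (simp add: cell_measurable)
  qed
  have "(\<lambda>p. W (?pt n (?idx n (fst p))) (snd p)) \<in> borel_measurable (lborel \<Otimes>\<^sub>M Q)"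
  proof (rule measurable_compose_countable[where f = "\<lambda>k p. W (?pt n k) (snd p)" and g = "\<lambda>p. ?idx n (fst p)"])
    show "(\<lambda>p. W (?pt n k) (snd p)) \<in> borel_measurable (lborel \<Otimes>\<^sub>M Q)" for k
      by (rule measurable_compose[OF measurable_snd W_measurable])
    show "(\<lambda>p. ?idx n (fst p)) \<in> measurable (lborel \<Otimes>\<^sub>M Q) (count_space UNIV)"
      by (rule measurable_compose[OF measurable_fst idx])
  qed
  then show "(\<lambda>p. W (?pt n (?idx n (fst p))) (snd p)) \<in> borel_measurable (lborel \<Otimes>\<^sub>M Q)" .
qed

end

definition corner :: "real \<Rightarrow> int ^ 'n \<Rightarrow> real ^ 'n" where
  "corner L k = (\<chi> i. L * k $ i)"

lemma norm_corner_le: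
  fixes k :: "int ^ 'n"
  assumes "0 \<le> L" "\<And>i. \<bar>k $ i\<bar> \<le> int N"
  shows "norm (corner L k) \<le> real CARD('n) * L * real N"
proof -
  have "norm (corner L k) \<le> (\<Sum>i\<in>UNIV. \<bar>corner L k $ i\<bar>)" by (rule norm_le_l1_cart)
  also have "\<dots> \<le> (\<Sum>i\<in>(UNIV :: 'n set). L * real N)"
  proof (rule sum_mono)
    fix i
    have "\<bar>real_of_int (k $ i)\<bar> \<le> real N" using assms(2)[of i] by linarith
    then show "\<bar>corner L k $ i\<bar> \<le> L * real N"
      using assms(1) by (simp add: corner_def abs_mult mult_left_mono)
  qed
  finally show ?thesis by simp
qed

lemma norm_corner_diff_le:
  fixes k :: "int ^ 'n"
  assumes "x \<in> cell L k"
  shows "norm (corner L k - x) \<le> real CARD('n) * L"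
proof -
  have "norm (corner L k - x) \<le> (\<Sum>i\<in>UNIV. \<bar>(corner L k - x) $ i\<bar>)" by (rule norm_le_l1_cart)
  also have "\<dots> \<le> (\<Sum>i\<in>(UNIV :: 'n set). L)"
  proof (rule sum_mono)
    fix i
    have "L * k $ i \<le> x $ i" "x $ i < L * (real_of_int (k $ i) + 1)" using assms by (auto simp: cell_def)
    then show "\<bar>(corner L k - x) $ i\<bar> \<le> L" by (simp add: corner_def algebra_simps)
  qed
  finally show ?thesis by simp
qed

text \<open>The moment generating function is that of Gaussian increments whose variance \<open>V\<close> depends on the difference of the
  points. The function \<open>S\<close> bounds the variance over balls.\<close>

locale stationary_field = continuous_field Q W for Q :: "'w measure" and W :: "real ^ 'n \<Rightarrow> 'w \<Rightarrow> real" +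
  fixes V :: "real ^ 'n \<Rightarrow> real" and S :: "real \<Rightarrow> real" and C q :: real
  assumes mgf: "(\<integral>\<^sup>+ \<omega>. ennreal (exp (t * (W x \<omega> - W y \<omega>))) \<partial>Q) = ennreal (exp (t\<^sup>2 * V (x - y) / 2))"
    and V_le: "norm z \<le> r \<Longrightarrow> V z \<le> S r"
    and S_growth: "1 \<le> r \<Longrightarrow> S r \<le> C * r powr (2 * q)"
    and C_q: "0 \<le> C" "0 < q" "q < 1"
begin

text \<open>The mass of a cell after the value of the potential at its corner is subtracted. Here \<open>s\<close> is \<open>1\<close> or \<open>-1\<close>, for the
  potentials \<open>W\<close> and \<open>-W\<close>.\<close>

definition local_mass :: "real \<Rightarrow> real \<Rightarrow> int ^ 'n \<Rightarrow> 'w \<Rightarrow> ennreal" where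
  "local_mass s L k \<omega> = (\<integral>\<^sup>+ x. ennreal (exp (s * (W (corner L k) \<omega> - W x \<omega>))) * indicator (cell L k) x \<partial>lborel)"

lemma joint_exp_measurable:
  "(\<lambda>p. ennreal (exp (s * (W a (snd p) - W (fst p) (snd p)))) * indicator (cell L k) (fst p)) \<in> borel_measurable (lborel \<Otimes>\<^sub>M Q)"
proof -
  have 1: "(\<lambda>p. W a (snd p)) \<in> borel_measurable (lborel \<Otimes>\<^sub>M Q)"
    by (rule measurable_compose[OF measurable_snd W_measurable])
  have 2: "(\<lambda>p. indicator (cell L k) (fst p) :: ennreal) \<in> borel_measurable (lborel \<Otimes>\<^sub>M Q)"
    by (rule measurable_compose[OF measurable_fst]) (simp add: cell_measurable)
  show ?thesis using 1 2 W_jointly_measurable by measurable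
qed

lemma local_mass_measurable: "local_mass s L k \<in> borel_measurable Q"
proof -
  have "(\<lambda>(\<omega>, x). ennreal (exp (s * (W (corner L k) \<omega> - W x \<omega>))) * indicator (cell L k) x) \<in> borel_measurable (Q \<Otimes>\<^sub>M lborel)"
    using measurable_compose[OF measurable_pair_swap' joint_exp_measurable]
    by (simp add: case_prod_beta' comp_def)
  then show ?thesis unfolding local_mass_def[abs_def]
    by (rule lborel.borel_measurable_nn_integral)
qed

text \<open>By Tonelli's theorem it suffices to bound the exponential moments of the increments over one cell, which are the
  same for all cells.\<close>

lemma local_mass_expectation:
  assumes s: "s\<^sup>2 = 1" and L: "0 < L"
  shows "(\<integral>\<^sup>+ \<omega>. local_mass s L k \<omega> \<partial>Q) \<le> ennreal (exp (S (real CARD('n) * L) / 2) * L ^ CARD('n))"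
proof -
  interpret P: pair_sigma_finite lborel Q ..
  have "(\<integral>\<^sup>+ \<omega>. local_mass s L k \<omega> \<partial>Q)
      = (\<integral>\<^sup>+ x. (\<integral>\<^sup>+ \<omega>. ennreal (exp (s * (W (corner L k) \<omega> - W x \<omega>))) * indicator (cell L k) x \<partial>Q) \<partial>lborel)"
    unfolding local_mass_def
    using P.Fubini[OF joint_exp_measurable[of s "corner L k" L k]] by simp
  also have "\<dots> \<le> (\<integral>\<^sup>+ x. ennreal (exp (S (real CARD('n) * L) / 2)) * indicator (cell L k) x \<partial>lborel)"
  proof (rule nn_integral_mono)
    fix x
    show "(\<integral>\<^sup>+ \<omega>. ennreal (exp (s * (W (corner L k) \<omega> - W x \<omega>))) * indicator (cell L k) x \<partial>Q)
        \<le> ennreal (exp (S (real CARD('n) * L) / 2)) * indicator (cell L k) x"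
    proof (cases "x \<in> cell L k")
      case True
      have "V (corner L k - x) \<le> S (real CARD('n) * L)" by (rule V_le[OF norm_corner_diff_le[OF True]])
      then show ?thesis using True by (simp add: mgf s)
    qed simp
  qed
  also have "\<dots> = ennreal (exp (S (real CARD('n) * L) / 2)) * emeasure lborel (cell L k)"
    by (simp add: nn_integral_cmult_indicator cell_measurable)
  finally show ?thesis using L by (simp add: emeasure_cell ennreal_mult)
qed

text \<open>The exponential Markov inequality. The variance is at most of order \<open>N\<^sup>2\<^sup>q\<close>, and with \<open>t = N\<^sup>-\<^sup>q\<close> the exponential moment is
  bounded uniformly in \<open>N\<close>, while the threshold contributes \<open>exp (- t N/16)\<close>.\<close>

lemma increment_tail:
  assumes s: "s\<^sup>2 = 1" and L: "1 \<le> L" and N: "1 \<le> N" and k: "\<And>i. \<bar>k $ i\<bar> \<le> int N"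
  shows "emeasure Q {\<omega> \<in> space Q. real N / 16 \<le> s * (W 0 \<omega> - W (corner L k) \<omega>)}
    \<le> ennreal (exp (C * (real CARD('n) * L) powr (2 * q)) * exp (- (real N powr (1 - q) / 16)))"
proof -
  define t where "t = real N powr (- q)"
  have t: "0 < t" using N by (simp add: t_def)
  let ?X = "\<lambda>\<omega>. ennreal (exp ((t * s) * (W 0 \<omega> - W (corner L k) \<omega>)))"
  let ?c = "ennreal (exp (- (t * real N / 16)))"
  have Xm: "?X \<in> borel_measurable Q" using W_measurable by measurable
  have "{\<omega> \<in> space Q. real N / 16 \<le> s * (W 0 \<omega> - W (corner L k) \<omega>)} \<subseteq> {\<omega> \<in> space Q. 1 \<le> ?c * ?X \<omega>}"
  proof (safe)
    fix \<omega> assume "\<omega> \<in> space Q" "real N / 16 \<le> s * (W 0 \<omega> - W (corner L k) \<omega>)"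
    then have "t * (real N / 16) \<le> t * (s * (W 0 \<omega> - W (corner L k) \<omega>))" using t by (intro mult_left_mono) auto
    then have "exp 0 \<le> exp (- (t * real N / 16) + (t * s) * (W 0 \<omega> - W (corner L k) \<omega>))"
      by (subst exp_le_cancel_iff) (simp add: mult.assoc)
    then show "1 \<le> ?c * ?X \<omega>"
      unfolding ennreal_mult'[symmetric, OF less_imp_le[OF exp_gt_zero]] exp_add[symmetric]
      by (simp add: ennreal_leI flip: ennreal_1)
  qed
  then have "emeasure Q {\<omega> \<in> space Q. real N / 16 \<le> s * (W 0 \<omega> - W (corner L k) \<omega>)}
      \<le> emeasure Q {\<omega> \<in> space Q. 1 \<le> ?c * ?X \<omega>}"
    by (rule emeasure_mono) (use Xm in measurable)
  also have "\<dots> \<le> ?c * (\<integral>\<^sup>+ \<omega>. ?X \<omega> * indicator (space Q) \<omega> \<partial>Q)"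
    by (rule nn_integral_Markov_inequality[where A = "space Q"]) (use Xm in measurable)
  also have "(\<integral>\<^sup>+ \<omega>. ?X \<omega> * indicator (space Q) \<omega> \<partial>Q) = (\<integral>\<^sup>+ \<omega>. ?X \<omega> \<partial>Q)"
    by (intro nn_integral_cong) auto
  also have "\<dots> = ennreal (exp ((t * s)\<^sup>2 * V (0 - corner L k) / 2))" by (rule mgf)
  also have "?c * \<dots> = ennreal (exp (- (t * real N / 16)) * exp ((t * s)\<^sup>2 * V (0 - corner L k) / 2))"
    by (simp add: ennreal_mult)
  also have "\<dots> \<le> ennreal (exp (C * (real CARD('n) * L) powr (2 * q)) * exp (- (real N powr (1 - q) / 16)))"
  proof (rule ennreal_leI)
    have n1: "1 \<le> real CARD('n) * L * real N"
    proof -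
      have "1 * 1 * 1 \<le> real CARD('n) * L * real N"
        using L N by (intro mult_mono) (auto simp: Suc_leI)
      then show ?thesis by simp
    qed
    have "V (0 - corner L k) \<le> S (real CARD('n) * L * real N)"
      using norm_corner_le[of L k N] L k by (intro V_le) simp
    also have "\<dots> \<le> C * (real CARD('n) * L * real N) powr (2 * q)" by (rule S_growth[OF n1])
    also have "\<dots> = C * (real CARD('n) * L) powr (2 * q) * real N powr (2 * q)"
      using L by (simp add: powr_mult)
    finally have "t\<^sup>2 * V (0 - corner L k) \<le> t\<^sup>2 * (C * (real CARD('n) * L) powr (2 * q) * real N powr (2 * q))"
      by (intro mult_left_mono) auto
    also have "t\<^sup>2 = real N powr (- (2 * q))"
      using N by (simp add: t_def power2_eq_square powr_add[symmetric])
    also have "real N powr (- (2 * q)) * (C * (real CARD('n) * L) powr (2 * q) * real N powr (2 * q))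
        = C * (real CARD('n) * L) powr (2 * q) * (real N powr (- (2 * q)) * real N powr (2 * q))" by simp
    also have "real N powr (- (2 * q)) * real N powr (2 * q) = 1"
      using N by (simp add: powr_add[symmetric])
    finally have b: "real N powr (- (2 * q)) * V (0 - corner L k) \<le> C * (real CARD('n) * L) powr (2 * q)"
      by simp
    have "(t * s)\<^sup>2 = t * t" using s by (simp add: power_mult_distrib power2_eq_square)
    also have "\<dots> = real N powr (- (2 * q))" unfolding t_def powr_add[symmetric] by simp
    finally have ts: "(t * s)\<^sup>2 = real N powr (- (2 * q))" .
    have "(t * s)\<^sup>2 * V (0 - corner L k) / 2 \<le> C * (real CARD('n) * L) powr (2 * q) / 2"
      unfolding ts using b by simp
    also have "\<dots> \<le> C * (real CARD('n) * L) powr (2 * q)" using C_q by simp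
    finally have 1: "(t * s)\<^sup>2 * V (0 - corner L k) / 2 \<le> C * (real CARD('n) * L) powr (2 * q)" .
    have "t * real N = real N powr (- q) * real N powr 1" using N by (simp add: t_def)
    also have "\<dots> = real N powr (1 - q)" unfolding powr_add[symmetric] by simp
    finally have 2: "t * real N = real N powr (1 - q)" .
    show "exp (- (t * real N / 16)) * exp ((t * s)\<^sup>2 * V (0 - corner L k) / 2)
        \<le> exp (C * (real CARD('n) * L) powr (2 * q)) * exp (- (real N powr (1 - q) / 16))"
      unfolding exp_add[symmetric] exp_le_cancel_iff 2 using 1 by linarith
  qed
  finally show ?thesis .
qed

lemma local_mass_tail:
  assumes s: "s\<^sup>2 = 1" and L: "0 < L"
  shows "emeasure Q {\<omega> \<in> space Q. ennreal (exp (real N / 16)) \<le> local_mass s L k \<omega>}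
    \<le> ennreal (exp (S (real CARD('n) * L) / 2) * L ^ CARD('n) * exp (- (real N / 16)))"
proof -
  let ?c = "ennreal (exp (- (real N / 16)))"
  have e: "?c * ennreal (exp (real N / 16)) = 1"
    by (simp add: ennreal_mult'[symmetric] exp_add[symmetric])
  have "{\<omega> \<in> space Q. ennreal (exp (real N / 16)) \<le> local_mass s L k \<omega>} \<subseteq> {\<omega> \<in> space Q. 1 \<le> ?c * local_mass s L k \<omega>}"
    by (auto simp: e[symmetric] intro: mult_left_mono)
  then have "emeasure Q {\<omega> \<in> space Q. ennreal (exp (real N / 16)) \<le> local_mass s L k \<omega>}
      \<le> emeasure Q {\<omega> \<in> space Q. 1 \<le> ?c * local_mass s L k \<omega>}"
    by (rule emeasure_mono) (use local_mass_measurable in measurable)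
  also have "\<dots> \<le> ?c * (\<integral>\<^sup>+ \<omega>. local_mass s L k \<omega> * indicator (space Q) \<omega> \<partial>Q)"
    by (rule nn_integral_Markov_inequality[where A = "space Q"]) (use local_mass_measurable in measurable)
  also have "(\<integral>\<^sup>+ \<omega>. local_mass s L k \<omega> * indicator (space Q) \<omega> \<partial>Q) = (\<integral>\<^sup>+ \<omega>. local_mass s L k \<omega> \<partial>Q)"
    by (intro nn_integral_cong) auto
  also have "?c * \<dots> \<le> ?c * ennreal (exp (S (real CARD('n) * L) / 2) * L ^ CARD('n))"
    by (intro mult_left_mono local_mass_expectation s L) simp
  finally show ?thesis using L by (simp add: ennreal_mult[symmetric] mult_ac)
qed

text \<open>The thresholds \<open>N/16\<close> for the value at the corner and for the logarithm of the local mass add up to \<open>N/8\<close>.\<close>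

definition bad_event :: "real \<Rightarrow> nat \<Rightarrow> real \<Rightarrow> int ^ 'n \<Rightarrow> 'w set" where
  "bad_event L N s k = {\<omega> \<in> space Q. real N / 16 \<le> s * (W 0 \<omega> - W (corner L k) \<omega>)} \<union>
     {\<omega> \<in> space Q. ennreal (exp (real N / 16)) \<le> local_mass s L k \<omega>}"

definition bad_stage :: "real \<Rightarrow> nat \<Rightarrow> 'w set" where
  "bad_stage L N = (\<Union>p\<in>{1, - 1} \<times> {k. \<forall>i. \<bar>k $ i\<bar> \<le> int N}. bad_event L N (fst p) (snd p))"

lemma bad_event_sets:
  "{\<omega> \<in> space Q. real N / 16 \<le> s * (W 0 \<omega> - W (corner L k) \<omega>)} \<in> sets Q"
  "{\<omega> \<in> space Q. ennreal (exp (real N / 16)) \<le> local_mass s L k \<omega>} \<in> sets Q"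
  "bad_event L N s k \<in> sets Q"
proof -
  show 1: "{\<omega> \<in> space Q. real N / 16 \<le> s * (W 0 \<omega> - W (corner L k) \<omega>)} \<in> sets Q"
    using W_measurable by measurable
  show 2: "{\<omega> \<in> space Q. ennreal (exp (real N / 16)) \<le> local_mass s L k \<omega>} \<in> sets Q"
    using local_mass_measurable by measurable
  show "bad_event L N s k \<in> sets Q" unfolding bad_event_def using 1 2 by (rule sets.Un)
qed

lemma bad_stage_sets: "bad_stage L N \<in> sets Q"
  unfolding bad_stage_def using bad_event_sets(3) finite_int_vectors[of "int N"]
  by (intro sets.finite_UN) auto

definition tail :: "real \<Rightarrow> nat \<Rightarrow> real" where
  "tail L N = exp (C * (real CARD('n) * L) powr (2 * q)) * exp (- (real N powr (1 - q) / 16)) +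
     exp (S (real CARD('n) * L) / 2) * L ^ CARD('n) * exp (- (real N / 16))"

lemma bad_stage_measure:
  assumes L: "1 \<le> L" and N: "1 \<le> N"
  shows "measure Q (bad_stage L N) \<le> 2 * (2 * real N + 1) ^ CARD('n) * tail L N"
proof -
  let ?K = "{k :: int ^ 'n. \<forall>i. \<bar>k $ i\<bar> \<le> int N}"
  let ?I = "{1, - 1 :: real} \<times> ?K"
  have finK: "finite ?K" by (rule finite_int_vectors)
  have tail0: "0 \<le> tail L N" using L by (simp add: tail_def add_nonneg_nonneg)
  have "emeasure Q (bad_event L N (fst p) (snd p)) \<le> ennreal (tail L N)" if p: "p \<in> ?I" for p
  proof -
    have s: "(fst p)\<^sup>2 = 1" and k: "\<And>i. \<bar>snd p $ i\<bar> \<le> int N" using p by auto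
    have "emeasure Q (bad_event L N (fst p) (snd p))
        \<le> ennreal (exp (C * (real CARD('n) * L) powr (2 * q)) * exp (- (real N powr (1 - q) / 16)))
          + ennreal (exp (S (real CARD('n) * L) / 2) * L ^ CARD('n) * exp (- (real N / 16)))"
      unfolding bad_event_def
      using L by (intro order_trans[OF emeasure_subadditive[OF bad_event_sets(1,2)]] add_mono
          increment_tail[OF s L N k] local_mass_tail[OF s]) auto
    also have "\<dots> = ennreal (tail L N)"
      unfolding tail_def using L by (subst ennreal_plus) auto
    finally show ?thesis .
  qed
  then have "emeasure Q (bad_stage L N) \<le> (\<Sum>p\<in>?I. ennreal (tail L N))"
    unfolding bad_stage_def using finK bad_event_sets(3)
    by (intro order_trans[OF emeasure_subadditive_finite] sum_mono) auto
  also have "\<dots> = ennreal (real (card ?I) * tail L N)"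
    using tail0 by (simp add: ennreal_mult ennreal_of_nat_eq_real_of_nat)
  finally have "measure Q (bad_stage L N) \<le> real (card ?I) * tail L N"
    using tail0 by (simp add: emeasure_eq_measure)
  also have "\<dots> \<le> (2 * (2 * real N + 1) ^ CARD('n)) * tail L N"
  proof (rule mult_right_mono[OF _ tail0])
    have "card ?I = 2 * card ?K" by (simp add: card_cartesian_product)
    also have "\<dots> \<le> 2 * nat (2 * int N + 1) ^ CARD('n)" by (intro mult_left_mono card_int_vectors) auto
    also have "nat (2 * int N + 1) = 2 * N + 1" by simp
    finally have "real (card ?I) \<le> real (2 * (2 * N + 1) ^ CARD('n))" by (rule of_nat_mono)
    then show "real (card ?I) \<le> 2 * (2 * real N + 1) ^ CARD('n)" by (simp add: add.commute)
  qed
  finally show ?thesis .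
qed

lemma summable_bad_stage:
  assumes L: "1 \<le> L"
  shows "summable (\<lambda>N. measure Q (bad_stage L N))"
proof (rule summable_comparison_test_ev)
  show "\<forall>\<^sub>F N in sequentially. norm (measure Q (bad_stage L N)) \<le> 2 * (2 * real N + 1) ^ CARD('n) * tail L N"
    using eventually_ge_at_top[of 1] by eventually_elim (use bad_stage_measure[OF L] in auto)
  have a: "0 < 1 - q" using C_q by simp
  have 1: "(\<lambda>N::nat. (2 * real N + 1) ^ CARD('n) * exp (- (real N powr (1 - q) / 16))) \<in> O(\<lambda>N. 1 / real N ^ 2)"
    using a by real_asymp
  have 2: "(\<lambda>N::nat. (2 * real N + 1) ^ CARD('n) * exp (- (real N / 16))) \<in> O(\<lambda>N. 1 / real N ^ 2)"
    by real_asymp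
  have sq: "summable (\<lambda>N. norm (1 / real N ^ 2))" using inverse_power_summable[of 2, where 'a = real] by (simp add: inverse_eq_divide)
  have s1: "summable (\<lambda>N::nat. (2 * real N + 1) ^ CARD('n) * exp (- (real N powr (1 - q) / 16)))"
    by (rule summable_comparison_test_bigo[OF sq 1])
  have s2: "summable (\<lambda>N::nat. (2 * real N + 1) ^ CARD('n) * exp (- (real N / 16)))"
    by (rule summable_comparison_test_bigo[OF sq 2])
  have "(\<lambda>N::nat. 2 * (2 * real N + 1) ^ CARD('n) * tail L N)
      = (\<lambda>N. (2 * exp (C * (real CARD('n) * L) powr (2 * q))) * ((2 * real N + 1) ^ CARD('n) * exp (- (real N powr (1 - q) / 16)))
        + (2 * (exp (S (real CARD('n) * L) / 2) * L ^ CARD('n))) * ((2 * real N + 1) ^ CARD('n) * exp (- (real N / 16))))"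
    by (simp add: fun_eq_iff tail_def algebra_simps)
  then show "summable (\<lambda>N::nat. 2 * (2 * real N + 1) ^ CARD('n) * tail L N)"
    by (simp only:) (intro summable_add summable_mult s1 s2)
qed

text \<open>The mass of a cell factors into the exponential of the increment to its corner and the local mass.\<close>

lemma cell_mass_le_outside_bad_stage:
  assumes \<omega>: "\<omega> \<in> space Q - bad_stage L N" and s: "s = 1 \<or> s = - 1" and k: "\<And>i. \<bar>k $ i\<bar> \<le> int N"
  shows "exp (s * W 0 \<omega>) * cell_mass (\<lambda>x. s * W x \<omega>) L k \<le> exp (real N / 8)"
proof -
  have \<omega>Q: "\<omega> \<in> space Q" using \<omega> by simp
  have "\<omega> \<notin> bad_event L N s k"
  proof
    assume "\<omega> \<in> bad_event L N s k"
    moreover have "(s, k) \<in> {1, - 1} \<times> {k. \<forall>i. \<bar>k $ i\<bar> \<le> int N}" using s k by auto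
    ultimately have "\<omega> \<in> bad_stage L N" unfolding bad_stage_def by force
    with \<omega> show False by simp
  qed
  then have 1: "s * (W 0 \<omega> - W (corner L k) \<omega>) \<le> real N / 16" and 2: "local_mass s L k \<omega> \<le> ennreal (exp (real N / 16))"
    using \<omega>Q by (auto simp: bad_event_def not_le less_imp_le)
  have cont: "continuous_on UNIV (\<lambda>x. s * W x \<omega>)" by (intro continuous_intros W_continuous \<omega>Q)
  let ?f = "\<lambda>x. exp (s * W 0 \<omega>) * (indicator (cell L k) x *\<^sub>R exp (- (s * W x \<omega>)))"
  have int: "integrable lborel ?f"
    using cell_integrable[of "\<lambda>x. exp (- (s * W x \<omega>))" L k] cont
    by (simp add: set_integrable_def continuous_intros)
  have Wm: "(\<lambda>x. W x \<omega>) \<in> borel_measurable borel"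
    by (rule borel_measurable_continuous_onI[OF W_continuous[OF \<omega>Q]])
  have "ennreal (exp (s * W 0 \<omega>) * cell_mass (\<lambda>x. s * W x \<omega>) L k) = ennreal (LINT x|lborel. ?f x)"
    by (simp add: cell_mass_def set_lebesgue_integral_def)
  also have "\<dots> = (\<integral>\<^sup>+ x. ennreal (?f x) \<partial>lborel)"
    by (rule nn_integral_eq_integral[OF int, symmetric]) simp
  also have "\<dots> = (\<integral>\<^sup>+ x. ennreal (exp (s * (W 0 \<omega> - W (corner L k) \<omega>)))
      * (ennreal (exp (s * (W (corner L k) \<omega> - W x \<omega>))) * indicator (cell L k) x) \<partial>lborel)"
  proof (rule nn_integral_cong)
    fix x
    have "exp (s * W 0 \<omega>) * exp (- (s * W x \<omega>))
        = exp (s * (W 0 \<omega> - W (corner L k) \<omega>)) * exp (s * (W (corner L k) \<omega> - W x \<omega>))"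
      unfolding exp_add[symmetric] by (simp add: algebra_simps)
    then show "ennreal (?f x) = ennreal (exp (s * (W 0 \<omega> - W (corner L k) \<omega>)))
        * (ennreal (exp (s * (W (corner L k) \<omega> - W x \<omega>))) * indicator (cell L k) x)"
      by (cases "x \<in> cell L k") (simp_all add: ennreal_mult[symmetric])
  qed
  also have "\<dots> = ennreal (exp (s * (W 0 \<omega> - W (corner L k) \<omega>))) * local_mass s L k \<omega>"
    unfolding local_mass_def
  proof (rule nn_integral_cmult)
    have ind: "(\<lambda>x. indicator (cell L k) x :: ennreal) \<in> borel_measurable lborel"
      by (simp add: cell_measurable)
    have "(\<lambda>x. ennreal (exp (s * (W (corner L k) \<omega> - W x \<omega>)))) \<in> borel_measurable lborel"
      using Wm by measurable
    then show "(\<lambda>x. ennreal (exp (s * (W (corner L k) \<omega> - W x \<omega>))) * indicator (cell L k) x) \<in> borel_measurable lborel"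
      using ind by (rule borel_measurable_times_ennreal)
  qed
  also have "\<dots> \<le> ennreal (exp (real N / 16)) * ennreal (exp (real N / 16))"
    using 1 2 by (intro mult_mono ennreal_leI) auto
  also have "\<dots> = ennreal (exp (real N / 8))"
    by (simp add: ennreal_mult[symmetric] exp_add[symmetric])
  finally show ?thesis by simp
qed

text \<open>The Borel-Cantelli lemma, for all integer side lengths simultaneously.\<close>

theorem AE_noncompact:
  "AE \<omega> in Q. noncompact_semigroup (\<lambda>x. W x \<omega>) \<and> lambda_ess (\<lambda>x. W x \<omega>) = 0"
proof -
  have "AE \<omega> in Q. \<forall>\<^sub>F N in sequentially. \<omega> \<in> space Q - bad_stage (real (Suc j)) N" for j
    by (rule borel_cantelli_AE1)
       (auto intro!: bad_stage_sets summable_bad_stage simp: emeasure_eq_measure)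
  then have "AE \<omega> in Q. \<forall>j. \<forall>\<^sub>F N in sequentially. \<omega> \<in> space Q - bad_stage (real (Suc j)) N"
    by (subst AE_all_countable) blast
  then show ?thesis
    using AE_space
  proof eventually_elim
    case (elim \<omega>)
    have cont: "continuous_on UNIV (\<lambda>x. W x \<omega>)" by (rule W_continuous[OF elim(2)])
    interpret potential "\<lambda>x. W x \<omega>" by standard (rule cont)
    have subexponential_cells
      unfolding subexponential_cells_def
    proof (intro allI impI)
      fix L :: nat assume "1 \<le> L"
      then obtain j where j: "L = Suc j" by (cases L) auto
      have "\<forall>\<^sub>F N in sequentially. \<omega> \<in> space Q - bad_stage (real L) N" using elim(1) j by blast
      then show "\<forall>\<^sub>F N in sequentially. \<forall>k. (\<forall>i. \<bar>k $ i\<bar> \<le> int N) \<longrightarrow>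
          exp (W 0 \<omega>) * cell_mass (\<lambda>x. W x \<omega>) (real L) k \<le> exp (real N / 8) \<and>
          exp (- W 0 \<omega>) * cell_mass (\<lambda>x. - W x \<omega>) (real L) k \<le> exp (real N / 8)"
      proof eventually_elim
        case (elim N)
        show ?case
          using cell_mass_le_outside_bad_stage[OF elim, of 1] cell_mass_le_outside_bad_stage[OF elim, of "- 1"]
          by auto
      qed
    qed
    then show ?case using noncompact_of_subexponential_cells by blast
  qed
qed

end

section \<open>Gaussian environments\<close>

lemma block_norm_le_norm: "block_norm b i x \<le> norm x"
proof -
  have "(\<Sum>j | b j = i. (x $ j)\<^sup>2) \<le> (\<Sum>j\<in>UNIV. (x $ j)\<^sup>2)" by (rule sum_mono2) auto
  also have "\<dots> = (norm x)\<^sup>2" by (simp add: norm_vec_def L2_set_def sum_nonneg)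
  finally show ?thesis unfolding block_norm_def by (simp add: real_le_lsqrt sum_nonneg)
qed

lemma centered_gaussian_increment:
  assumes W: "centered_gaussian_process Q W"
  shows "centered_gaussian Q (\<lambda>\<omega>. W x \<omega> - W y \<omega>)"
proof (cases "x = y")
  case False
  have "centered_gaussian Q (\<lambda>\<omega>. \<Sum>z\<in>{x, y}. (if z = x then 1 else - 1) * W z \<omega>)"
    by (rule W[unfolded centered_gaussian_process_def, rule_format]) simp
  then show ?thesis using False by simp
qed (simp add: centered_gaussian_def)

lemma gaussian_process_measurable:
  assumes W: "centered_gaussian_process Q W"
  shows "W x \<in> borel_measurable Q"
proof -
  have "centered_gaussian Q (\<lambda>\<omega>. \<Sum>z\<in>{x}. 1 * W z \<omega>)"
    by (rule W[unfolded centered_gaussian_process_def, rule_format]) simp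
  then show ?thesis by (simp add: centered_gaussian_def)
qed

text \<open>The norm of a block is at most the norm of the whole vector, so monotonicity of the \<open>\<sigma>\<^sub>i\<close> gives the bound
  \<open>S r = \<Sum>\<^sub>i \<sigma>\<^sub>i(r)\<^sup>2\<close> of the variance on balls, and regular variation its growth.\<close>

lemma AE_noncompact_gaussian_environment:
  fixes W :: "real ^ 'n \<Rightarrow> 'w \<Rightarrow> real"
  assumes Q: "prob_space Q" and W: "centered_gaussian_process Q W"
    and cont: "AE \<omega> in Q. continuous_on UNIV (\<lambda>x. W x \<omega>)" and env: "gaussian_environment Q W \<gamma>"
  shows "AE \<omega> in Q. noncompact_semigroup (\<lambda>x. W x \<omega>) \<and> lambda_ess (\<lambda>x. W x \<omega>) = 0"
proof -
  interpret Q: prob_space Q by (rule Q)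
  have "\<forall>x y. (LINT \<omega>|Q. (W x \<omega> - W y \<omega>)\<^sup>2) = (\<gamma> (x - y))\<^sup>2"
    using env unfolding gaussian_environment_def by (elim conjE)
  then have var: "(LINT \<omega>|Q. (W x \<omega> - W y \<omega>)\<^sup>2) = (\<gamma> (x - y))\<^sup>2" for x y by blast
  obtain l :: nat and b :: "'n \<Rightarrow> nat" and \<sigma> :: "nat \<Rightarrow> real \<Rightarrow> real" where
    mono_pos: "\<forall>i\<in>{1..l}. mono_on {0..} (\<sigma> i) \<and> (\<forall>r\<ge>0. \<sigma> i r \<ge> 0)"
    and \<gamma>_sum: "\<forall>x. (\<gamma> x)\<^sup>2 = (\<Sum>i\<in>{1..l}. (\<sigma> i (block_norm b i x))\<^sup>2)"
    and rv_all: "\<forall>i\<in>{1..l}. \<exists>\<alpha>\<in>{0<..<1}. \<exists>\<beta>\<in>{0<..<1}.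
           regularly_varying_at_zero (\<sigma> i) \<alpha> \<and> regularly_varying_at_infinity (\<sigma> i) \<beta>"
    using env unfolding gaussian_environment_def by (elim conjE exE) (rule that)
  have mono: "mono_on {0..} (\<sigma> i)" and pos: "\<And>r. 0 \<le> r \<Longrightarrow> 0 \<le> \<sigma> i r" if "i \<in> {1..l}" for i
    using mono_pos that by auto
  have \<gamma>: "(\<gamma> x)\<^sup>2 = (\<Sum>i\<in>{1..l}. (\<sigma> i (block_norm b i x))\<^sup>2)" for x using \<gamma>_sum by blast
  have rv: "\<exists>\<beta>\<in>{0<..<1}. regularly_varying_at_infinity (\<sigma> i) \<beta>" if "i \<in> {1..l}" for i
    using rv_all that by blast
  define S where "S r = (\<Sum>i\<in>{1..l}. (\<sigma> i r)\<^sup>2)" for r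
  have "\<exists>q C. 0 < q \<and> q < 1 \<and> 0 \<le> C \<and> (\<forall>r\<ge>1. (\<Sum>i\<in>{1..l}. (\<sigma> i r)\<^sup>2) \<le> C * r powr (2 * q))"
  proof (rule sum_squares_growth)
    fix i assume i: "i \<in> {1..l}"
    obtain \<beta> where "0 < \<beta>" "\<beta> < 1" "regularly_varying_at_infinity (\<sigma> i) \<beta>" using rv[OF i] by auto
    then show "\<exists>q C. 0 < q \<and> q < 1 \<and> 0 \<le> C \<and> (\<forall>r\<ge>1. \<sigma> i r \<le> C * r powr q)"
      by (intro regularly_varying_growth mono pos i)
  qed (use pos in auto)
  then obtain q C where q: "0 < q" "q < 1" "0 \<le> C" and growth: "\<And>r. 1 \<le> r \<Longrightarrow> S r \<le> C * r powr (2 * q)"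
    unfolding S_def by blast
  obtain Z where Z: "{\<omega> \<in> space Q. \<not> continuous_on UNIV (\<lambda>x. W x \<omega>)} \<subseteq> Z" "emeasure Q Z = 0" "Z \<in> sets Q"
    using AE_E[OF cont] by blast
  \<comment> \<open>Continuity of all paths is arranged by setting the field to zero on a null set.\<close>
  define W' where "W' x \<omega> = (if \<omega> \<in> Z then 0 else W x \<omega>)" for x \<omega>
  have ae: "AE \<omega> in Q. \<omega> \<notin> Z" using Z by (intro AE_not_in) (auto simp: null_sets_def)
  interpret stationary_field Q W' "\<lambda>z. (\<gamma> z)\<^sup>2" S C q
  proof
    show "W' x \<in> borel_measurable Q" for x
      unfolding W'_def[abs_def] using gaussian_process_measurable[OF W, of x] Z(3) by measurable
    show "continuous_on UNIV (\<lambda>x. W' x \<omega>)" if "\<omega> \<in> space Q" for \<omega>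
      using Z(1) that by (cases "\<omega> \<in> Z") (auto simp: W'_def)
    show "(\<integral>\<^sup>+ \<omega>. ennreal (exp (t * (W' x \<omega> - W' y \<omega>))) \<partial>Q) = ennreal (exp (t\<^sup>2 * (\<gamma> (x - y))\<^sup>2 / 2))" for t x y
    proof -
      have "(\<integral>\<^sup>+ \<omega>. ennreal (exp (t * (W' x \<omega> - W' y \<omega>))) \<partial>Q) = (\<integral>\<^sup>+ \<omega>. ennreal (exp (t * (W x \<omega> - W y \<omega>))) \<partial>Q)"
        by (rule nn_integral_cong_AE) (use ae in eventually_elim, simp add: W'_def)
      also have "\<dots> = ennreal (exp (t\<^sup>2 * (\<gamma> (x - y))\<^sup>2 / 2))"
        using nn_integral_exp_gaussian[OF Q centered_gaussian_increment[OF W], of t x y] by (simp add: var)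
      finally show ?thesis .
    qed
    show "(\<gamma> z)\<^sup>2 \<le> S r" if z: "norm z \<le> r" for z r
      unfolding \<gamma> S_def
    proof (rule sum_mono)
      fix i assume i: "i \<in> {1..l}"
      have b0: "0 \<le> block_norm b i z" by (simp add: block_norm_def sum_nonneg)
      have br: "block_norm b i z \<le> r" using block_norm_le_norm[of b i z] z by linarith
      have "\<sigma> i (block_norm b i z) \<le> \<sigma> i r"
        by (rule mono_onD[OF mono[OF i]]) (use b0 br in auto)
      then show "(\<sigma> i (block_norm b i z))\<^sup>2 \<le> (\<sigma> i r)\<^sup>2"
        by (rule power_mono) (rule pos[OF i b0])
    qed
  qed (use q growth in auto)
  show ?thesis
    using AE_noncompact ae
  proof eventually_elim
    case (elim \<omega>)
    then show ?case by (simp add: W'_def)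
  qed
qed

theorem theorem3p2:
  fixes Q :: "'w measure"
    and W :: "real ^ 'n \<Rightarrow> 'w \<Rightarrow> real"
    and \<gamma> :: "real ^ 'n \<Rightarrow> real"
  assumes "prob_space Q"
    and "centered_gaussian_process Q W"
    and "AE \<omega> in Q. continuous_on UNIV (\<lambda>x. W x \<omega>)"
    and "gaussian_environment Q W \<gamma>"
  shows "(Limsup at_infinity
            (\<lambda>x. ereal (\<gamma> x * sqrt (ln (ln (norm x))) / norm x)) < \<infinity> \<longrightarrow>
          (AE \<omega> in Q. noncompact_semigroup (\<lambda>x. W x \<omega>))) \<and>
         ((\<exists>p\<in>{0<..<1}. Limsup at_infinity
            (\<lambda>x. ereal (\<gamma> x * sqrt (ln (ln (norm x))) / norm x powr p)) = 0) \<longrightarrow>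
          (AE \<omega> in Q. lambda_ess (\<lambda>x. W x \<omega>) = 0))"
proof -
  note main = AE_noncompact_gaussian_environment[OF assms]
  have "AE \<omega> in Q. noncompact_semigroup (\<lambda>x. W x \<omega>)" using main by eventually_elim simp
  moreover have "AE \<omega> in Q. lambda_ess (\<lambda>x. W x \<omega>) = 0" using main by eventually_elim simp
  ultimately show ?thesis by blast
qed

end
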